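(* Let $n\ge 1$ and let $U\in C^\infty(\mathbb{R}^n)$ satisfy $Z=\int_{\mathbb{R}^n}e^{-U}\,dx<\infty$. For $x\in\mathbb{R}^n$ define the symmetric $n\times n$ matrix $\widetilde{\mathrm{Hess}}(U)(x)$ by $$\big(\widetilde{\mathrm{Hess}}(U)(x)\big)_{ij}=\begin{cases}\lambda_1^{x_{\backslash i}}, & i=j,\\ \partial_{ij}U(x), & i\neq j.\end{cases}$$ Then $$\lambda_1(U)\ \ge\ \inf_{x\in\mathbb{R}^n}\lambda_{\min}\big(\widetilde{\mathrm{Hess}}(U)(x)\big)\ \ge\ \inf_{x\in\mathbb{R}^n}\ \sup_{w}\ \min_{1\le i\le n}\Big(\lambda_1^{x_{\backslash i}}-\sum_{j:\,j\ne i}|\partial_{ij}U(x)|\,\frac{w_j}{w_i}\Big),$$ where $w=(w_i)_{i=1}^n$ varies over all positive sequences (i.e. $w_i>0$ for all $i$).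
   Context: Let $d\mu_U=e^{-U}dx/Z$, a probability measure on $\mathbb{R}^n$. The spectral gap $\lambda_1(U)$ is the largest constant $\kappa$ such that $\kappa\,\mathrm{Var}_{\mu_U}(f)\le\int_{\mathbb{R}^n}|\nabla f|^2\,d\mu_U$ for all $f\in C_0^\infty(\mathbb{R}^n)$ (smooth functions with compact support), where $\mathrm{Var}_{\mu_U}(f)$ is the variance of $f$ under $\mu_U$. For $x=(x_1,\dots,x_n)\in\mathbb{R}^n$, $x_{\backslash i}\in\mathbb{R}^{n-1}$ denotes the vector obtained from $x$ by removing the $i$-th component. The conditional distribution of $x_i$ given $x_{\backslash i}$ is the probability measure on $\mathbb{R}$ $\mu_U^{x_{\backslash i}}(dx_i)=e^{-U(x)}dx_i/Z(x_{\backslash i})$, with $Z(x_{\backslash i})=\int_{\mathbb{R}}e^{-U(x)}dx_i$, assumed finite for all $i$ and all $x_{\backslash i}$. The quantity $\lambda_1^{x_{\backslash i}}$ is the one-dimensional spectral gap of this marginal: the largest constant such that $\lambda_1^{x_{\backslash i}}\,\mathrm{Var}_{\mu_U^{x_{\backslash i}}}(f)\le\int_{\mathbb{R}}(f')^2\,d\mu_U^{x_{\backslash i}}$ for all $f\in C_0^\infty(\mathbb{R})$. $\partial_{ij}U=\partial^2U/\partial x_i\partial x_j$, and $\lambda_{\min}(M)$ is the minimal eigenvalue of a symmetric matrix $M$. *)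

theory Defs
  imports "HOL-Probability.Probability"
begin

definition partial_deriv :: "'a::euclidean_space \<Rightarrow> ('a \<Rightarrow> real) \<Rightarrow> 'a \<Rightarrow> real" where
  "partial_deriv b f x = frechet_derivative f (at x) b"

definition gradient :: "('a::euclidean_space \<Rightarrow> real) \<Rightarrow> 'a \<Rightarrow> 'a" where
  "gradient f x = (\<Sum>b\<in>Basis. partial_deriv b f x *\<^sub>R b)"

primrec C_k :: "nat \<Rightarrow> ('a::euclidean_space \<Rightarrow> real) \<Rightarrow> bool" where
  "C_k 0 f \<longleftrightarrow> continuous_on UNIV f"
| "C_k (Suc k) f \<longleftrightarrow> f differentiable_on UNIV \<and> (\<forall>b\<in>Basis. C_k k (partial_deriv b f))"

definition smooth :: "('a::euclidean_space \<Rightarrow> real) \<Rightarrow> bool" where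
  "smooth f \<longleftrightarrow> (\<forall>k. C_k k f)"

definition test_function :: "('a::euclidean_space \<Rightarrow> real) \<Rightarrow> bool" where
  "test_function f \<longleftrightarrow> smooth f \<and> compact (closure {x. f x \<noteq> 0})"

definition partition_const :: "('a::euclidean_space \<Rightarrow> real) \<Rightarrow> real" where
  "partition_const U = (\<integral>x. exp (- U x) \<partial>lborel)"

definition gibbs :: "('a::euclidean_space \<Rightarrow> real) \<Rightarrow> 'a measure" where
  "gibbs U = density lborel (\<lambda>x. ennreal (exp (- U x) / partition_const U))"

text \<open>Used both on \<open>real ^ 'n\<close> and, for the conditional distributions, on \<open>real\<close>,
  where \<open>Basis = {1}\<close> and so the integrand on the right is the square of the derivative.
  For integrable \<open>exp (- U x)\<close> with \<open>U\<close> continuous, the set of admissible \<open>\<kappa>\<close> contains \<open>0\<close>, is closed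
  and is bounded above (take any \<open>f\<close> of positive variance), so the greatest element exists.\<close>

definition spectral_gap :: "('a::euclidean_space \<Rightarrow> real) \<Rightarrow> real" where
  "spectral_gap U = (GREATEST \<kappa>. \<forall>f. test_function f \<longrightarrow>
     \<kappa> * prob_space.variance (gibbs U) f \<le> (\<integral>x. (norm (gradient f x))\<^sup>2 \<partial>gibbs U))"

text \<open>\<open>cond_potential U x i\<close> is \<open>U\<close> as a function of the \<open>i\<close>-th coordinate alone, the others being
  frozen at those of \<open>x\<close>; it does not depend on \<open>x $ i\<close>.\<close>

definition cond_potential :: "(real ^ 'n \<Rightarrow> real) \<Rightarrow> real ^ 'n \<Rightarrow> 'n \<Rightarrow> real \<Rightarrow> real" where
  "cond_potential U x i t = U (\<chi> j. if j = i then t else x $ j)"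

definition cond_gap :: "(real ^ 'n \<Rightarrow> real) \<Rightarrow> real ^ 'n \<Rightarrow> 'n \<Rightarrow> real" where
  "cond_gap U x i = spectral_gap (cond_potential U x i)"

definition partial2 :: "'n \<Rightarrow> 'n \<Rightarrow> (real ^ 'n \<Rightarrow> real) \<Rightarrow> real ^ 'n \<Rightarrow> real" where
  "partial2 i j U = partial_deriv (axis i 1) (partial_deriv (axis j 1) U)"

definition Hess_tilde :: "(real ^ 'n \<Rightarrow> real) \<Rightarrow> real ^ 'n \<Rightarrow> real ^ 'n ^ 'n" where
  "Hess_tilde U x = (\<chi> i j. if i = j then cond_gap U x i else partial2 i j U x)"

definition eigenvalues :: "real ^ 'n ^ 'n \<Rightarrow> real set" where
  "eigenvalues A = {c. \<exists>v. v \<noteq> 0 \<and> A *v v = c *\<^sub>R v}"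

definition lambda_min :: "real ^ 'n ^ 'n \<Rightarrow> real" where
  "lambda_min A = Min (eigenvalues A)"

end

theory Submission
  imports Defs
begin

text \<open>Write \<open>\<rho> = exp (- U)\<close> and let \<open>L\<close> be the generator \<open>\<Delta> - \<nabla>U \<cdot> \<nabla>\<close>, the sum over
the coordinate directions \<open>b\<close> of \<open>L\<^sub>b u = \<partial>\<^sub>b \<partial>\<^sub>b u - \<partial>\<^sub>b U \<partial>\<^sub>b u\<close>; it satisfies
\<open>\<integral> u L v \<rho> = - \<integral> \<nabla>u \<cdot> \<nabla>v \<rho>\<close>. The first inequality rests on the fact that a Poincare
inequality with constant \<open>\<kappa> > 0\<close> is the same as \<open>\<kappa> \<integral> |\<nabla>u|\<^sup>2 \<rho> \<le> \<integral> (L u)\<^sup>2 \<rho>\<close> for all test functions.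

From the Poincare inequality to the bound on \<open>L\<close> the argument is short (lemma
\<open>poincare_imp_energy_le\<close>) and is used in dimension one, on every line parallel to an axis. Expand
\<open>(L u)\<^sup>2\<close> into the products \<open>L\<^sub>b u L\<^sub>c u\<close>. For \<open>b \<noteq> c\<close>, integration by parts gives
\<open>\<integral> L\<^sub>b u L\<^sub>c u \<rho> = \<integral> ((\<partial>\<^sub>c \<partial>\<^sub>b u)\<^sup>2 + \<partial>\<^sub>b \<partial>\<^sub>c U \<partial>\<^sub>b u \<partial>\<^sub>c u) \<rho>\<close>, and the square is dropped. For
\<open>b = c\<close> one does not integrate by parts: the one-dimensional gap bounds the integral of
\<open>(L\<^sub>b u)\<^sup>2 \<rho>\<close> along each line below by the gap of that line times the integral of \<open>(\<partial>\<^sub>b u)\<^sup>2 \<rho>\<close>. In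
total \<open>\<integral> (L u)\<^sup>2 \<rho>\<close> dominates the integral of the quadratic form of the modified Hessian at
\<open>\<nabla>u\<close>, hence \<open>\<kappa> \<integral> |\<nabla>u|\<^sup>2 \<rho>\<close> if \<open>\<kappa>\<close> is a lower bound of its smallest eigenvalues
(\<open>energy_le_integral_gen_sq\<close>). The gap of a line is a measurable function of the line because it
is upper semicontinuous (\<open>line_gap_measurable\<close>).

The way back to the Poincare inequality (\<open>poincare_from_generator_bound\<close>) is by duality. For test
functions \<open>f\<close> and \<open>u\<close>, expanding the square gives
\<open>\<integral> (f + L u)\<^sup>2 \<rho> \<ge> \<integral> f\<^sup>2 \<rho> - (1/\<kappa>) \<integral> |\<nabla>f|\<^sup>2 \<rho>\<close>, so it has to be shown that the infimum of the
left side over \<open>u\<close> is \<open>(\<integral> f \<rho>)\<^sup>2 / Z\<close>, that is, that the range of \<open>L\<close> on test functions is dense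
in the functions of mean zero. A minimising sequence converges in \<open>L\<^sup>2\<close> to some \<open>h\<close> orthogonal to
the range (\<open>generator_residual\<close>), so \<open>h\<close> is a square integrable weak solution of \<open>L h = 0\<close>, and
the claim is that \<open>h\<close> is constant.

This Liouville property is proved without elliptic regularity. Convolving \<open>h \<rho>\<close> and \<open>h \<rho> \<nabla>U\<close> with
the same mollifier keeps the weak equation exact: the smooth vector field
\<open>\<nabla>((h \<rho>) * \<eta>) + (h \<rho> \<nabla>U) * \<eta>\<close> is divergence free (\<open>flux_divergence\<close>), and it differs
from \<open>\<rho> \<nabla>(((h \<rho>) * \<eta>) / \<rho>)\<close> by an error that contains no derivative of \<open>h\<close> and so tends to
\<open>0\<close> in \<open>L\<^sup>2\<close> on compact sets. A Caccioppoli estimate with a cutoff \<open>\<phi>\<close>, followed by the limit in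
\<open>\<eta>\<close>, bounds the gradient of \<open>h\<close> in the weak sense by \<open>\<integral> |\<nabla>\<phi>|\<^sup>2 h\<^sup>2 \<rho>\<close>, which is arbitrarily
small for widely spread cutoffs (\<open>weak_gradient_zero\<close>).

The second inequality is linear algebra: Gershgorin's bound after conjugation by the diagonal
matrix of the weights, applied to an eigenvector of the smallest eigenvalue.\<close>

section \<open>Directional derivatives\<close>

text \<open>A derivative along one direction, everywhere on the space and with no differentiability in other
directions: this is all that integration by parts needs, and for convolutions with a rough
function it is easier to establish than a Frechet derivative.\<close>
definition dd :: "'a::euclidean_space \<Rightarrow> ('a \<Rightarrow> real) \<Rightarrow> ('a \<Rightarrow> real) \<Rightarrow> bool" where
  "dd v f f' \<longleftrightarrow> (\<forall>x. ((\<lambda>t. f (x + t *\<^sub>R v)) has_real_derivative f' x) (at 0))"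

lemma ddD: "dd v f f' \<Longrightarrow> ((\<lambda>t. f (x + t *\<^sub>R v)) has_real_derivative f' x) (at 0)"
  by (simp add: dd_def)

lemma dd_line:
  assumes "dd v f f'"
  shows "((\<lambda>t. f (x + t *\<^sub>R v)) has_real_derivative f' (x + t *\<^sub>R v)) (at t)"
proof -
  have "((\<lambda>s. f ((x + t *\<^sub>R v) + s *\<^sub>R v)) has_real_derivative f' (x + t *\<^sub>R v)) (at 0)"
    using assms by (rule ddD)
  then have "((\<lambda>s. f (x + (s + t) *\<^sub>R v)) has_real_derivative f' (x + t *\<^sub>R v)) (at 0)"
    by (simp add: algebra_simps)
  then show ?thesis
    using DERIV_shift[of "\<lambda>t. f (x + t *\<^sub>R v)" "f' (x + t *\<^sub>R v)" 0 t] by simp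
qed

lemma dd_unique: "dd v f f' \<Longrightarrow> dd v f f'' \<Longrightarrow> f' = f''"
  unfolding dd_def by (intro ext) (metis DERIV_unique)

lemma dd_const [intro]: "dd v (\<lambda>x. c) (\<lambda>x. 0)"
  by (simp add: dd_def)

lemma dd_add: "dd v f f' \<Longrightarrow> dd v g g' \<Longrightarrow> dd v (\<lambda>x. f x + g x) (\<lambda>x. f' x + g' x)"
  unfolding dd_def by (auto intro!: derivative_eq_intros)

lemma dd_diff: "dd v f f' \<Longrightarrow> dd v g g' \<Longrightarrow> dd v (\<lambda>x. f x - g x) (\<lambda>x. f' x - g' x)"
  unfolding dd_def by (auto intro!: derivative_eq_intros)

lemma dd_minus: "dd v f f' \<Longrightarrow> dd v (\<lambda>x. - f x) (\<lambda>x. - f' x)"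
  unfolding dd_def by (auto intro!: derivative_eq_intros)

lemma dd_cmult: "dd v f f' \<Longrightarrow> dd v (\<lambda>x. c * f x) (\<lambda>x. c * f' x)"
  unfolding dd_def by (auto intro!: derivative_eq_intros)

lemma dd_mult: "dd v f f' \<Longrightarrow> dd v g g' \<Longrightarrow> dd v (\<lambda>x. f x * g x) (\<lambda>x. f' x * g x + f x * g' x)"
  unfolding dd_def by (auto intro!: derivative_eq_intros)

lemma dd_exp: "dd v f f' \<Longrightarrow> dd v (\<lambda>x. exp (f x)) (\<lambda>x. exp (f x) * f' x)"
  unfolding dd_def by (auto intro!: derivative_eq_intros)

lemma dd_reflect:
  assumes "dd v f f'"
  shows "dd v (\<lambda>y. f (x - y)) (\<lambda>y. - f' (x - y))"
  unfolding dd_def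
proof
  fix y
  have "((\<lambda>t. f ((x - y) + t *\<^sub>R v)) has_real_derivative f' ((x - y) + 0 *\<^sub>R v)) (at (- 0))"
    using assms dd_line[of v f f' "x-y" 0] by simp
  then have "((\<lambda>t. f ((x - y) + (- t) *\<^sub>R v)) has_real_derivative - f' (x - y)) (at 0)"
    by (subst DERIV_mirror[symmetric]) simp
  then show "((\<lambda>t. f (x - (y + t *\<^sub>R v))) has_real_derivative - f' (x - y)) (at 0)"
    by (simp add: algebra_simps)
qed

lemma dd_MVT:
  assumes "dd v f f'" "h \<noteq> 0"
  obtains s where "\<bar>s\<bar> < \<bar>h\<bar>" "0 < s * h" "f (x + h *\<^sub>R v) - f x = h * f' (x + s *\<^sub>R v)"
proof (cases "h > 0")
  case True
  obtain s where "0 < s" "s < h" "f (x + h *\<^sub>R v) - f (x + 0 *\<^sub>R v) = (h - 0) * f' (x + s *\<^sub>R v)"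
    using MVT2[OF True, of "\<lambda>t. f (x + t *\<^sub>R v)" "\<lambda>t. f' (x + t *\<^sub>R v)"] dd_line[OF assms(1)] by blast
  then show ?thesis using that[of s] by (simp add: True)
next
  case False
  then have "h < 0" using assms(2) by simp
  then obtain s where s: "h < s" "s < 0" "f (x + 0 *\<^sub>R v) - f (x + h *\<^sub>R v) = (0 - h) * f' (x + s *\<^sub>R v)"
    using MVT2[of h 0 "\<lambda>t. f (x + t *\<^sub>R v)" "\<lambda>t. f' (x + t *\<^sub>R v)"] dd_line[OF assms(1)] by blast
  then show ?thesis using that[of s] \<open>h < 0\<close> by (simp add: mult_neg_neg)
qed

text \<open>Schwarz's theorem. The mean value theorem, applied twice, expresses the second difference of \<open>f\<close>
over a parallelogram of size \<open>h\<close> as \<open>h\<^sup>2\<close> times either mixed derivative at a point near \<open>x\<close>;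
then \<open>h\<close> tends to \<open>0\<close>.\<close>
lemma dd_commute:
  assumes fb: "dd b f fb" and fc: "dd c f fc" and fcb: "dd c fb fcb" and fbc: "dd b fc fbc"
    and cont: "isCont fcb x" "isCont fbc x"
  shows "fcb x = fbc x"
proof -
  define M where "M = norm b + norm c"
  have "\<exists>p q. norm (p - x) \<le> h * M \<and> norm (q - x) \<le> h * M \<and> fcb p = fbc q" if h: "h > 0" for h
  proof -
    \<comment> \<open>one order of the two mean value steps; the roles of \<open>b\<close> and \<open>c\<close> are exchanged below\<close>
    have ex: "\<exists>p. norm (p - x) \<le> h * (norm b + norm c) \<and>
        f (x + h *\<^sub>R b + h *\<^sub>R c) - f (x + h *\<^sub>R b) - (f (x + h *\<^sub>R c) - f x) = h * (h * fcb p)"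
      if fb: "dd b f fb" and fcb: "dd c fb fcb" for b c fb fcb
    proof -
      have "((\<lambda>s. f ((x + h *\<^sub>R c) + s *\<^sub>R b) - f (x + s *\<^sub>R b)) has_real_derivative
          fb ((x + h *\<^sub>R c) + s *\<^sub>R b) - fb (x + s *\<^sub>R b)) (at s)" for s
        by (intro DERIV_diff dd_line fb)
      then obtain s where s: "0 < s" "s < h"
        "(f ((x + h *\<^sub>R c) + h *\<^sub>R b) - f (x + h *\<^sub>R b)) - (f ((x + h *\<^sub>R c) + 0 *\<^sub>R b) - f (x + 0 *\<^sub>R b))
          = (h - 0) * (fb ((x + h *\<^sub>R c) + s *\<^sub>R b) - fb (x + s *\<^sub>R b))"
        using MVT2[OF h, of "\<lambda>s. f ((x + h *\<^sub>R c) + s *\<^sub>R b) - f (x + s *\<^sub>R b)"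
            "\<lambda>s. fb ((x + h *\<^sub>R c) + s *\<^sub>R b) - fb (x + s *\<^sub>R b)"] by blast
      obtain t where t: "\<bar>t\<bar> < \<bar>h\<bar>" "fb ((x + s *\<^sub>R b) + h *\<^sub>R c) - fb (x + s *\<^sub>R b) = h * fcb ((x + s *\<^sub>R b) + t *\<^sub>R c)"
        using dd_MVT[OF fcb, of h "x + s *\<^sub>R b"] h by (metis less_irrefl)
      have "norm ((x + s *\<^sub>R b) + t *\<^sub>R c - x) \<le> s * norm b + \<bar>t\<bar> * norm c"
        using norm_triangle_ineq[of "s *\<^sub>R b" "t *\<^sub>R c"] s by simp
      also have "\<dots> \<le> h * norm b + h * norm c"
        using s t h by (intro add_mono mult_right_mono) auto
      finally have "norm ((x + s *\<^sub>R b) + t *\<^sub>R c - x) \<le> h * (norm b + norm c)" by (simp add: algebra_simps)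
      moreover have "f (x + h *\<^sub>R b + h *\<^sub>R c) - f (x + h *\<^sub>R b) - (f (x + h *\<^sub>R c) - f x)
          = h * (h * fcb ((x + s *\<^sub>R b) + t *\<^sub>R c))"
        using s(3) t(2) by (simp add: ac_simps)
      ultimately show ?thesis by blast
    qed
    obtain p where p: "norm (p - x) \<le> h * (norm b + norm c)"
        "f (x + h *\<^sub>R b + h *\<^sub>R c) - f (x + h *\<^sub>R b) - (f (x + h *\<^sub>R c) - f x) = h * (h * fcb p)"
      using ex[OF fb fcb] by blast
    obtain q where q: "norm (q - x) \<le> h * (norm c + norm b)"
        "f (x + h *\<^sub>R c + h *\<^sub>R b) - f (x + h *\<^sub>R c) - (f (x + h *\<^sub>R b) - f x) = h * (h * fbc q)"
      using ex[OF fc fbc] by blast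
    have "x + h *\<^sub>R c + h *\<^sub>R b = x + h *\<^sub>R b + h *\<^sub>R c" by simp
    then have "h * (h * fcb p) = h * (h * fbc q)" using p(2) q(2) by (smt (verit))
    then show ?thesis using p(1) q(1) h unfolding M_def by (auto simp: add.commute)
  qed
  then have "\<forall>n. \<exists>p q. norm (p - x) \<le> inverse (real (Suc n)) * M \<and> norm (q - x) \<le> inverse (real (Suc n)) * M \<and> fcb p = fbc q"
    by simp
  then obtain p q where pq: "\<And>n. norm (p n - x) \<le> inverse (real (Suc n)) * M"
      "\<And>n. norm (q n - x) \<le> inverse (real (Suc n)) * M" "\<And>n. fcb (p n) = fbc (q n)"
    by metis
  have lim: "(\<lambda>n. inverse (real (Suc n)) * M) \<longlonglongrightarrow> 0"
    using tendsto_mult_left_zero[OF LIMSEQ_inverse_real_of_nat] .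
  have "p \<longlonglongrightarrow> x" "q \<longlonglongrightarrow> x"
    using pq(1,2) by (auto intro!: LIM_zero_cancel[of _ x] Lim_null_comparison[OF _ lim])
  then have "(\<lambda>n. fcb (p n)) \<longlonglongrightarrow> fcb x" "(\<lambda>n. fbc (q n)) \<longlonglongrightarrow> fbc x"
    using cont by (auto intro: isCont_tendsto_compose)
  then show ?thesis using pq(3) LIMSEQ_unique by auto
qed

section \<open>Continuous functions of compact support\<close>

text \<open>The space usually written \<open>C\<^sub>c\<close>.\<close>
definition Cc :: "('a::euclidean_space \<Rightarrow> real) \<Rightarrow> bool" where
  "Cc f \<longleftrightarrow> continuous_on UNIV f \<and> bounded {x. f x \<noteq> 0}"

lemma Cc_cont: "Cc f \<Longrightarrow> continuous_on UNIV f" by (simp add: Cc_def)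

lemma Cc_measurable: "Cc f \<Longrightarrow> f \<in> borel_measurable borel"
  by (simp add: Cc_def borel_measurable_continuous_onI)

lemma Cc_supportE:
  assumes "Cc f" obtains R where "R > 0" "\<And>x. norm x > R \<Longrightarrow> f x = 0"
proof -
  obtain R where "R > 0" "\<And>x. f x \<noteq> 0 \<Longrightarrow> norm x \<le> R"
    using assms unfolding Cc_def bounded_pos by blast
  then show ?thesis using that by (meson not_le)
qed

lemma CcI: "continuous_on UNIV f \<Longrightarrow> (\<And>x. norm x > R \<Longrightarrow> f x = 0) \<Longrightarrow> Cc f"
  unfolding Cc_def bounded_iff by (metis mem_Collect_eq not_le)

lemma CcI_sub: "continuous_on UNIV f \<Longrightarrow> Cc g \<Longrightarrow> (\<And>x. g x = 0 \<Longrightarrow> f x = 0) \<Longrightarrow> Cc f"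
  unfolding Cc_def by (auto intro: bounded_subset)

lemma Cc_mult1: "continuous_on UNIV g \<Longrightarrow> Cc f \<Longrightarrow> Cc (\<lambda>x. g x * f x)"
  by (rule CcI_sub[of _ f]) (auto intro!: continuous_intros simp: Cc_cont)

lemma Cc_mult2: "continuous_on UNIV g \<Longrightarrow> Cc f \<Longrightarrow> Cc (\<lambda>x. f x * g x)"
  using Cc_mult1[of g f] by (simp add: mult.commute)

lemma Cc_add: assumes "Cc f" "Cc g" shows "Cc (\<lambda>x. f x + g x)"
proof -
  have "bounded ({x. f x \<noteq> 0} \<union> {x. g x \<noteq> 0})" using assms by (simp add: Cc_def)
  then have "bounded {x. f x + g x \<noteq> 0}" by (rule bounded_subset) auto
  then show ?thesis using assms by (auto simp: Cc_def intro!: continuous_intros)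
qed

lemma Cc_zero: "Cc (\<lambda>x. 0)" by (simp add: Cc_def)

lemma Cc_sum: "(\<And>i. i \<in> I \<Longrightarrow> Cc (f i)) \<Longrightarrow> Cc (\<lambda>x. \<Sum>i\<in>I. f i x)"
  by (induction I rule: infinite_finite_induct) (auto simp: Cc_zero Cc_add)

lemma Cc_minus: "Cc f \<Longrightarrow> Cc (\<lambda>x. - f x)"
  using Cc_mult1[of "\<lambda>_. -1" f] by simp

lemma Cc_cmult: "Cc f \<Longrightarrow> Cc (\<lambda>x. c * f x)"
  using Cc_mult1[of "\<lambda>_. c" f] by simp

lemma Cc_diff: "Cc f \<Longrightarrow> Cc g \<Longrightarrow> Cc (\<lambda>x. f x - g x)"
  using Cc_add[of f "\<lambda>x. - g x"] Cc_minus[of g] by simp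

lemma Cc_power2: "Cc f \<Longrightarrow> Cc (\<lambda>x. (f x)\<^sup>2)"
  using Cc_mult1[of f f] by (simp add: power2_eq_square Cc_cont)

lemma Cc_integrable: assumes "Cc f" shows "integrable lborel f"
proof -
  obtain R where R: "R > 0" "\<And>x. norm x > R \<Longrightarrow> f x = 0" using Cc_supportE[OF assms] by blast
  have "integrable lborel (\<lambda>x. indicator (cball 0 R) x *\<^sub>R f x)"
    by (rule borel_integrable_compact) (auto intro: continuous_on_subset[OF Cc_cont[OF assms]])
  also have "(\<lambda>x. indicator (cball 0 R) x *\<^sub>R f x) = f"
    using R by (auto simp: fun_eq_iff indicator_def)
  finally show ?thesis .
qed

lemma Cc_boundE: assumes "Cc f" obtains B where "B > 0" "\<And>x. \<bar>f x\<bar> \<le> B"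
proof -
  obtain R where R: "R > 0" "\<And>x. norm x > R \<Longrightarrow> f x = 0" using Cc_supportE[OF assms] by blast
  have "compact (f ` cball 0 R)"
    by (intro compact_continuous_image continuous_on_subset[OF Cc_cont[OF assms]]) auto
  then have "bounded (f ` cball 0 R)" by (rule compact_imp_bounded)
  then obtain B where B: "B > 0" "\<And>y. y \<in> f ` cball 0 R \<Longrightarrow> \<bar>y\<bar> \<le> B"
    unfolding bounded_pos by auto
  have "\<bar>f x\<bar> \<le> B" for x
    using R(2)[of x] B by (cases "norm x \<le> R") auto
  then show ?thesis using that B(1) by blast
qed

lemma Cc_shift: fixes f :: "'a::euclidean_space \<Rightarrow> real" assumes "Cc f" shows "Cc (\<lambda>x. f (c + x))"
proof -
  obtain R where R: "R > 0" "\<And>x. norm x > R \<Longrightarrow> f x = 0" using Cc_supportE[OF assms] by blast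
  show ?thesis
  proof (rule CcI[of _ "R + norm c"])
    show "continuous_on UNIV (\<lambda>x. f (c + x))"
      by (rule continuous_on_compose2[OF Cc_cont[OF assms]]) (auto intro!: continuous_intros)
    fix x :: 'a assume "R + norm c < norm x"
    then have "norm (c + x) > R" using norm_triangle_ineq4[of "c + x" c] by simp
    then show "f (c + x) = 0" using R by blast
  qed
qed

lemma Cc_reflect: fixes f :: "'a::euclidean_space \<Rightarrow> real" assumes "Cc f" shows "Cc (\<lambda>y. f (x - y))"
proof -
  obtain R where R: "R > 0" "\<And>x. norm x > R \<Longrightarrow> f x = 0" using Cc_supportE[OF assms] by blast
  show ?thesis
  proof (rule CcI[of _ "R + norm x"])
    show "continuous_on UNIV (\<lambda>y. f (x - y))"
      by (rule continuous_on_compose2[OF Cc_cont[OF assms]]) (auto intro!: continuous_intros)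
    fix y :: 'a assume "R + norm x < norm y"
    then have "norm (x - y) > R" using norm_triangle_ineq4[of "x" "x - y"] by simp
    then show "f (x - y) = 0" using R by blast
  qed
qed

lemma lborel_integral_shift:
  fixes f :: "'a::euclidean_space \<Rightarrow> real"
  assumes [measurable]: "f \<in> borel_measurable borel"
  shows "(LBINT x. f (c + x)) = (LBINT x. f x)"
proof -
  have "(LBINT x. f x) = (\<integral>x. f x \<partial>(distr lborel borel ((+) c)))"
    by (simp add: lborel_distr_plus)
  also have "\<dots> = (LBINT x. f (c + x))"
    by (subst integral_distr) auto
  finally show ?thesis by simp
qed

lemma dd_Cc_deriv_support:
  assumes "dd v f f'" "Cc f" "continuous_on UNIV f'"
  shows "Cc f'"
proof -
  obtain R where R: "R > 0" "\<And>x. norm x > R \<Longrightarrow> f x = 0" using Cc_supportE[OF assms(2)] by blast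
  have "f' x = 0" if "norm x > R" for x
  proof -
    have "((\<lambda>t. norm (x + t *\<^sub>R v)) \<longlongrightarrow> norm (x + 0 *\<^sub>R v)) (at 0)"
      by (intro tendsto_intros)
    then have "eventually (\<lambda>t. norm (x + t *\<^sub>R v) > R) (at 0)"
      using that by (intro order_tendstoD) auto
    then have ev: "eventually (\<lambda>t. norm (x + t *\<^sub>R v) > R) (nhds 0)"
      using that by (simp add: eventually_nhds_conv_at)
    have "((\<lambda>t. 0::real) has_real_derivative f' x) (at 0)"
      by (rule DERIV_cong_ev[THEN iffD1, OF refl _ refl ddD[OF assms(1)]])
         (use ev R(2) in \<open>auto elim: eventually_mono\<close>)
    then show ?thesis using DERIV_unique DERIV_const by blast
  qed
  then show ?thesis using assms(3) by (rule CcI[rotated])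
qed

text \<open>The source of every integration by parts below. The integral of a difference quotient vanishes by
translation invariance of Lebesgue measure, and the quotients converge boundedly.\<close>
lemma integral_dd_eq_0:
  assumes dd: "dd v f f'" and f: "Cc f" and c': "continuous_on UNIV f'"
  shows "(LBINT x. f' x) = 0"
proof -
  have f': "Cc f'" by (rule dd_Cc_deriv_support[OF dd f c'])
  have [measurable]: "f \<in> borel_measurable borel" "f' \<in> borel_measurable borel"
    using f f' by (auto intro: Cc_measurable)
  obtain R where R: "R > 0" "\<And>x. norm x > R \<Longrightarrow> f x = 0" using Cc_supportE[OF f] by blast
  obtain B where B: "B > 0" "\<And>x. \<bar>f' x\<bar> \<le> B" using Cc_boundE[OF f'] by blast
  define h where "h n = inverse (real (Suc n))" for n
  have h: "h n > 0" "h n \<le> 1" for n by (auto simp: h_def field_simps)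
  have hlim: "h \<longlonglongrightarrow> 0" unfolding h_def by (rule LIMSEQ_inverse_real_of_nat)
  define s where "s n x = (f (h n *\<^sub>R v + x) - f x) / h n" for n x
  have int0: "(LBINT x. s n x) = 0" for n
  proof -
    have "(LBINT x. f (h n *\<^sub>R v + x) - f x) = 0"
      using lborel_integral_shift[of f "h n *\<^sub>R v"]
      by (subst Bochner_Integration.integral_diff) (auto intro!: Cc_integrable f Cc_shift)
    then show ?thesis unfolding s_def by simp
  qed
  have "(\<lambda>n. LBINT x. s n x) \<longlonglongrightarrow> (LBINT x. f' x)"
  proof (rule integral_dominated_convergence[where w="\<lambda>x. B * indicator (cball 0 (R + norm v)) x"])
    show "integrable lborel (\<lambda>x. B * indicator (cball 0 (R + norm v)) x :: real)"
      by (intro integrable_mult_right integrable_real_indicator) (use emeasure_lborel_cball_finite[of 0 "R + norm v"] in \<open>auto simp: top.not_eq_extremum\<close>)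
    show "AE x in lborel. (\<lambda>n. s n x) \<longlonglongrightarrow> f' x"
    proof (rule AE_I2)
      fix x
      have "((\<lambda>t. (f (x + t *\<^sub>R v) - f x) / t) \<longlongrightarrow> f' x) (at 0)"
        using ddD[OF dd, of x] by (simp add: DERIV_def)
      then have "((\<lambda>n. (f (x + h n *\<^sub>R v) - f x) / h n) \<longlongrightarrow> f' x) sequentially"
        by (rule filterlim_compose) (use hlim h(1) in \<open>auto simp: filterlim_at less_imp_neq[symmetric] intro!: always_eventually\<close>)
      then show "(\<lambda>n. s n x) \<longlonglongrightarrow> f' x" by (simp add: s_def add.commute)
    qed
    show "AE x in lborel. norm (s n x) \<le> B * indicator (cball 0 (R + norm v)) x" for n
    proof (rule AE_I2)
      fix x
      obtain t where t: "f (x + h n *\<^sub>R v) - f x = h n * f' (x + t *\<^sub>R v)"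
        using dd_MVT[OF dd, of "h n" x] h(1)[of n] by (metis less_irrefl)
      show "norm (s n x) \<le> B * indicator (cball 0 (R + norm v)) x"
      proof (cases "norm x \<le> R + norm v")
        case True
        have "s n x = f' (x + t *\<^sub>R v)" using t h(1)[of n] by (simp add: s_def add.commute)
        then show ?thesis using True B(2) by simp
      next
        case False
        have "norm (h n *\<^sub>R v) \<le> norm v" using h[of n] by (simp add: mult_left_le_one_le)
        then have "norm (h n *\<^sub>R v + x) > R" using False norm_triangle_ineq4[of "h n *\<^sub>R v + x" "h n *\<^sub>R v"] by simp
        moreover have "norm x > R" using False norm_ge_zero[of v] by linarith
        ultimately show ?thesis using False R(2) by (simp add: s_def)
      qed
    qed
  qed (auto simp: s_def)
  then have "(\<lambda>n. 0::real) \<longlonglongrightarrow> (LBINT x. f' x)" by (simp add: int0)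
  then show ?thesis using LIMSEQ_unique tendsto_const by blast
qed

section \<open>Smooth functions\<close>

abbreviation pd where "pd \<equiv> partial_deriv"

lemma differentiable_imp_dd:
  assumes "f differentiable_on UNIV"
  shows "dd v f (pd v f)"
  unfolding dd_def
proof
  fix x
  have "f differentiable (at x)" using assms by (simp add: differentiable_on_def)
  then have D: "(f has_derivative frechet_derivative f (at x)) (at (x + 0 *\<^sub>R v))"
    by (simp add: frechet_derivative_works)
  have "((\<lambda>t. x + t *\<^sub>R v) has_derivative (\<lambda>t. t *\<^sub>R v)) (at (0::real))"
    by (auto intro!: derivative_eq_intros)
  from has_derivative_compose[OF this D]
  have "((\<lambda>t. f (x + t *\<^sub>R v)) has_derivative (\<lambda>t. frechet_derivative f (at x) (t *\<^sub>R v))) (at 0)" .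
  moreover have "(\<lambda>t. frechet_derivative f (at x) (t *\<^sub>R v)) = (\<lambda>t. t * pd v f x)"
    using linear_frechet_derivative[OF \<open>f differentiable (at x)\<close>]
    by (simp add: linear_cmul partial_deriv_def)
  ultimately show "((\<lambda>t. f (x + t *\<^sub>R v)) has_real_derivative pd v f x) (at 0)"
    by (simp add: has_field_derivative_def mult_commute_abs)
qed

lemma pd_eqI: "f differentiable_on UNIV \<Longrightarrow> dd v f f' \<Longrightarrow> pd v f = f'"
  using dd_unique differentiable_imp_dd by blast

lemma pd_linear_combination:
  fixes f :: "'a::euclidean_space \<Rightarrow> real"
  assumes "f differentiable_on UNIV"
  shows "pd v f x = (\<Sum>b\<in>Basis. (v \<bullet> b) * pd b f x)"
proof -
  have lin: "linear (frechet_derivative f (at x))"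
    using assms by (intro linear_frechet_derivative) (simp add: differentiable_on_def)
  have "frechet_derivative f (at x) v = frechet_derivative f (at x) (\<Sum>b\<in>Basis. (v \<bullet> b) *\<^sub>R b)"
    by (simp add: euclidean_representation)
  also have "\<dots> = (\<Sum>b\<in>Basis. (v \<bullet> b) * frechet_derivative f (at x) b)"
    using lin by (simp add: linear_sum linear_cmul)
  finally show ?thesis by (simp add: partial_deriv_def)
qed

lemma C_k_mono1: "C_k (Suc k) f \<Longrightarrow> C_k k f"
proof (induction k arbitrary: f)
  case 0
  then show ?case by (simp add: differentiable_imp_continuous_on)
next
  case (Suc k)
  then show ?case by (metis C_k.simps(2))
qed

lemma C_k_const: "C_k k (\<lambda>x::'a::euclidean_space. c)"
proof (induction k arbitrary: c)
  case (Suc k)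
  have "pd b (\<lambda>x::'a. c) = (\<lambda>x. 0)" for b by (rule pd_eqI) auto
  then show ?case using Suc by simp
qed simp

lemma C_k_add: "C_k k f \<Longrightarrow> C_k k g \<Longrightarrow> C_k k (\<lambda>x. f x + g x)"
proof (induction k arbitrary: f g)
  case (Suc k)
  then have d: "f differentiable_on UNIV" "g differentiable_on UNIV" by auto
  then have "pd b (\<lambda>x. f x + g x) = (\<lambda>x. pd b f x + pd b g x)" for b
    by (intro pd_eqI dd_add differentiable_imp_dd) auto
  then show ?case using Suc d by auto
qed (auto intro: continuous_intros)

lemma C_k_mult: "C_k k f \<Longrightarrow> C_k k g \<Longrightarrow> C_k k (\<lambda>x. f x * g x)"
proof (induction k arbitrary: f g)
  case (Suc k)
  then have d: "f differentiable_on UNIV" "g differentiable_on UNIV" by auto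
  then have "pd b (\<lambda>x. f x * g x) = (\<lambda>x. pd b f x * g x + f x * pd b g x)" for b
    by (intro pd_eqI dd_mult differentiable_imp_dd) auto
  moreover have "C_k k f" "C_k k g" using Suc.prems C_k_mono1 by blast+
  ultimately show ?case using Suc d by (auto intro!: C_k_add)
qed (auto intro: continuous_intros)

lemma C_k_diff: "C_k k f \<Longrightarrow> C_k k g \<Longrightarrow> C_k k (\<lambda>x. f x - g x)"
  using C_k_add[of k f "\<lambda>x. (-1) * g x"] C_k_mult[OF C_k_const, of k g "-1"] by simp

lemma C_k_sum: "(\<And>i. i \<in> I \<Longrightarrow> C_k k (f i)) \<Longrightarrow> C_k k (\<lambda>x. \<Sum>i\<in>I. f i x)"
  by (induction I rule: infinite_finite_induct) (auto simp: C_k_const C_k_add)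

lemma smooth_const: "smooth (\<lambda>x. c)" by (simp add: smooth_def C_k_const)
lemma smooth_add: "smooth f \<Longrightarrow> smooth g \<Longrightarrow> smooth (\<lambda>x. f x + g x)" by (simp add: smooth_def C_k_add)
lemma smooth_mult: "smooth f \<Longrightarrow> smooth g \<Longrightarrow> smooth (\<lambda>x. f x * g x)" by (simp add: smooth_def C_k_mult)
lemma smooth_cmult: "smooth f \<Longrightarrow> smooth (\<lambda>x. c * f x)" by (intro smooth_mult smooth_const)
lemma smooth_minus: "smooth f \<Longrightarrow> smooth (\<lambda>x. - f x)" using smooth_cmult[of f "-1"] by simp
lemma smooth_diff: "smooth f \<Longrightarrow> smooth g \<Longrightarrow> smooth (\<lambda>x. f x - g x)"
  using smooth_add[of f "\<lambda>x. - g x"] smooth_minus[of g] by simp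
lemma smooth_sum: "(\<And>i. i \<in> I \<Longrightarrow> smooth (f i)) \<Longrightarrow> smooth (\<lambda>x. \<Sum>i\<in>I. f i x)"
  by (induction I rule: infinite_finite_induct) (auto simp: smooth_const smooth_add)
lemma smooth_prod: "(\<And>i. i \<in> I \<Longrightarrow> smooth (f i)) \<Longrightarrow> smooth (\<lambda>x. \<Prod>i\<in>I. f i x)"
  by (induction I rule: infinite_finite_induct) (auto simp: smooth_const smooth_mult)

lemma smooth_differentiable: "smooth f \<Longrightarrow> f differentiable_on UNIV"
  unfolding smooth_def by (metis C_k.simps(2))
lemma smooth_continuous: "smooth f \<Longrightarrow> continuous_on A f"
  by (meson continuous_on_subset differentiable_imp_continuous_on smooth_differentiable subset_UNIV)
lemma smooth_dd: "smooth f \<Longrightarrow> dd v f (pd v f)"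
  by (intro differentiable_imp_dd smooth_differentiable)
lemma smooth_pd: "smooth f \<Longrightarrow> b \<in> Basis \<Longrightarrow> smooth (pd b f)"
  unfolding smooth_def by (metis C_k.simps(2))
lemma smooth_pd_continuous: "smooth f \<Longrightarrow> b \<in> Basis \<Longrightarrow> continuous_on A (pd b f)"
  by (intro smooth_continuous smooth_pd)

lemma smooth_pd_commute:
  assumes "smooth f" "b \<in> Basis" "c \<in> Basis"
  shows "pd c (pd b f) = pd b (pd c f)"
proof
  fix x
  have "isCont (pd c (pd b f)) x" "isCont (pd b (pd c f)) x"
    using assms smooth_pd_continuous[of _ _ UNIV] smooth_pd
    by (metis continuous_on_eq_continuous_at iso_tuple_UNIV_I open_UNIV)+
  then show "pd c (pd b f) x = pd b (pd c f) x"
    using assms by (intro dd_commute[of b f _ c]) (auto intro: smooth_dd smooth_pd)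
qed

text \<open>By the chain rule a partial derivative of the composition is a fixed linear combination of
compositions of partial derivatives of \<open>f\<close>, which makes the statement inductive in \<open>k\<close>.\<close>
lemma C_k_affine:
  fixes f :: "'a::euclidean_space \<Rightarrow> real" and A :: "'b::euclidean_space \<Rightarrow> 'a"
  assumes A: "\<And>x. A x = a + L x" and L: "linear L" 
  shows "C_k k f \<Longrightarrow> C_k k (\<lambda>x. f (A x))"
proof (induction k arbitrary: f)
  case 0
  have "continuous_on UNIV A" unfolding A using L
    by (intro continuous_intros linear_continuous_on) (simp add: linear_conv_bounded_linear)
  then show ?case using 0 by (auto intro: continuous_on_compose2)
next
  case (Suc k)
  have bl: "bounded_linear L" using L by (simp add: linear_conv_bounded_linear)
  have AD: "(A has_derivative L) (at x)" for x
    unfolding A[abs_def] by (auto intro!: derivative_eq_intros bounded_linear_imp_has_derivative[OF bl])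
  have fd: "f differentiable_on UNIV" using Suc.prems by simp
  then have FD: "(f has_derivative frechet_derivative f (at y)) (at y)" for y
    by (simp add: differentiable_on_def frechet_derivative_works)
  have comp: "((\<lambda>x. f (A x)) has_derivative (\<lambda>h. frechet_derivative f (at (A x)) (L h))) (at x)" for x
    by (rule has_derivative_compose[OF AD FD])
  have "pd b (\<lambda>x. f (A x)) = (\<lambda>x. \<Sum>c\<in>Basis. (L b \<bullet> c) * pd c f (A x))" for b
  proof
    fix x
    have "pd b (\<lambda>x. f (A x)) x = pd (L b) f (A x)"
      unfolding partial_deriv_def by (subst frechet_derivative_at[OF comp, symmetric]) rule
    then show "pd b (\<lambda>x. f (A x)) x = (\<Sum>c\<in>Basis. (L b \<bullet> c) * pd c f (A x))"
      by (rule trans) (rule pd_linear_combination[OF fd])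
  qed
  moreover have "C_k k (\<lambda>x. \<Sum>c\<in>Basis. (L b \<bullet> c) * pd c f (A x))" for b
  proof (intro C_k_sum C_k_mult C_k_const)
    fix c :: 'a assume "c \<in> Basis"
    then show "C_k k (\<lambda>x. pd c f (A x))" using Suc.prems by (intro Suc.IH) simp
  qed
  moreover have "(\<lambda>x. f (A x)) differentiable_on UNIV"
    using comp unfolding differentiable_on_def differentiable_def by blast
  ultimately show ?case by simp
qed

lemma smooth_affine:
  fixes f :: "'a::euclidean_space \<Rightarrow> real" and L :: "'b::euclidean_space \<Rightarrow> 'a"
  assumes "smooth f" "linear L"
  shows "smooth (\<lambda>x. f (a + L x))"
  using C_k_affine[of "\<lambda>x. a + L x" a L] assms by (simp add: smooth_def)

lemma test_function_iff: "test_function f \<longleftrightarrow> smooth f \<and> bounded {x. f x \<noteq> 0}"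
  unfolding test_function_def by (auto simp: compact_closure)

lemma test_function_smooth: "test_function f \<Longrightarrow> smooth f" by (simp add: test_function_def)

lemma test_function_Cc: "test_function f \<Longrightarrow> Cc f"
  by (simp add: test_function_iff Cc_def smooth_continuous)

lemma test_functionI: "smooth f \<Longrightarrow> Cc f \<Longrightarrow> test_function f"
  by (simp add: test_function_iff Cc_def)

lemma test_function_pd: 
  assumes "test_function f" "b \<in> Basis" shows "test_function (pd b f)"
proof (rule test_functionI)
  show s: "smooth (pd b f)" using assms by (intro smooth_pd test_function_smooth)
  show "Cc (pd b f)"
    by (rule dd_Cc_deriv_support[of b f]) (use assms s in \<open>auto intro: smooth_dd test_function_smooth test_function_Cc smooth_continuous\<close>)
qed

lemma test_function_add: "test_function f \<Longrightarrow> test_function g \<Longrightarrow> test_function (\<lambda>x. f x + g x)"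
  by (rule test_functionI) (auto intro!: smooth_add Cc_add intro: test_function_Cc test_function_smooth)
lemma test_function_mult: "smooth f \<Longrightarrow> test_function g \<Longrightarrow> test_function (\<lambda>x. f x * g x)"
  by (rule test_functionI) (auto intro!: smooth_mult Cc_mult1 smooth_continuous intro: test_function_Cc test_function_smooth)
lemma test_function_cmult: "test_function g \<Longrightarrow> test_function (\<lambda>x. c * g x)"
  by (intro test_function_mult smooth_const)
lemma test_function_diff: "test_function f \<Longrightarrow> test_function g \<Longrightarrow> test_function (\<lambda>x. f x - g x)"
  by (rule test_functionI) (auto intro!: smooth_diff Cc_diff intro: test_function_Cc test_function_smooth)
lemma test_function_sum: "(\<And>i. i \<in> I \<Longrightarrow> test_function (f i)) \<Longrightarrow> test_function (\<lambda>x. \<Sum>i\<in>I. f i x)"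
  by (rule test_functionI) (auto intro!: smooth_sum Cc_sum intro: test_function_Cc test_function_smooth)

lemma test_function_reflect:
  fixes f :: "'a::euclidean_space \<Rightarrow> real"
  assumes "test_function f" shows "test_function (\<lambda>y. f (x - y))"
proof (rule test_functionI)
  have "linear (uminus :: 'a \<Rightarrow> 'a)" by (rule linear_uminus)
  from smooth_affine[OF test_function_smooth[OF assms] this, of x]
  show "smooth (\<lambda>y. f (x - y))" by simp
  show "Cc (\<lambda>y. f (x - y))" by (rule Cc_reflect[OF test_function_Cc[OF assms]])
qed

lemma pd_reflect: "smooth f \<Longrightarrow> pd b (\<lambda>y. f (x - y)) = (\<lambda>y. - pd b f (x - y))"
  using smooth_affine[of f uminus x] linear_uminus
  by (intro pd_eqI dd_reflect smooth_dd) (auto intro: smooth_differentiable)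

section \<open>A smooth bump function\<close>

text \<open>For \<open>m = 0\<close> this is the classical smooth function that is flat at \<open>0\<close>. The extra powers of
\<open>1/t\<close> make the family closed under differentiation up to linear combinations.\<close>
definition flat_fn :: "nat \<Rightarrow> real \<Rightarrow> real" where
  "flat_fn m t = (if t > 0 then inverse t ^ m * exp (- inverse t) else 0)"

lemma flat_fn_lim: "((\<lambda>t. inverse t ^ m * exp (- inverse t)) \<longlongrightarrow> 0) (at_right (0::real))"
proof -
  have "((\<lambda>s. s ^ m / exp s) \<longlongrightarrow> 0) (at_top :: real filter)" by (rule tendsto_power_div_exp_0)
  then have "((\<lambda>t. inverse t ^ m / exp (inverse t)) \<longlongrightarrow> 0) (at_right (0::real))"
    by (rule filterlim_compose[OF _ filterlim_inverse_at_top_right])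
  then show ?thesis by (simp add: exp_minus divide_inverse)
qed

lemma flat_fn_deriv:
  "(flat_fn m has_real_derivative flat_fn (m + 2) t - real m * flat_fn (m + 1) t) (at t)"
proof -
  consider "t < 0" | "t = 0" | "t > 0" by linarith
  then show ?thesis
  proof cases
    case 1
    have "((\<lambda>_. 0) has_real_derivative 0) (at t)" by simp
    then have "(flat_fn m has_real_derivative 0) (at t)"
      by (rule has_field_derivative_transform_within_open[of _ _ _ "{..<0}"]) (use 1 in \<open>auto simp: flat_fn_def\<close>)
    then show ?thesis using 1 by (simp add: flat_fn_def)
  next
    case 2
    have "((\<lambda>h. (flat_fn m h - flat_fn m 0) / (h - 0)) \<longlongrightarrow> 0) (at 0)"
    proof (rule filterlim_split_at)
      have "((\<lambda>_. 0) \<longlongrightarrow> (0::real)) (at_left 0)" by simp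
      then show "((\<lambda>h. (flat_fn m h - flat_fn m 0) / (h - 0)) \<longlongrightarrow> 0) (at_left 0)"
        by (rule Lim_transform_eventually) (auto simp: eventually_at_filter flat_fn_def)
      show "((\<lambda>h. (flat_fn m h - flat_fn m 0) / (h - 0)) \<longlongrightarrow> 0) (at_right 0)"
        by (rule Lim_transform_eventually[OF flat_fn_lim[of "Suc m"]])
           (auto simp: eventually_at_filter flat_fn_def divide_inverse)
    qed
    then show ?thesis using 2 by (simp add: has_field_derivative_iff flat_fn_def)
  next
    case 3
    have key: "inverse t ^ n = inverse t * inverse t ^ (n - Suc 0)" if "n \<noteq> 0" for n
      using that by (cases n) auto
    have "((\<lambda>t. inverse t ^ m * exp (- inverse t)) has_real_derivative
        flat_fn (m + 2) t - real m * flat_fn (m + 1) t) (at t)"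
      using 3 by (cases m; cases "m - 1") (auto intro!: derivative_eq_intros simp: flat_fn_def algebra_simps power2_eq_square, metis key)
    then show ?thesis
      by (rule has_field_derivative_transform_within_open[of _ _ _ "{0<..}"]) (use 3 in \<open>auto simp: flat_fn_def\<close>)
  qed
qed

lemma C_k_flat_fn: "C_k k (flat_fn m)"
proof (induction k arbitrary: m)
  case 0
  then show ?case 
    by (auto intro!: continuous_at_imp_continuous_on DERIV_isCont[OF flat_fn_deriv])
next
  case (Suc k)
  have D: "(flat_fn m has_derivative (*) (flat_fn (m + 2) t - real m * flat_fn (m + 1) t)) (at t)" for t
    using flat_fn_deriv[of m t] by (simp add: has_field_derivative_def)
  have "flat_fn m differentiable_on UNIV"
    using D unfolding differentiable_on_def differentiable_def by blast
  moreover have "pd 1 (flat_fn m) = (\<lambda>t. flat_fn (m + 2) t - real m * flat_fn (m + 1) t)"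
    unfolding partial_deriv_def frechet_derivative_at[OF D, symmetric] by auto
  ultimately show ?case using Suc by (auto intro!: C_k_diff C_k_mult C_k_const)
qed

lemma smooth_flat_fn: "smooth (flat_fn m)" by (simp add: smooth_def C_k_flat_fn)

text \<open>A product over the coordinates, so that smoothness follows from closure under products and affine
substitutions.\<close>
definition bump :: "'a::euclidean_space \<Rightarrow> real" where
  "bump x = (\<Prod>b\<in>Basis. flat_fn 0 (1 + x \<bullet> b) * flat_fn 0 (1 - x \<bullet> b))"

lemma bump_nonneg: "bump x \<ge> 0" unfolding bump_def by (intro prod_nonneg) (auto simp: flat_fn_def)

lemma bump_0: "bump 0 > 0" unfolding bump_def by (intro prod_pos) (auto simp: flat_fn_def)

lemma bump_eq_0: fixes x :: "'a::euclidean_space" assumes "norm x > real DIM('a)" shows "bump x = 0"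
proof -
  have "\<exists>b\<in>Basis. \<bar>x \<bullet> b\<bar> > 1"
  proof (rule ccontr)
    assume "\<not> ?thesis"
    then have "(\<Sum>b\<in>Basis. \<bar>x \<bullet> b\<bar>) \<le> (\<Sum>b\<in>(Basis::'a set). 1)" by (intro sum_mono) (auto simp: not_less)
    then show False using norm_le_l1[of x] assms by simp
  qed
  then obtain b where "b \<in> Basis" "\<bar>x \<bullet> b\<bar> > 1" by blast
  then show ?thesis unfolding bump_def by (intro prod_zero bexI[of _ b]) (auto simp: flat_fn_def)
qed

lemma test_function_bump: "test_function (\<lambda>x::'a::euclidean_space. bump (c *\<^sub>R x))" if "c > 0"
proof (rule test_functionI)
  have "smooth (\<lambda>x::'a. flat_fn 0 (1 + (c *\<^sub>R x) \<bullet> b))" for b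
    by (rule smooth_affine[OF smooth_flat_fn, where L="\<lambda>x::'a. (c *\<^sub>R x) \<bullet> b" and a=1])
       (auto intro!: linearI simp: inner_add_left algebra_simps)
  moreover have "smooth (\<lambda>x::'a. flat_fn 0 (1 + (- ((c *\<^sub>R x) \<bullet> b))))" for b
    by (rule smooth_affine[OF smooth_flat_fn, where L="\<lambda>x::'a. - ((c *\<^sub>R x) \<bullet> b)" and a=1])
       (auto intro!: linearI simp: inner_add_left algebra_simps)
  ultimately show s: "smooth (\<lambda>x::'a. bump (c *\<^sub>R x))"
    unfolding bump_def by (intro smooth_prod smooth_mult) auto
  show "Cc (\<lambda>x::'a. bump (c *\<^sub>R x))"
  proof (rule CcI[OF smooth_continuous[OF s], of "DIM('a) / c"])
    fix x :: 'a assume "real DIM('a) / c < norm x"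
    then show "bump (c *\<^sub>R x) = 0" using that by (intro bump_eq_0) (simp add: field_simps)
  qed
qed

section \<open>The spectral gap is the best Poincare constant\<close>

lemma AE_continuous_eq_0:
  fixes f :: "'a::euclidean_space \<Rightarrow> real"
  assumes "continuous_on UNIV f" "AE x in lborel. f x = 0"
  shows "f x = 0"
proof (rule ccontr)
  assume "f x \<noteq> 0"
  define S where "S = {x. f x \<noteq> 0}"
  have "open S" unfolding S_def using assms(1) by (intro open_Collect_neq) auto
  moreover have "S \<noteq> {}" using \<open>f x \<noteq> 0\<close> S_def by auto
  ultimately have "\<not> negligible S" by (rule open_not_negligible)
  moreover have "S \<in> null_sets lborel"
    using assms(2) \<open>open S\<close> by (intro AE_iff_null_sets[THEN iffD2]) (auto simp: S_def)
  ultimately show False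
    using null_sets_completionI negligible_iff_null_sets by blast
qed

lemma continuous_integral_pos:
  fixes f :: "'a::euclidean_space \<Rightarrow> real"
  assumes "continuous_on UNIV f" "\<And>x. f x \<ge> 0" "integrable lborel f" "f x > 0"
  shows "(LBINT x. f x) > 0"
proof -
  have "(LBINT x. f x) \<noteq> 0"
  proof
    assume "(LBINT x. f x) = 0"
    then have "AE x in lborel. f x = 0"
      using integral_nonneg_eq_0_iff_AE[OF assms(3)] assms(2) by simp
    then show False using AE_continuous_eq_0[OF assms(1)] assms(4) by (metis less_irrefl)
  qed
  then show ?thesis using Bochner_Integration.integral_nonneg[of lborel f] assms(2) by (simp add: order_less_le)
qed

lemma norm_gradient_sq: "(norm (gradient f x))\<^sup>2 = (\<Sum>b\<in>Basis. (pd b f x)\<^sup>2)"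
proof -
  have "gradient f x \<bullet> b = pd b f x" if "b \<in> Basis" for b
    using that unfolding gradient_def by simp
  then show ?thesis
    by (subst power2_norm_eq_inner, subst euclidean_inner) (simp add: power2_eq_square)
qed

text \<open>A finite measure with density \<open>\<rho> = exp (- U)\<close>. Working with \<open>\<rho>\<close> instead of the normalised
Gibbs measure keeps the constant \<open>Z\<close> out of the estimates.\<close>
locale weight =
  fixes U :: "'a::euclidean_space \<Rightarrow> real"
  assumes contU: "continuous_on UNIV U"
    and intU: "integrable lborel (\<lambda>x. exp (- U x))"
begin

abbreviation \<rho> where "\<rho> x \<equiv> exp (- U x)"
abbreviation Z where "Z \<equiv> partition_const U"

lemma cont\<rho> [continuous_intros]: "continuous_on A \<rho>"
  using continuous_on_subset[OF contU] by (auto intro!: continuous_intros)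

lemma meas\<rho> [measurable]: "\<rho> \<in> borel_measurable borel"
  using cont\<rho> by (rule borel_measurable_continuous_onI)

lemma Z_pos: "Z > 0"
  unfolding partition_const_def by (rule continuous_integral_pos[OF cont\<rho> _ intU]) auto

lemma integral_gibbs:
  fixes f :: "'a \<Rightarrow> real"
  assumes [measurable]: "f \<in> borel_measurable borel"
  shows "(\<integral>x. f x \<partial>gibbs U) = (LBINT x. f x * \<rho> x) / Z"
proof -
  have "(\<integral>x. f x \<partial>gibbs U) = (LBINT x. (\<rho> x / Z) *\<^sub>R f x)"
    unfolding gibbs_def using Z_pos by (subst integral_density) auto
  also have "\<dots> = (LBINT x. f x * \<rho> x / Z)" by (simp add: mult.commute)
  finally show ?thesis by simp
qed

lemma integrable_bounded_\<rho>:
  assumes [measurable]: "f \<in> borel_measurable borel" and "\<And>x. \<bar>f x\<bar> \<le> B"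
  shows "integrable lborel (\<lambda>x. f x * \<rho> x)"
  by (rule Bochner_Integration.integrable_bound[OF integrable_mult_right[OF intU, of B]])
     (auto simp: abs_mult intro!: mult_right_mono order_trans[OF assms(2)])

lemma integrable_Cc_\<rho>: "Cc f \<Longrightarrow> integrable lborel (\<lambda>x. f x * \<rho> x)"
  by (intro Cc_integrable Cc_mult2 cont\<rho>)

text \<open>The variance of \<open>f\<close> under the Gibbs measure, times \<open>Z\<close>.\<close>
definition wvar :: "('a \<Rightarrow> real) \<Rightarrow> real" where
  "wvar f = (LBINT x. (f x)\<^sup>2 * \<rho> x) - (LBINT x. f x * \<rho> x)\<^sup>2 / Z"

lemma wvar_eq:
  assumes "Cc f"
  shows "wvar f = (LBINT x. (f x - c)\<^sup>2 * \<rho> x) - (LBINT x. (f x - c) * \<rho> x)\<^sup>2 / Z"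
proof -
  have i: "integrable lborel (\<lambda>x. (f x)\<^sup>2 * \<rho> x)" "integrable lborel (\<lambda>x. f x * \<rho> x)"
    using assms by (auto intro!: integrable_Cc_\<rho> Cc_power2)
  define a b where "a = (LBINT x. (f x)\<^sup>2 * \<rho> x)" and "b = (LBINT x. f x * \<rho> x)"
  have "(LBINT x. (f x - c)\<^sup>2 * \<rho> x) = (LBINT x. (f x)\<^sup>2 * \<rho> x - (2 * c) * (f x * \<rho> x) + c\<^sup>2 * \<rho> x)"
    by (simp add: power2_eq_square algebra_simps)
  also have "\<dots> = a - 2 * c * b + c\<^sup>2 * Z"
    using i intU by (subst Bochner_Integration.integral_add Bochner_Integration.integral_diff; simp add: a_def b_def partition_const_def)+
  finally have 1: "(LBINT x. (f x - c)\<^sup>2 * \<rho> x) = a - 2 * c * b + c\<^sup>2 * Z" .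
  have "(LBINT x. (f x - c) * \<rho> x) = (LBINT x. f x * \<rho> x - c * \<rho> x)"
    by (simp add: algebra_simps)
  also have "\<dots> = b - c * Z"
    using i intU by (subst Bochner_Integration.integral_diff; simp add: b_def partition_const_def)
  finally have 2: "(LBINT x. (f x - c) * \<rho> x) = b - c * Z" .
  show ?thesis unfolding 1 2 wvar_def a_def[symmetric] b_def[symmetric] using Z_pos
    by (simp add: field_simps power2_eq_square)
qed

lemma wvar_mean:
  assumes "Cc f"
  shows "wvar f = (LBINT x. (f x - (LBINT x. f x * \<rho> x) / Z)\<^sup>2 * \<rho> x)"
proof -
  define c where "c = (LBINT x. f x * \<rho> x) / Z"
  have "(LBINT x. (f x - c) * \<rho> x) = (LBINT x. f x * \<rho> x - c * \<rho> x)"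
    by (simp add: algebra_simps)
  also have "\<dots> = 0"
    using intU integrable_Cc_\<rho>[OF assms] Z_pos by (subst Bochner_Integration.integral_diff; simp add: c_def partition_const_def)
  finally show ?thesis using wvar_eq[OF assms, of c] by (simp add: c_def)
qed

lemma wvar_nonneg: "Cc f \<Longrightarrow> wvar f \<ge> 0"
  by (simp add: wvar_mean)

definition energy :: "('a \<Rightarrow> real) \<Rightarrow> real" where
  "energy f = (LBINT x. (\<Sum>b\<in>Basis. (pd b f x)\<^sup>2) * \<rho> x)"

lemma energy_nonneg: "energy f \<ge> 0"
  unfolding energy_def by (intro Bochner_Integration.integral_nonneg) (auto intro!: mult_nonneg_nonneg sum_nonneg)

definition poincare :: "real \<Rightarrow> bool" where
  "poincare \<kappa> \<longleftrightarrow> (\<forall>f. test_function f \<longrightarrow> \<kappa> * wvar f \<le> energy f)"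

lemma variance_gibbs:
  assumes "Cc f"
  shows "prob_space.variance (gibbs U) f = wvar f / Z"
proof -
  have [measurable]: "f \<in> borel_measurable borel" using assms by (rule Cc_measurable)
  show ?thesis by (simp add: integral_gibbs wvar_mean[OF assms])
qed

lemma spectral_gap_eq: "spectral_gap U = (GREATEST \<kappa>. poincare \<kappa>)"
proof -
  have "(\<kappa> * prob_space.variance (gibbs U) f \<le> (\<integral>x. (norm (gradient f x))\<^sup>2 \<partial>gibbs U))
      = (\<kappa> * wvar f \<le> energy f)" if f: "test_function f" for f \<kappa>
  proof -
    have "pd b f \<in> borel_measurable borel" if "b \<in> Basis" for b
      using test_function_pd[OF f that] by (intro Cc_measurable test_function_Cc)
    then have "(\<integral>x. (norm (gradient f x))\<^sup>2 \<partial>gibbs U) = energy f / Z"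
      unfolding norm_gradient_sq energy_def by (intro integral_gibbs) measurable
    then show ?thesis using variance_gibbs[OF test_function_Cc[OF f]] Z_pos
      by (simp add: divide_le_cancel)
  qed
  then show ?thesis unfolding spectral_gap_def poincare_def by (metis (no_types, lifting))
qed

lemma exists_wvar_pos: "\<exists>f. test_function f \<and> wvar f > 0"
proof -
  define f :: "'a \<Rightarrow> real" where "f x = bump (1 *\<^sub>R x)" for x
  have f: "test_function f" unfolding f_def by (rule test_function_bump) simp
  have Cc: "Cc f" using f by (rule test_function_Cc)
  obtain R where R: "R > 0" "\<And>x. norm x > R \<Longrightarrow> f x = 0" using Cc_supportE[OF Cc] by blast
  obtain y :: 'a where "norm y = R + 1" using vector_choose_size[of "R + 1"] R(1) by auto
  then have fy: "f y = 0" using R by simp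
  have f0: "f 0 > 0" unfolding f_def by (simp add: bump_0)
  obtain B where B: "B > 0" "\<And>x. \<bar>f x\<bar> \<le> B" using Cc_boundE[OF Cc] by blast
  define c where "c = (LBINT x. f x * \<rho> x) / Z"
  have [measurable]: "f \<in> borel_measurable borel" using Cc by (rule Cc_measurable)
  have "\<bar>(f x - c)\<^sup>2\<bar> \<le> (B + \<bar>c\<bar>)\<^sup>2" for x
    using B(2)[of x] by (auto simp: abs_le_square_iff[symmetric] intro!: power2_le_iff_abs_le[THEN iffD2])
  then have int: "integrable lborel (\<lambda>x. (f x - c)\<^sup>2 * \<rho> x)"
    by (intro integrable_bounded_\<rho>[where B="(B + \<bar>c\<bar>)\<^sup>2"]) auto
  obtain z where z: "f z \<noteq> c" using fy f0 by (metis less_irrefl)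
  have "(LBINT x. (f x - c)\<^sup>2 * \<rho> x) > 0"
    by (rule continuous_integral_pos[OF _ _ int, of z])
       (use z in \<open>auto intro!: continuous_intros Cc_cont[OF Cc]\<close>)
  then show ?thesis using f wvar_mean[OF Cc] unfolding c_def by auto
qed

text \<open>The set of admissible constants is closed, contains \<open>0\<close>, and is bounded above by the quotient for
any single function of positive variance, so its supremum is admissible.\<close>
lemma spectral_gap_greatest:
  shows poincare_spectral_gap: "poincare (spectral_gap U)"
    and le_spectral_gap: "\<And>\<kappa>. poincare \<kappa> \<Longrightarrow> \<kappa> \<le> spectral_gap U"
    and spectral_gap_nonneg: "spectral_gap U \<ge> 0"
proof -
  define S where "S = Collect poincare"
  have S0: "0 \<in> S" by (simp add: S_def poincare_def energy_nonneg)
  obtain f where f: "test_function f" "wvar f > 0" using exists_wvar_pos by blast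
  have "\<kappa> \<le> energy f / wvar f" if "\<kappa> \<in> S" for \<kappa>
    using that f by (simp add: S_def poincare_def field_simps)
  then have bdd: "bdd_above S" by (rule bdd_aboveI)
  have "poincare (Sup S)" unfolding poincare_def
  proof (intro allI impI)
    fix g :: "'a \<Rightarrow> real" assume g: "test_function g"
    show "Sup S * wvar g \<le> energy g"
    proof (cases "wvar g = 0")
      case True
      then show ?thesis using energy_nonneg by simp
    next
      case False
      then have pos: "wvar g > 0" using wvar_nonneg[OF test_function_Cc[OF g]] by simp
      have "Sup S \<le> energy g / wvar g"
      proof (rule cSup_least)
        show "S \<noteq> {}" using S0 by blast
        show "\<kappa> \<le> energy g / wvar g" if "\<kappa> \<in> S" for \<kappa>
          using that pos g by (simp add: S_def poincare_def field_simps)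
      qed
      then show ?thesis using pos by (simp add: field_simps)
    qed
  qed
  moreover have "\<kappa> \<le> Sup S" if "poincare \<kappa>" for \<kappa>
    using that bdd by (intro cSup_upper) (auto simp: S_def)
  ultimately have eq: "spectral_gap U = Sup S"
    unfolding spectral_gap_eq by (rule Greatest_equality)
  show "poincare (spectral_gap U)" unfolding eq by fact
  show *: "\<And>\<kappa>. poincare \<kappa> \<Longrightarrow> \<kappa> \<le> spectral_gap U" unfolding eq by fact
  show "spectral_gap U \<ge> 0" using S0 by (intro *) (simp add: S_def)
qed

lemma spectral_gap_less_iff:
  "spectral_gap U < a \<longleftrightarrow> (\<exists>f. test_function f \<and> energy f < a * wvar f)"
proof
  assume "spectral_gap U < a"
  then have "\<not> poincare a" using le_spectral_gap by force
  then show "\<exists>f. test_function f \<and> energy f < a * wvar f" by (auto simp: poincare_def not_le)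
next
  assume "\<exists>f. test_function f \<and> energy f < a * wvar f"
  then obtain f where f: "test_function f" "energy f < a * wvar f" by blast
  have "spectral_gap U * wvar f \<le> energy f" using poincare_spectral_gap f by (auto simp: poincare_def)
  then have "spectral_gap U * wvar f < a * wvar f" using f by simp
  then show "spectral_gap U < a" using wvar_nonneg[OF test_function_Cc[OF f(1)]] mult_less_cancel_right by fastforce
qed

end

section \<open>Smallest eigenvalue of a symmetric matrix\<close>

text \<open>Eigenvectors of different eigenvalues are orthogonal, hence linearly independent.\<close>
lemma eigenvalues_finite:
  fixes A :: "real ^ 'n ^ 'n"
  assumes sym: "transpose A = A"
  shows "finite (eigenvalues A)"
proof -
  have "\<forall>c\<in>eigenvalues A. \<exists>v. v \<noteq> 0 \<and> A *v v = c *\<^sub>R v" by (auto simp: eigenvalues_def)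
  then obtain V where V: "\<And>c. c \<in> eigenvalues A \<Longrightarrow> V c \<noteq> 0 \<and> A *v V c = c *\<^sub>R V c" by metis
  have orth: "V c \<bullet> V d = 0" if "c \<in> eigenvalues A" "d \<in> eigenvalues A" "c \<noteq> d" for c d
  proof -
    have "c * (V c \<bullet> V d) = (A *v V c) \<bullet> V d" using V that by simp
    also have "\<dots> = V c \<bullet> (A *v V d)"
      by (metis sym dot_lmul_matrix inner_commute transpose_matrix_vector)
    also have "\<dots> = d * (V c \<bullet> V d)" using V that by simp
    finally show ?thesis using that(3) by simp
  qed
  have inj: "inj_on V (eigenvalues A)"
    by (rule inj_onI) (metis V orth inner_eq_zero_iff)
  have "independent (V ` eigenvalues A)"
    by (rule pairwise_orthogonal_independent) (use V orth in \<open>auto simp: pairwise_def orthogonal_def\<close>)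
  then have "finite (V ` eigenvalues A)" by (rule independent_imp_finite)
  then show ?thesis using inj by (rule finite_imageD)
qed

text \<open>The quadratic form attains its minimum \<open>m\<close> over the unit sphere at some \<open>v0\<close>; minimality in the
direction of the residual \<open>r = A v0 - m v0\<close> forces \<open>r = 0\<close>.\<close>
lemma rayleigh_minimum_eigenvalue:
  fixes A :: "real ^ 'n ^ 'n"
  assumes sym: "transpose A = A"
  obtains m where "m \<in> eigenvalues A" "\<And>v. m * (v \<bullet> v) \<le> v \<bullet> (A *v v)"
proof -
  have self: "(A *v u) \<bullet> v = u \<bullet> (A *v v)" for u v
    by (metis sym dot_lmul_matrix inner_commute transpose_matrix_vector)
  have cont: "continuous_on (sphere 0 1) (\<lambda>v. v \<bullet> (A *v v))"
    by (intro continuous_intros linear_continuous_on) (rule matrix_vector_mul_bounded_linear)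
  have "\<exists>v0\<in>sphere 0 1. \<forall>v\<in>sphere 0 1. v0 \<bullet> (A *v v0) \<le> v \<bullet> (A *v v)"
    by (rule continuous_attains_inf[OF compact_sphere _ cont]) simp
  then obtain v0 where v0: "v0 \<in> sphere 0 1" and min: "\<And>v. v \<in> sphere 0 1 \<Longrightarrow> v0 \<bullet> (A *v v0) \<le> v \<bullet> (A *v v)"
    by blast
  define m where "m = v0 \<bullet> (A *v v0)"
  have ray: "m * (v \<bullet> v) \<le> v \<bullet> (A *v v)" for v
  proof (cases "v = 0")
    case False
    define u where "u = (1 / norm v) *\<^sub>R v"
    have "u \<in> sphere 0 1" using False by (simp add: u_def)
    then have "m \<le> u \<bullet> (A *v u)" using min by (simp add: m_def)
    moreover have "u \<bullet> (A *v u) = (v \<bullet> (A *v v)) / (norm v)\<^sup>2"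
      by (simp add: u_def matrix_vector_mult_scaleR power2_eq_square)
    ultimately have "m \<le> (v \<bullet> (A *v v)) / (norm v)\<^sup>2" by simp
    then show ?thesis using False by (simp add: field_simps power2_norm_eq_inner)
  qed simp
  define r where "r = A *v v0 - m *\<^sub>R v0"
  define c where "c = r \<bullet> (A *v r) - m * (r \<bullet> r)"
  have c: "c \<ge> 0" using ray[of r] by (simp add: c_def)
  have q: "0 \<le> 2 * t * (r \<bullet> r) + t\<^sup>2 * c" for t
  proof -
    have "v0 \<bullet> v0 = 1" using v0 by (simp add: dot_square_norm)
    moreover have "A *v (v0 + t *\<^sub>R r) = A *v v0 + t *\<^sub>R (A *v r)"
      by (simp add: matrix_vector_right_distrib matrix_vector_mult_scaleR)
    moreover have "A *v v0 = r + m *\<^sub>R v0" by (simp add: r_def)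
    moreover have "v0 \<bullet> (A *v r) = (A *v v0) \<bullet> r" by (simp add: self)
    ultimately have "(v0 + t *\<^sub>R r) \<bullet> (A *v (v0 + t *\<^sub>R r)) - m * ((v0 + t *\<^sub>R r) \<bullet> (v0 + t *\<^sub>R r))
       = (v0 \<bullet> r) + m + t * (r \<bullet> r + m * (v0 \<bullet> r)) + t * (r \<bullet> r + m * (v0 \<bullet> r)) + t\<^sup>2 * (r \<bullet> (A *v r))
         - m * (1 + 2 * t * (v0 \<bullet> r) + t\<^sup>2 * (r \<bullet> r))"
      by (simp add: inner_add_left inner_add_right inner_commute algebra_simps power2_eq_square)
    moreover have "v0 \<bullet> r = 0" using \<open>v0 \<bullet> v0 = 1\<close> by (simp add: r_def inner_diff_right m_def)
    ultimately show ?thesis using ray[of "v0 + t *\<^sub>R r"] by (simp add: c_def algebra_simps)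
  qed
  have "r \<bullet> r = 0"
  proof (rule ccontr)
    assume "r \<bullet> r \<noteq> 0"
    then have n: "r \<bullet> r > 0" by simp
    define n where "n = r \<bullet> r"
    \<comment> \<open>a step of this size makes the linear term win against the quadratic one\<close>
    define q where "q = n / (c + 1)"
    have nq: "n = q * (c + 1)" using c by (simp add: q_def)
    have "q > 0" using c n by (simp add: q_def n_def)
    have "0 \<le> 2 * (- q) * n + (- q)\<^sup>2 * c" unfolding n_def by (rule q)
    also have "\<dots> = - (q\<^sup>2 * (c + 2))"
      by (simp add: nq algebra_simps power2_eq_square)
    also have "\<dots> < 0" using c \<open>q > 0\<close> by simp
    finally show False by simp
  qed
  then have "A *v v0 = m *\<^sub>R v0" by (simp add: r_def)
  moreover have "v0 \<noteq> 0" using v0 by auto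
  ultimately have "m \<in> eigenvalues A" by (auto simp: eigenvalues_def)
  then show ?thesis using ray that by blast
qed

lemma lambda_min_eigenvalue:
  fixes A :: "real ^ 'n ^ 'n"
  assumes sym: "transpose A = A"
  shows "lambda_min A \<in> eigenvalues A"
  unfolding lambda_min_def
  using eigenvalues_finite[OF sym] rayleigh_minimum_eigenvalue[OF sym] by (metis Min_in empty_iff)

lemma lambda_min_rayleigh:
  fixes A :: "real ^ 'n ^ 'n"
  assumes sym: "transpose A = A"
  shows "lambda_min A * (v \<bullet> v) \<le> v \<bullet> (A *v v)"
proof -
  obtain m where m: "m \<in> eigenvalues A" "\<And>v. m * (v \<bullet> v) \<le> v \<bullet> (A *v v)"
    using rayleigh_minimum_eigenvalue[OF sym] by blast
  have "lambda_min A \<le> m" unfolding lambda_min_def using eigenvalues_finite[OF sym] m(1) by simp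
  then have "lambda_min A * (v \<bullet> v) \<le> m * (v \<bullet> v)" by (rule mult_right_mono) simp
  then show ?thesis using m(2)[of v] by simp
qed

text \<open>Gershgorin's argument for the row at which \<open>\<bar>v $ i\<bar> / w i\<close> is maximal, where \<open>v\<close> is an
eigenvector.\<close>
lemma weighted_gershgorin:
  fixes A :: "real ^ 'n ^ 'n" and w :: "'n \<Rightarrow> real"
  assumes "c \<in> eigenvalues A" and w: "\<And>i. 0 < w i"
  shows "(MIN i. A $ i $ i - (\<Sum>j\<in>UNIV - {i}. \<bar>A $ i $ j\<bar> * (w j / w i))) \<le> c"
proof -
  obtain v where v: "v \<noteq> 0" "A *v v = c *\<^sub>R v" using assms(1) by (auto simp: eigenvalues_def)
  define M where "M = Max (range (\<lambda>i. \<bar>v $ i\<bar> / w i))"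
  have "M \<in> range (\<lambda>i. \<bar>v $ i\<bar> / w i)" unfolding M_def by (intro Max_in) auto
  then obtain i where i: "M = \<bar>v $ i\<bar> / w i" by blast
  have le: "\<bar>v $ j\<bar> \<le> M * w j" for j
  proof -
    have "\<bar>v $ j\<bar> / w j \<le> M" unfolding M_def by (intro Max_ge) auto
    then show ?thesis using w[of j] by (simp add: field_simps)
  qed
  have "M > 0"
  proof -
    obtain j where "v $ j \<noteq> 0" using v(1) by (metis vec_eq_iff zero_index)
    then have "0 < M * w j" using le[of j] by linarith
    then show ?thesis using w[of j] by (simp add: zero_less_mult_iff)
  qed
  then have vi: "\<bar>v $ i\<bar> > 0" "v $ i \<noteq> 0" using i w[of i] by (auto simp: zero_less_divide_iff)
  have "(A *v v) $ i = (\<Sum>j\<in>UNIV. A $ i $ j * v $ j)" by (simp add: matrix_vector_mult_def)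
  also have "\<dots> = A $ i $ i * v $ i + (\<Sum>j\<in>UNIV - {i}. A $ i $ j * v $ j)"
    by (subst sum.remove[of UNIV i]) auto
  finally have "(A $ i $ i - c) * v $ i = - (\<Sum>j\<in>UNIV - {i}. A $ i $ j * v $ j)"
    using v(2) by (simp add: algebra_simps)
  then have "\<bar>A $ i $ i - c\<bar> * \<bar>v $ i\<bar> = \<bar>\<Sum>j\<in>UNIV - {i}. A $ i $ j * v $ j\<bar>"
    by (metis abs_minus_cancel abs_mult)
  also have "\<dots> \<le> (\<Sum>j\<in>UNIV - {i}. \<bar>A $ i $ j\<bar> * (w j / w i) * \<bar>v $ i\<bar>)"
  proof (rule order_trans[OF sum_abs], rule sum_mono)
    fix j
    have "\<bar>A $ i $ j * v $ j\<bar> \<le> \<bar>A $ i $ j\<bar> * (M * w j)"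
      unfolding abs_mult by (intro mult_left_mono le) auto
    then show "\<bar>A $ i $ j * v $ j\<bar> \<le> \<bar>A $ i $ j\<bar> * (w j / w i) * \<bar>v $ i\<bar>" by (simp add: i mult_ac)
  qed
  also have "\<dots> = (\<Sum>j\<in>UNIV - {i}. \<bar>A $ i $ j\<bar> * (w j / w i)) * \<bar>v $ i\<bar>" by (simp add: sum_distrib_right)
  finally have "\<bar>A $ i $ i - c\<bar> \<le> (\<Sum>j\<in>UNIV - {i}. \<bar>A $ i $ j\<bar> * (w j / w i))"
    using vi(1) by (rule mult_right_le_imp_le)
  then have "A $ i $ i - (\<Sum>j\<in>UNIV - {i}. \<bar>A $ i $ j\<bar> * (w j / w i)) \<le> c" by linarith
  then show ?thesis by (meson Min_le finite_class.finite_UNIV finite_imageI order_trans rangeI)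
qed

section \<open>The generator and integration by parts\<close>

locale smooth_weight =
  fixes U :: "'a::euclidean_space \<Rightarrow> real"
  assumes smoothU: "smooth U"
    and intU': "integrable lborel (\<lambda>x. exp (- U x))"

sublocale smooth_weight \<subseteq> weight U
  using smoothU intU' by unfold_locales (auto intro: smooth_continuous)

text \<open>The part of the generator that differentiates in direction \<open>b\<close>.\<close>
definition gen1 :: "('a::euclidean_space \<Rightarrow> real) \<Rightarrow> 'a \<Rightarrow> ('a \<Rightarrow> real) \<Rightarrow> 'a \<Rightarrow> real" where
  "gen1 U b u x = pd b (pd b u) x - pd b U x * pd b u x"

definition gen :: "('a::euclidean_space \<Rightarrow> real) \<Rightarrow> ('a \<Rightarrow> real) \<Rightarrow> 'a \<Rightarrow> real" where
  "gen U u x = (\<Sum>b\<in>Basis. gen1 U b u x)"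

lemma test_function_gen1:
  assumes "smooth U" "test_function u" "b \<in> Basis" shows "test_function (gen1 U b u)"
  unfolding gen1_def using assms
  by (intro test_function_diff test_function_mult test_function_pd smooth_pd)

lemma test_function_gen:
  assumes "smooth U" "test_function u" shows "test_function (gen U u)"
  unfolding gen_def using assms by (intro test_function_sum test_function_gen1)

context smooth_weight
begin

lemma contdU [continuous_intros]: "b \<in> Basis \<Longrightarrow> continuous_on A (pd b U)"
  by (rule smooth_pd_continuous[OF smoothU])

lemma dd_\<rho>: "dd b \<rho> (\<lambda>x. \<rho> x * (- pd b U x))"
  by (intro dd_exp dd_minus smooth_dd smoothU)

lemma weighted_ibp:
  assumes b: "b \<in> Basis" and a: "dd b a a'" "continuous_on UNIV a" "continuous_on UNIV a'"
    and c: "dd b c c'" "continuous_on UNIV c" "continuous_on UNIV c'"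
    and cs: "Cc a \<or> Cc c"
  shows "(LBINT x. a x * (c' x - pd b U x * c x) * \<rho> x) = - (LBINT x. a' x * c x * \<rho> x)"
proof -
  have a': "Cc a \<Longrightarrow> Cc a'" using a dd_Cc_deriv_support by blast
  have c': "Cc c \<Longrightarrow> Cc c'" using c dd_Cc_deriv_support by blast
  have 1: "dd b (\<lambda>x. (a x * c x) * \<rho> x) (\<lambda>x. (a' x * c x + a x * c' x) * \<rho> x + (a x * c x) * (\<rho> x * (- pd b U x)))"
    by (intro dd_mult dd_\<rho> a c)
  have "Cc (\<lambda>x. a x * c x)"
    using cs Cc_mult2[OF c(2), of a] Cc_mult1[OF a(2), of c] by blast
  then have 2: "Cc (\<lambda>x. (a x * c x) * \<rho> x)" by (rule Cc_mult2[OF cont\<rho>])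
  have "(LBINT x. (a' x * c x + a x * c' x) * \<rho> x + (a x * c x) * (\<rho> x * (- pd b U x))) = 0"
    by (rule integral_dd_eq_0[OF 1 2]) (intro continuous_intros a c b)
  also have "(\<lambda>x. (a' x * c x + a x * c' x) * \<rho> x + (a x * c x) * (\<rho> x * (- pd b U x)))
      = (\<lambda>x. a' x * c x * \<rho> x + a x * (c' x - pd b U x * c x) * \<rho> x)"
    by (auto simp: algebra_simps)
  also have "(LBINT x. a' x * c x * \<rho> x + a x * (c' x - pd b U x * c x) * \<rho> x)
     = (LBINT x. a' x * c x * \<rho> x) + (LBINT x. a x * (c' x - pd b U x * c x) * \<rho> x)"
  proof (rule Bochner_Integration.integral_add)
    have "Cc (\<lambda>x. a' x * c x)"
      using cs Cc_mult2[OF c(2) a'] Cc_mult1[OF a(3)] by blast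
    then show "integrable lborel (\<lambda>x. a' x * c x * \<rho> x)" by (rule integrable_Cc_\<rho>)
    have "Cc (\<lambda>x. a x * (c' x - pd b U x * c x))"
    proof (cases "Cc a")
      case True then show ?thesis using b c by (intro Cc_mult2 continuous_intros) auto
    next
      case False
      then have "Cc c" using cs by simp
      then have "Cc (\<lambda>x. c' x - pd b U x * c x)" using c' by (intro Cc_diff Cc_mult1 contdU b)
      then show ?thesis using a by (intro Cc_mult1)
    qed
    then show "integrable lborel (\<lambda>x. a x * (c' x - pd b U x * c x) * \<rho> x)" by (rule integrable_Cc_\<rho>)
  qed
  finally show ?thesis by simp
qed

lemma ibp_gen1:
  assumes b: "b \<in> Basis" and a: "dd b a a'" "continuous_on UNIV a" "continuous_on UNIV a'"
    and w: "test_function w"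
  shows "(LBINT x. a x * gen1 U b w x * \<rho> x) = - (LBINT x. a' x * pd b w x * \<rho> x)"
proof -
  have "test_function (pd b w)" using b w by (intro test_function_pd)
  then show ?thesis unfolding gen1_def
    by (intro weighted_ibp b a)
       (auto intro: smooth_dd smooth_continuous smooth_pd test_function_smooth test_function_Cc b)
qed

text \<open>The mixed terms of Bochner's formula. One integration by parts moves \<open>\<partial>\<^sub>b\<close> from the first factor
to \<open>L\<^sub>c u\<close>; commuting it with \<open>L\<^sub>c\<close> costs the term with \<open>\<partial>\<^sub>b \<partial>\<^sub>c U\<close>, and a second one moves
\<open>\<partial>\<^sub>c\<close> back.\<close>
lemma integral_gen1_mult_gen1:
  assumes u: "test_function u" and b: "b \<in> Basis" and c: "c \<in> Basis"
  shows "(LBINT x. gen1 U b u x * gen1 U c u x * \<rho> x)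
    = (LBINT x. ((pd c (pd b u) x)\<^sup>2 + pd b (pd c U) x * pd b u x * pd c u x) * \<rho> x)"
proof -
  note su = test_function_smooth[OF u]
  note tu = test_function_pd[OF u]
  have tL: "test_function (gen1 U c u)" by (rule test_function_gen1[OF smoothU u c])
  have comm: "pd b (pd c u) = pd c (pd b u)" by (rule smooth_pd_commute[OF su c b])
  have "dd b (gen1 U c u) (\<lambda>x. pd b (pd c (pd c u)) x - (pd b (pd c U) x * pd c u x + pd c U x * pd b (pd c u) x))"
    unfolding gen1_def by (intro dd_diff dd_mult smooth_dd smooth_pd su smoothU b c)
  then have D: "dd b (gen1 U c u) (\<lambda>x. gen1 U c (pd b u) x - pd b (pd c U) x * pd c u x)"
    unfolding gen1_def smooth_pd_commute[OF smooth_pd[OF su c] c b] comm by (simp add: algebra_simps)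
  have "(LBINT x. gen1 U b u x * gen1 U c u x * \<rho> x) = (LBINT x. gen1 U c u x * gen1 U b u x * \<rho> x)"
    by (simp add: mult.commute)
  also have "\<dots> = - (LBINT x. (gen1 U c (pd b u) x - pd b (pd c U) x * pd c u x) * pd b u x * \<rho> x)"
  proof (rule ibp_gen1[OF b D _ _ u])
    show "continuous_on UNIV (gen1 U c u)" by (intro smooth_continuous test_function_smooth tL)
    show "continuous_on UNIV (\<lambda>x. gen1 U c (pd b u) x - pd b (pd c U) x * pd c u x)"
      by (intro continuous_on_diff continuous_on_mult smooth_continuous smooth_pd su smoothU b c
          test_function_smooth test_function_gen1 tu)
  qed
  also have "(LBINT x. (gen1 U c (pd b u) x - pd b (pd c U) x * pd c u x) * pd b u x * \<rho> x)
     = (LBINT x. pd b u x * gen1 U c (pd b u) x * \<rho> x - pd b (pd c U) x * pd b u x * pd c u x * \<rho> x)"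
    by (simp add: algebra_simps)
  also have "\<dots> = (LBINT x. pd b u x * gen1 U c (pd b u) x * \<rho> x) - (LBINT x. pd b (pd c U) x * pd b u x * pd c u x * \<rho> x)"
    using test_function_gen1[OF smoothU tu[OF b] c] tu b c smoothU
    by (intro Bochner_Integration.integral_diff integrable_Cc_\<rho> Cc_mult1 test_function_Cc continuous_intros smooth_continuous)
       (auto intro: smooth_pd test_function_smooth)
  also have "(LBINT x. pd b u x * gen1 U c (pd b u) x * \<rho> x) = - (LBINT x. pd c (pd b u) x * pd c (pd b u) x * \<rho> x)"
    using su b c by (intro ibp_gen1 c tu b smooth_dd smooth_continuous smooth_pd)
  finally have "(LBINT x. gen1 U b u x * gen1 U c u x * \<rho> x) =
      (LBINT x. pd c (pd b u) x * pd c (pd b u) x * \<rho> x) + (LBINT x. pd b (pd c U) x * pd b u x * pd c u x * \<rho> x)"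
    by simp
  also have "\<dots> = (LBINT x. pd c (pd b u) x * pd c (pd b u) x * \<rho> x + pd b (pd c U) x * pd b u x * pd c u x * \<rho> x)"
    using tu b c smoothU
    by (intro Bochner_Integration.integral_add[symmetric] integrable_Cc_\<rho> Cc_mult1 test_function_Cc continuous_intros smooth_continuous test_function_pd)
       (auto intro: smooth_pd test_function_smooth u)
  finally show ?thesis by (simp add: power2_eq_square algebra_simps)
qed

lemma integral_mult_gen:
  assumes u: "test_function u" and v: "test_function v"
  shows "(LBINT x. u x * gen U v x * \<rho> x) = - (LBINT x. (\<Sum>b\<in>Basis. pd b u x * pd b v x) * \<rho> x)"
proof -
  note su = test_function_smooth[OF u]
  have "(LBINT x. u x * gen U v x * \<rho> x) = (LBINT x. (\<Sum>b\<in>Basis. u x * gen1 U b v x * \<rho> x))"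
    by (simp add: gen_def sum_distrib_left sum_distrib_right)
  also have "\<dots> = (\<Sum>b\<in>Basis. LBINT x. u x * gen1 U b v x * \<rho> x)"
    by (intro Bochner_Integration.integral_sum integrable_Cc_\<rho> Cc_mult1 smooth_continuous su test_function_Cc test_function_gen1 smoothU v)
  also have "\<dots> = (\<Sum>b\<in>Basis. - (LBINT x. pd b u x * pd b v x * \<rho> x))"
    by (intro sum.cong refl ibp_gen1 smooth_dd su smooth_continuous smooth_pd v)
  also have "\<dots> = - (\<Sum>b\<in>Basis. (LBINT x. pd b u x * pd b v x * \<rho> x))" by (simp add: sum_negf)
  also have "(\<Sum>b\<in>Basis. (LBINT x. pd b u x * pd b v x * \<rho> x)) = (LBINT x. (\<Sum>b\<in>Basis. pd b u x * pd b v x * \<rho> x))"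
    by (intro Bochner_Integration.integral_sum[symmetric] integrable_Cc_\<rho> Cc_mult1 smooth_continuous smooth_pd su test_function_Cc test_function_pd v)
  finally show ?thesis by (simp add: sum_distrib_right)
qed

lemma integral_gen_eq_0:
  assumes v: "test_function v"
  shows "(LBINT x. gen U v x * \<rho> x) = 0"
proof -
  have "(LBINT x. gen U v x * \<rho> x) = (LBINT x. (\<Sum>b\<in>Basis. 1 * gen1 U b v x * \<rho> x))"
    by (simp add: gen_def sum_distrib_right)
  also have "\<dots> = (\<Sum>b\<in>Basis. LBINT x. 1 * gen1 U b v x * \<rho> x)"
    by (intro Bochner_Integration.integral_sum integrable_Cc_\<rho> Cc_mult1 test_function_Cc test_function_gen1 smoothU v) auto
  also have "\<dots> = (\<Sum>b\<in>Basis. - (LBINT x. 0 * pd b v x * \<rho> x))"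
    by (intro sum.cong refl ibp_gen1 v dd_const) auto
  finally show ?thesis by simp
qed

text \<open>The Poincare inequality controls \<open>u\<close> minus its mean \<open>m\<close> by its energy, and the energy is
\<open>- \<integral> (u - m) L u \<rho>\<close>. Young's inequality with parameter \<open>\<kappa>\<close> is enough, so that no square root
appears.\<close>
lemma poincare_imp_energy_le:
  assumes \<kappa>: "poincare \<kappa>" "\<kappa> \<ge> 0" and u: "test_function u"
  shows "\<kappa> * energy u \<le> (LBINT x. (gen U u x)\<^sup>2 * \<rho> x)"
proof (cases "\<kappa> = 0")
  case True
  then show ?thesis by (auto intro!: Bochner_Integration.integral_nonneg)
next
  case False
  then have kpos: "\<kappa> > 0" using \<kappa> by simp
  note Cu = test_function_Cc[OF u]
  define m where "m = (LBINT x. u x * \<rho> x) / Z"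
  have tL: "test_function (gen U u)" by (rule test_function_gen[OF smoothU u])
  have [measurable]: "u \<in> borel_measurable borel" "gen U u \<in> borel_measurable borel"
    using Cu tL by (auto intro: Cc_measurable test_function_Cc)
  obtain B where B: "B > 0" "\<And>x. \<bar>u x\<bar> \<le> B" using Cc_boundE[OF Cu] by blast
  have "\<bar>(u x - m)\<^sup>2\<bar> \<le> (B + \<bar>m\<bar>)\<^sup>2" for x
    using B(2)[of x] by (auto simp: abs_le_square_iff[symmetric] intro!: power2_le_iff_abs_le[THEN iffD2])
  then have i1: "integrable lborel (\<lambda>x. (u x - m)\<^sup>2 * \<rho> x)"
    by (intro integrable_bounded_\<rho>[where B="(B + \<bar>m\<bar>)\<^sup>2"]) auto
  have i2: "integrable lborel (\<lambda>x. (gen U u x)\<^sup>2 * \<rho> x)"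
    by (intro integrable_Cc_\<rho> Cc_power2 test_function_Cc tL)
  have i3: "integrable lborel (\<lambda>x. u x * gen U u x * \<rho> x)" "integrable lborel (\<lambda>x. gen U u x * \<rho> x)"
    by (intro integrable_Cc_\<rho> Cc_mult1 Cc_cont[OF Cu] test_function_Cc tL)+
  have e: "energy u = - (LBINT x. u x * gen U u x * \<rho> x)"
    using integral_mult_gen[OF u u] by (simp add: energy_def power2_eq_square)
  have "2 * \<kappa> * energy u = (LBINT x. (- 2 * \<kappa>) * (u x * gen U u x * \<rho> x) + (2 * \<kappa> * m) * (gen U u x * \<rho> x))"
    using i3 by (subst Bochner_Integration.integral_add) (simp_all add: e integral_gen_eq_0[OF u])
  also have "\<dots> \<le> (LBINT x. \<kappa>\<^sup>2 * ((u x - m)\<^sup>2 * \<rho> x) + (gen U u x)\<^sup>2 * \<rho> x)"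
  proof (rule integral_mono)
    fix x
    \<comment> \<open>Young's inequality; the mean \<open>m\<close> is free because \<open>L u\<close> integrates to zero\<close>
    have "0 \<le> (\<kappa> * (u x - m) + gen U u x)\<^sup>2 * \<rho> x" by simp
    then show "(- 2 * \<kappa>) * (u x * gen U u x * \<rho> x) + (2 * \<kappa> * m) * (gen U u x * \<rho> x)
        \<le> \<kappa>\<^sup>2 * ((u x - m)\<^sup>2 * \<rho> x) + (gen U u x)\<^sup>2 * \<rho> x"
      by (simp add: power2_eq_square algebra_simps)
  qed (use i1 i2 i3 in auto)
  also have "\<dots> = \<kappa>\<^sup>2 * wvar u + (LBINT x. (gen U u x)\<^sup>2 * \<rho> x)"
    using i1 i2 by (simp add: wvar_mean[OF Cu] m_def)
  also have "\<kappa>\<^sup>2 * wvar u \<le> \<kappa> * energy u"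
    using \<kappa> u by (auto simp: poincare_def power2_eq_square mult.assoc intro!: mult_left_mono)
  finally show ?thesis by simp
qed

end

section \<open>Integration along parallel lines\<close>

lemma nn_integral_shift:
  fixes f :: "'a::euclidean_space \<Rightarrow> ennreal"
  assumes [measurable]: "f \<in> borel_measurable borel"
  shows "(\<integral>\<^sup>+x. f (c + x) \<partial>lborel) = (\<integral>\<^sup>+x. f x \<partial>lborel)"
proof -
  have "(\<integral>\<^sup>+x. f x \<partial>lborel) = (\<integral>\<^sup>+x. f x \<partial>(distr lborel borel ((+) c)))"
    by (simp add: lborel_distr_plus)
  also have "\<dots> = (\<integral>\<^sup>+x. f (c + x) \<partial>lborel)"
    by (subst nn_integral_distr) auto
  finally show ?thesis by simp
qed

text \<open>A disintegration of Lebesgue measure into lines parallel to \<open>b\<close> that needs no splitting of the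
space into a line and its complement: each line meets the slab \<open>0 \<le> x \<bullet> b \<le> 1\<close> in a unit segment,
and moving the starting point along that segment does not change the integral over the line.\<close>
lemma nn_integral_along_lines:
  fixes f :: "'a::euclidean_space \<Rightarrow> ennreal"
  assumes [measurable]: "f \<in> borel_measurable borel" and b: "b \<in> Basis"
  shows "(\<integral>\<^sup>+x. indicator {0..1} (x \<bullet> b) * (\<integral>\<^sup>+t. f (x + t *\<^sub>R b) \<partial>lborel) \<partial>lborel) = (\<integral>\<^sup>+x. f x \<partial>lborel)"
proof -
  have "(\<integral>\<^sup>+x. indicator {0..1} (x \<bullet> b) * (\<integral>\<^sup>+t. f (x + t *\<^sub>R b) \<partial>lborel) \<partial>lborel)
      = (\<integral>\<^sup>+x. (\<integral>\<^sup>+t. indicator {0..1} (x \<bullet> b) * f (x + t *\<^sub>R b) \<partial>lborel) \<partial>lborel)"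
    by (intro nn_integral_cong nn_integral_cmult[symmetric]) measurable
  also have "\<dots> = (\<integral>\<^sup>+t. (\<integral>\<^sup>+x. indicator {0..1} (x \<bullet> b) * f (x + t *\<^sub>R b) \<partial>lborel) \<partial>lborel)"
    by (rule lborel_pair.Fubini'[symmetric]) measurable
  also have "\<dots> = (\<integral>\<^sup>+t. (\<integral>\<^sup>+x. indicator {0..1} (x \<bullet> b - t) * f x \<partial>lborel) \<partial>lborel)"
  proof (rule nn_integral_cong)
    fix t :: real
    have "(\<integral>\<^sup>+x. indicator {0..1} (x \<bullet> b) * f (x + t *\<^sub>R b) \<partial>lborel)
       = (\<integral>\<^sup>+x. (\<lambda>y. indicator {0..1} (y \<bullet> b - t) * f y) (t *\<^sub>R b + x) \<partial>lborel)"
      using b by (simp add: inner_add_left add.commute)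
    also have "\<dots> = (\<integral>\<^sup>+x. indicator {0..1} (x \<bullet> b - t) * f x \<partial>lborel)"
      by (rule nn_integral_shift) measurable
    finally show "(\<integral>\<^sup>+x. indicator {0..1} (x \<bullet> b) * f (x + t *\<^sub>R b) \<partial>lborel)
       = (\<integral>\<^sup>+x. indicator {0..1} (x \<bullet> b - t) * f x \<partial>lborel)" .
  qed
  also have "\<dots> = (\<integral>\<^sup>+x. (\<integral>\<^sup>+t. indicator {0..1} (x \<bullet> b - t) * f x \<partial>lborel) \<partial>lborel)"
    by (rule lborel_pair.Fubini') measurable
  also have "\<dots> = (\<integral>\<^sup>+x. f x \<partial>lborel)"
  proof (rule nn_integral_cong)
    fix x :: 'a
    have "(\<integral>\<^sup>+t. indicator {0..1} (x \<bullet> b - t) * f x \<partial>lborel) = (\<integral>\<^sup>+t. indicator {x \<bullet> b - 1..x \<bullet> b} t * f x \<partial>lborel)"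
      by (intro nn_integral_cong arg_cong2[where f="(*)"]) (auto simp: indicator_def)
    also have "\<dots> = emeasure lborel {x \<bullet> b - 1..x \<bullet> b} * f x"
      by (subst nn_integral_multc) auto
    finally show "(\<integral>\<^sup>+t. indicator {0..1} (x \<bullet> b - t) * f x \<partial>lborel) = f x" by simp
  qed
  finally show ?thesis .
qed

lemma nn_integral_mono_lines:
  fixes P Q :: "'a::euclidean_space \<Rightarrow> ennreal"
  assumes [measurable]: "P \<in> borel_measurable borel" "Q \<in> borel_measurable borel" and b: "b \<in> Basis"
    and le: "\<And>x. (\<integral>\<^sup>+t. Q (x + t *\<^sub>R b) \<partial>lborel) \<le> (\<integral>\<^sup>+t. P (x + t *\<^sub>R b) \<partial>lborel)"
  shows "(\<integral>\<^sup>+x. Q x \<partial>lborel) \<le> (\<integral>\<^sup>+x. P x \<partial>lborel)"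
  by (subst (1 2) nn_integral_along_lines[OF _ b, symmetric]) (auto intro!: nn_integral_mono mult_left_mono le)

section \<open>Spectral gaps of lines\<close>

lemma continuous_on_param_integral:
  fixes h :: "'a::euclidean_space \<Rightarrow> 'b::euclidean_space \<Rightarrow> real"
  assumes cont: "continuous_on UNIV (\<lambda>(x, t). h x t)"
    and supp: "\<And>x t. norm t > R \<Longrightarrow> h x t = 0"
  shows "continuous_on UNIV (\<lambda>x. LBINT t. h x t)"
proof -
  have ch: "continuous_on UNIV (\<lambda>t. h x t)" for x
  proof -
    have "continuous_on UNIV (\<lambda>t::'b. (x, t))" by (intro continuous_intros)
    from continuous_on_compose2[OF cont this] show ?thesis by simp
  qed
  have ct: "continuous_on UNIV (\<lambda>x. h x t)" for t
  proof -
    have "continuous_on UNIV (\<lambda>x::'a. (x, t))" by (intro continuous_intros)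
    from continuous_on_compose2[OF cont this] show ?thesis by simp
  qed
  have [measurable]: "h x \<in> borel_measurable borel" for x
    using ch by (rule borel_measurable_continuous_onI)
  have "(\<lambda>n. LBINT t. h (s n) t) \<longlonglongrightarrow> (LBINT t. h x t)" if s: "s \<longlonglongrightarrow> x" for s x
  proof -
    have "bounded (range s)" using s by (intro convergent_imp_bounded) (auto simp: convergent_def)
    then obtain r where r: "\<And>n. norm (s n) \<le> r" unfolding bounded_iff by auto
    have "compact ((\<lambda>(x, t). h x t) ` (cball 0 r \<times> cball 0 R))"
      by (intro compact_continuous_image continuous_on_subset[OF cont] compact_Times) auto
    then have "bounded ((\<lambda>(x, t). h x t) ` (cball 0 r \<times> cball 0 R))" by (rule compact_imp_bounded)
    then obtain B where B': "\<And>p. p \<in> cball 0 r \<times> cball 0 R \<Longrightarrow> norm (case p of (x, t) \<Rightarrow> h x t) \<le> B"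
      unfolding bounded_iff by blast
    have B: "\<bar>h x t\<bar> \<le> B" if "norm x \<le> r" "norm t \<le> R" for x t
      using B'[of "(x, t)"] that by simp
    show ?thesis
    proof (rule integral_dominated_convergence[where w="\<lambda>t. B * indicator (cball 0 R) t"])
      show "integrable lborel (\<lambda>t::'b. B * indicator (cball 0 R) t :: real)"
        by (intro integrable_mult_right integrable_real_indicator)
           (use emeasure_lborel_cball_finite[of 0 R] in \<open>auto simp: top.not_eq_extremum\<close>)
      show "AE t in lborel. (\<lambda>n. h (s n) t) \<longlonglongrightarrow> h x t"
        by (rule AE_I2, rule continuous_on_tendsto_compose[OF ct s]) auto
      show "AE t in lborel. norm (h (s n) t) \<le> B * indicator (cball 0 R) t" for n
      proof (rule AE_I2)
        fix t :: 'b
        show "norm (h (s n) t) \<le> B * indicator (cball 0 R) t"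
          using B[OF r[of n], of t] supp[of t "s n"] by (cases "norm t \<le> R") (auto simp: indicator_def)
      qed
    qed (auto simp: measurable)
  qed
  then show ?thesis
    unfolding continuous_on_sequentially o_def by blast
qed

text \<open>The restriction of \<open>U\<close> to the line through \<open>x\<close> in direction \<open>b\<close>, parametrised by the coordinate
along \<open>b\<close>, so that it depends on the line only.\<close>
definition line :: "('a::euclidean_space \<Rightarrow> real) \<Rightarrow> 'a \<Rightarrow> 'a \<Rightarrow> real \<Rightarrow> real" where
  "line U b x t = U (x - (x \<bullet> b) *\<^sub>R b + t *\<^sub>R b)"

lemma line_shift: "b \<in> Basis \<Longrightarrow> line U b (x + s *\<^sub>R b) = line U b x"
  by (auto simp: line_def fun_eq_iff inner_add_left algebra_simps)

lemma smooth_line: "smooth U \<Longrightarrow> smooth (line U b x)"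
  unfolding line_def[abs_def]
  by (rule smooth_affine[where L="\<lambda>t. t *\<^sub>R b"]) (auto intro!: linearI simp: algebra_simps)

lemma pd_line: assumes "smooth U" shows "pd 1 (line U b x) = line (pd b U) b x"
proof (rule pd_eqI)
  show "line U b x differentiable_on UNIV" by (intro smooth_differentiable smooth_line assms)
  show "dd 1 (line U b x) (line (pd b U) b x)"
    unfolding dd_def
  proof
    fix s :: real
    from ddD[OF smooth_dd[OF assms, of b], of "x - (x \<bullet> b) *\<^sub>R b + s *\<^sub>R b"]
    show "((\<lambda>t. line U b x (s + t *\<^sub>R 1)) has_real_derivative line (pd b U) b x s) (at 0)"
      by (simp add: line_def algebra_simps)
  qed
qed

lemma test_function_line: assumes "test_function u" "b \<in> Basis" shows "test_function (line u b x)"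
proof (rule test_functionI)
  show s: "smooth (line u b x)" by (intro smooth_line test_function_smooth assms)
  obtain R where R: "R > 0" "\<And>x. norm x > R \<Longrightarrow> u x = 0" using Cc_supportE[OF test_function_Cc[OF assms(1)]] by blast
  show "Cc (line u b x)"
  proof (rule CcI[OF smooth_continuous[OF s]])
    fix t :: real assume t: "R + norm (x - (x \<bullet> b) *\<^sub>R b) < norm t"
    have "norm b = 1" using assms(2) by (rule norm_Basis)
    then have "R < norm (x - (x \<bullet> b) *\<^sub>R b + t *\<^sub>R b)"
      using t norm_triangle_ineq4[of "x - (x \<bullet> b) *\<^sub>R b + t *\<^sub>R b" "x - (x \<bullet> b) *\<^sub>R b"] by simp
    then show "line u b x t = 0" unfolding line_def by (rule R)
  qed
qed

lemma line_smooth_weight: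
  assumes "smooth U" "integrable lborel (\<lambda>t. exp (- line U b x t))"
  shows "smooth_weight (line U b x)"
  using assms by unfold_locales (auto intro: smooth_line)

text \<open>The generator of the restricted potential acts on the restricted function as \<open>L\<^sub>b\<close>, so this is the
one-dimensional case of \<open>poincare_imp_energy_le\<close>.\<close>
lemma line_gap_energy:
  assumes U: "smooth U" "integrable lborel (\<lambda>t. exp (- line U b x t))"
    and u: "test_function u" and b: "b \<in> Basis"
  shows "spectral_gap (line U b x) * (LBINT t. (line (pd b u) b x t)\<^sup>2 * exp (- line U b x t))
     \<le> (LBINT t. (line (gen1 U b u) b x t)\<^sup>2 * exp (- line U b x t))"
proof -
  interpret smooth_weight "line U b x" by (rule line_smooth_weight[OF U])
  note su = test_function_smooth[OF u]
  have e: "energy (line u b x) = (LBINT t. (line (pd b u) b x t)\<^sup>2 * exp (- line U b x t))"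
    by (simp add: energy_def pd_line[OF su])
  have "pd 1 (line (pd b u) b x) = line (pd b (pd b u)) b x" by (intro pd_line smooth_pd su b)
  then have l: "gen (line U b x) (line u b x) = line (gen1 U b u) b x"
    by (auto simp: gen_def gen1_def pd_line[OF su] pd_line[OF U(1)] fun_eq_iff) (auto simp: line_def gen1_def)
  have "spectral_gap (line U b x) * energy (line u b x) \<le> (LBINT t. (gen (line U b x) (line u b x) t)\<^sup>2 * exp (- line U b x t))"
    by (intro poincare_imp_energy_le poincare_spectral_gap spectral_gap_nonneg test_function_line u b)
  then show ?thesis unfolding e l .
qed

text \<open>The sublevel sets are open. The gap of the line is below \<open>a\<close> if and only if some test function
violates the inequality with constant \<open>a\<close>, and for a fixed test function the integrals involved
depend continuously on \<open>x\<close>, with the exception of the total mass \<open>Z\<close> of the line. That mass is the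
increasing limit of the continuous masses \<open>Zm m x\<close> of truncations, and replacing it by them only
decreases the variance, so the condition becomes a union over \<open>m\<close> of open conditions.\<close>
lemma line_gap_measurable:
  fixes U :: "'a::euclidean_space \<Rightarrow> real"
  assumes U: "smooth U" and int: "\<And>x. integrable lborel (\<lambda>t. exp (- line U b x t))"
  shows "(\<lambda>x. spectral_gap (line U b x)) \<in> borel_measurable borel"
proof (rule borel_measurableI_less)
  fix a :: real
  let ?G = "\<lambda>x. spectral_gap (line U b x)"
  define \<rho> where "\<rho> x t = exp (- line U b x t)" for x t
  have W: "weight (line U b x)" for x
    by (intro weight.intro smooth_continuous smooth_line U int)
  \<comment> \<open>truncations of the constant function 1; index \<open>Suc m\<close> keeps them positive at \<open>0\<close>\<close>
  define ht :: "nat \<Rightarrow> real \<Rightarrow> real" where "ht m t = max 0 (min 1 (real (Suc m) - \<bar>t\<bar>))" for m t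
  have ht: "Cc (ht m)" "0 \<le> ht m t" "ht m t \<le> 1" "ht m 0 > 0" for m t
    by (auto simp: ht_def intro!: continuous_intros CcI[where R="real (Suc m)"])
  have htlim: "(\<lambda>m. ht m t) \<longlonglongrightarrow> 1" for t
  proof (rule tendsto_eventually)
    obtain N where "\<bar>t\<bar> \<le> real N" using real_arch_simple by blast
    then show "eventually (\<lambda>m. ht m t = 1) sequentially"
      by (intro eventually_sequentiallyI[of N]) (auto simp: ht_def)
  qed
  have contUl: "continuous_on UNIV (\<lambda>(x, t). line U b x t)"
    unfolding line_def case_prod_beta
    by (rule continuous_on_compose2[OF smooth_continuous[OF U, of UNIV]]) (auto intro!: continuous_intros)
  have cont: "continuous_on UNIV (\<lambda>x. LBINT t. \<phi> t * \<rho> x t)" if \<phi>: "Cc \<phi>" for \<phi> :: "real \<Rightarrow> real"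
  proof -
    obtain R where R: "\<And>x. norm x > R \<Longrightarrow> \<phi> x = 0" using Cc_supportE[OF \<phi>] by blast
    show ?thesis
    proof (rule continuous_on_param_integral[where R=R])
      have "continuous_on UNIV (\<lambda>p::'a \<times> real. \<phi> (snd p))"
        by (rule continuous_on_compose2[OF Cc_cont[OF \<phi>]]) (auto intro!: continuous_intros)
      then show "continuous_on UNIV (\<lambda>(x::'a, t). \<phi> t * \<rho> x t)"
        using contUl unfolding \<rho>_def case_prod_beta by (auto intro!: continuous_intros)
    qed (use R in auto)
  qed
  define Zm where "Zm m x = (LBINT t. ht m t * \<rho> x t)" for m x
  have Zpos: "Zm m x > 0" for m x
  proof -
    interpret weight "line U b x" by (rule W)
    have "Cc (\<lambda>t. ht m t * \<rho> x t)" unfolding \<rho>_def by (intro Cc_mult2 ht cont\<rho>)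
    then show ?thesis unfolding Zm_def
      by (intro continuous_integral_pos[where x=0]) (auto intro: Cc_cont Cc_integrable simp: ht \<rho>_def)
  qed
  define D where "D f m x = (LBINT t. (f t)\<^sup>2 * \<rho> x t) - (LBINT t. f t * \<rho> x t)\<^sup>2 / Zm m x" for f m x
  define E where "E f x = (LBINT t. (pd 1 f t)\<^sup>2 * \<rho> x t)" for f :: "real \<Rightarrow> real" and x
  \<comment> \<open>the description of the sublevel set by conditions that are open in \<open>x\<close>\<close>
  have main: "?G x < a \<longleftrightarrow> (\<exists>f m. test_function f \<and> E f x < a * D f m x)" if "a > 0" for x
  proof -
    interpret weight "line U b x" by (rule W)
    have E: "energy f = E f x" for f by (simp add: energy_def E_def \<rho>_def)
    have Zle: "Zm m x \<le> Z" for m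
      unfolding Zm_def partition_const_def \<rho>_def
      using ht(1)[of m] by (intro integral_mono integrable_Cc_\<rho> intU) (auto simp: ht)
    have Zlim: "(\<lambda>m. Zm m x) \<longlonglongrightarrow> Z"
      unfolding Zm_def partition_const_def \<rho>_def
    proof (rule integral_dominated_convergence[where w="\<lambda>t. exp (- line U b x t)"])
      show "AE t in lborel. (\<lambda>m. ht m t * exp (- line U b x t)) \<longlonglongrightarrow> exp (- line U b x t)"
        using tendsto_mult_right[OF htlim] by (intro AE_I2) (auto intro: tendsto_eq_intros htlim)
      show "AE t in lborel. norm (ht m t * exp (- line U b x t)) \<le> exp (- line U b x t)" for m
        by (auto simp: ht abs_mult)
      have [measurable]: "ht m \<in> borel_measurable borel" for m using ht(1) by (rule Cc_measurable)
      show "(\<lambda>t. ht m t * exp (- line U b x t)) \<in> borel_measurable lborel" for m by measurable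
    qed (use intU in auto)
    have Dlim: "(\<lambda>m. D f m x) \<longlonglongrightarrow> wvar f" for f
      unfolding D_def wvar_def \<rho>_def using Z_pos by (intro tendsto_intros Zlim) auto
    have Dle: "D f m x \<le> wvar f" for f m
      unfolding D_def wvar_def \<rho>_def using Zpos[of m x] Zle[of m] by (intro diff_left_mono divide_left_mono) auto
    show ?thesis unfolding spectral_gap_less_iff E
    proof safe
      fix f assume f: "test_function f" "E f x < a * wvar f"
      have "(\<lambda>m. a * D f m x) \<longlonglongrightarrow> a * wvar f" by (intro tendsto_intros Dlim)
      then have "eventually (\<lambda>m. E f x < a * D f m x) sequentially" using f(2) by (rule order_tendstoD)
      then show "\<exists>f m. test_function f \<and> E f x < a * D f m x"
        using f(1) by (meson eventually_happens trivial_limit_sequentially)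
    next
      fix f m assume f: "test_function f" "E f x < a * D f m x"
      have "a * D f m x \<le> a * wvar f" using that by (intro mult_left_mono Dle) auto
      then show "\<exists>f. test_function f \<and> E f x < a * wvar f" using f by (intro exI[of _ f]) auto
    qed
  qed
  show "{x \<in> space borel. ?G x < a} \<in> sets borel"
  proof (cases "a > 0")
    case False
    have "\<not> ?G x < a" for x
      using weight.spectral_gap_nonneg[OF W, of x] False by linarith
    then show ?thesis by simp
  next
    case True
    have "open {x. E f x < a * D f m x}" if f: "test_function f" for f m
    proof (intro open_Collect_less)
      have C: "Cc f" "Cc (pd 1 f)" using f by (auto intro!: test_function_Cc test_function_pd)
      have "Zm m x \<noteq> 0" for x using Zpos[of m x] by simp
      then show "continuous_on UNIV (E f)" "continuous_on UNIV (\<lambda>x. a * D f m x)"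
        unfolding E_def[abs_def] D_def Zm_def[abs_def]
        by (auto intro!: continuous_intros cont C Cc_power2 ht simp: Zm_def)
    qed
    then have "open (\<Union>f\<in>{f. test_function f}. \<Union>m. {x. E f x < a * D f m x})" by blast
    also have "(\<Union>f\<in>{f. test_function f}. \<Union>m. {x. E f x < a * D f m x}) = {x \<in> space borel. ?G x < a}"
      using main[OF True] by auto
    finally show ?thesis by simp
  qed
qed

context smooth_weight
begin

text \<open>The inequality on lines, integrated over all lines. Integrability of the left side is part of the
conclusion because the gap, as a function of the line, may be unbounded.\<close>
lemma line_gap_integral:
  assumes int: "\<And>x. integrable lborel (\<lambda>t. exp (- line U b x t))"
    and u: "test_function u" and b: "b \<in> Basis"
  shows "integrable lborel (\<lambda>x. spectral_gap (line U b x) * (pd b u x)\<^sup>2 * \<rho> x)"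
    and "(LBINT x. spectral_gap (line U b x) * (pd b u x)\<^sup>2 * \<rho> x) \<le> (LBINT x. (gen1 U b u x)\<^sup>2 * \<rho> x)"
proof -
  let ?G = "\<lambda>x. spectral_gap (line U b x)"
  have G0: "?G x \<ge> 0" for x
    by (rule weight.spectral_gap_nonneg) (intro weight.intro smooth_continuous smooth_line smoothU int)
  note [measurable] = line_gap_measurable[OF smoothU int]
  have C: "Cc (pd b u)" "Cc (gen1 U b u)"
    using b u by (auto intro!: test_function_Cc test_function_pd test_function_gen1 smoothU)
  have [measurable]: "pd b u \<in> borel_measurable borel" "gen1 U b u \<in> borel_measurable borel"
    using C by (auto intro: Cc_measurable)
  define P where "P x = (gen1 U b u x)\<^sup>2 * \<rho> x" for x
  define Q where "Q x = ?G x * (pd b u x)\<^sup>2 * \<rho> x" for x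
  have [measurable]: "P \<in> borel_measurable borel" "Q \<in> borel_measurable borel"
    unfolding P_def[abs_def] Q_def[abs_def] by measurable
  have P0: "P x \<ge> 0" and Q0: "Q x \<ge> 0" for x unfolding P_def Q_def using G0 by auto
  have intP: "integrable lborel P" unfolding P_def[abs_def] by (intro integrable_Cc_\<rho> Cc_power2 C)
  have "(\<integral>\<^sup>+x. ennreal (Q x) \<partial>lborel) \<le> (\<integral>\<^sup>+x. ennreal (P x) \<partial>lborel)"
  proof (rule nn_integral_mono_lines[OF _ _ b])
    fix x :: 'a
    define y where "y = x - (x \<bullet> b) *\<^sub>R b"
    have shift: "(\<integral>\<^sup>+t. ennreal (f (x + t *\<^sub>R b)) \<partial>lborel) = (\<integral>\<^sup>+t. ennreal (line f b x t) \<partial>lborel)"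
      if [measurable]: "f \<in> borel_measurable borel" for f
    proof -
      have "(\<integral>\<^sup>+t. ennreal (f (x + t *\<^sub>R b)) \<partial>lborel) = (\<integral>\<^sup>+t. (\<lambda>s. ennreal (line f b x s)) (x \<bullet> b + t) \<partial>lborel)"
        by (simp add: line_def algebra_simps)
      also have "\<dots> = (\<integral>\<^sup>+t. ennreal (line f b x t) \<partial>lborel)"
        by (rule nn_integral_shift) (unfold line_def, measurable)
      finally show ?thesis .
    qed
    have tl: "test_function (line (pd b u) b x)" "test_function (line (gen1 U b u) b x)"
      using b u by (auto intro!: test_function_line test_function_pd test_function_gen1 smoothU)
    have cl: "continuous_on UNIV (\<lambda>t. exp (- line U b x t))"
      by (intro continuous_intros smooth_continuous smooth_line smoothU)
    have i1: "integrable lborel (\<lambda>t. (line (pd b u) b x t)\<^sup>2 * exp (- line U b x t))"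
      and i2: "integrable lborel (\<lambda>t. (line (gen1 U b u) b x t)\<^sup>2 * exp (- line U b x t))"
        by (intro Cc_integrable Cc_mult2[OF cl] Cc_power2 test_function_Cc tl)+
    have Ql: "line Q b x = (\<lambda>t. ?G x * ((line (pd b u) b x t)\<^sup>2 * exp (- line U b x t)))"
    proof
      fix t
      have "line U b (x - (x \<bullet> b) *\<^sub>R b + t *\<^sub>R b) = line U b x"
        using line_shift[OF b, of U x "t - x \<bullet> b"] by (simp add: algebra_simps)
      then show "line Q b x t = ?G x * ((line (pd b u) b x t)\<^sup>2 * exp (- line U b x t))"
        by (simp add: line_def[of Q] Q_def) (simp add: line_def)
    qed
    have Pl: "line P b x = (\<lambda>t. (line (gen1 U b u) b x t)\<^sup>2 * exp (- line U b x t))"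
      by (auto simp: line_def P_def)
    have "(\<integral>\<^sup>+t. ennreal (Q (x + t *\<^sub>R b)) \<partial>lborel) = ennreal (LBINT t. line Q b x t)"
      unfolding shift[OF \<open>Q \<in> _\<close>] Ql
      by (intro nn_integral_eq_integral integrable_mult_right i1) (auto simp: G0)
    also have "\<dots> \<le> ennreal (LBINT t. line P b x t)"
      unfolding Ql Pl using line_gap_energy[OF smoothU int u b] by (intro ennreal_leI) simp
    also have "\<dots> = (\<integral>\<^sup>+t. ennreal (P (x + t *\<^sub>R b)) \<partial>lborel)"
      unfolding shift[OF \<open>P \<in> _\<close>] Pl
      by (intro nn_integral_eq_integral[symmetric] i2) auto
    finally show "(\<integral>\<^sup>+t. ennreal (Q (x + t *\<^sub>R b)) \<partial>lborel) \<le> (\<integral>\<^sup>+t. ennreal (P (x + t *\<^sub>R b)) \<partial>lborel)" .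
  qed auto
  also have "\<dots> = ennreal (LBINT x. P x)"
    using intP P0 by (intro nn_integral_eq_integral) auto
  finally have le: "(\<integral>\<^sup>+x. ennreal (Q x) \<partial>lborel) \<le> ennreal (LBINT x. P x)" .
  have intQ: "integrable lborel Q"
    by (rule integrableI_nonneg) (use Q0 le_less_trans[OF le] in auto)
  then show "integrable lborel (\<lambda>x. ?G x * (pd b u x)\<^sup>2 * \<rho> x)" unfolding Q_def[abs_def] .
  have "ennreal (LBINT x. Q x) \<le> ennreal (LBINT x. P x)"
    using le nn_integral_eq_integral[OF intQ] Q0 by simp
  then have "(LBINT x. Q x) \<le> (LBINT x. P x)"
    using P0 by (subst (asm) ennreal_le_iff) (auto intro: Bochner_Integration.integral_nonneg)
  then show "(LBINT x. ?G x * (pd b u x)\<^sup>2 * \<rho> x) \<le> (LBINT x. (gen1 U b u x)\<^sup>2 * \<rho> x)"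
    unfolding Q_def[abs_def] P_def[abs_def] .
qed

text \<open>The lower bound for the integral of \<open>(L u)\<^sup>2 \<rho>\<close>: squares of the \<open>L\<^sub>b u\<close> are treated by the gaps of
lines, products of different ones by Bochner's formula. The hypothesis \<open>form\<close> says that \<open>\<kappa>\<close>
bounds the quadratic form of the modified Hessian from below.\<close>
lemma energy_le_integral_gen_sq:
  assumes int: "\<And>x b. b \<in> Basis \<Longrightarrow> integrable lborel (\<lambda>t. exp (- line U b x t))"
    and u: "test_function u"
    and form: "\<And>x (v :: 'a \<Rightarrow> real). \<kappa> * (\<Sum>b\<in>Basis. (v b)\<^sup>2) \<le>
        (\<Sum>b\<in>Basis. spectral_gap (line U b x) * (v b)\<^sup>2) + (\<Sum>b\<in>Basis. \<Sum>c\<in>Basis - {b}. pd b (pd c U) x * v b * v c)"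
  shows "\<kappa> * energy u \<le> (LBINT x. (gen U u x)\<^sup>2 * \<rho> x)"
proof -
  let ?G = "\<lambda>b x. spectral_gap (line U b x)"
  have CL: "Cc (gen1 U b u)" if "b \<in> Basis" for b
    using that u by (auto intro!: test_function_Cc test_function_gen1 smoothU)
  have Cp: "Cc (pd b u)" if "b \<in> Basis" for b
    using that u by (auto intro!: test_function_Cc test_function_pd)
  have Cpp: "Cc (\<lambda>x. pd b (pd c U) x * pd b u x * pd c u x)" if "b \<in> Basis" "c \<in> Basis" for b c
    using that by (intro Cc_mult1 Cp continuous_on_mult smooth_continuous smooth_pd smoothU test_function_smooth u)
  have iLL: "integrable lborel (\<lambda>x. gen1 U b u x * gen1 U c u x * \<rho> x)" if "b \<in> Basis" "c \<in> Basis" for b c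
    using that by (intro integrable_Cc_\<rho> Cc_mult1 CL Cc_cont)
  have iX: "integrable lborel (\<lambda>x. pd b (pd c U) x * pd b u x * pd c u x * \<rho> x)" if "b \<in> Basis" "c \<in> Basis" for b c
    using that by (intro integrable_Cc_\<rho> Cpp)
  have iG: "integrable lborel (\<lambda>x. ?G b x * (pd b u x)\<^sup>2 * \<rho> x)" if "b \<in> Basis" for b
    using line_gap_integral(1)[OF int u] that by blast
  have off: "(LBINT x. pd b (pd c U) x * pd b u x * pd c u x * \<rho> x) \<le> (LBINT x. gen1 U b u x * gen1 U c u x * \<rho> x)"
    if "b \<in> Basis" "c \<in> Basis" for b c
  proof -
    have "Cc (pd c (pd b u))"
      using that u by (auto intro!: test_function_Cc test_function_pd)
    then have "integrable lborel (\<lambda>x. ((pd c (pd b u) x)\<^sup>2 + pd b (pd c U) x * pd b u x * pd c u x) * \<rho> x)"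
      using that by (intro integrable_Cc_\<rho> Cc_add Cc_power2 Cpp)
    then show ?thesis unfolding integral_gen1_mult_gen1[OF u that]
      by (intro integral_mono iX that) (auto intro!: mult_right_mono)
  qed
  have "\<kappa> * energy u = (LBINT x. \<kappa> * (\<Sum>b\<in>Basis. (pd b u x)\<^sup>2) * \<rho> x)"
    by (simp add: energy_def mult.assoc)
  also have "\<dots> \<le> (LBINT x. (\<Sum>b\<in>Basis. ?G b x * (pd b u x)\<^sup>2 * \<rho> x) + (\<Sum>b\<in>Basis. \<Sum>c\<in>Basis - {b}. pd b (pd c U) x * pd b u x * pd c u x * \<rho> x))"
  proof (rule integral_mono)
    show "integrable lborel (\<lambda>x. \<kappa> * (\<Sum>b\<in>Basis. (pd b u x)\<^sup>2) * \<rho> x)"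
      by (intro integrable_Cc_\<rho> Cc_cmult Cc_sum Cc_power2 Cp)
    show "integrable lborel (\<lambda>x. (\<Sum>b\<in>Basis. ?G b x * (pd b u x)\<^sup>2 * \<rho> x) + (\<Sum>b\<in>Basis. \<Sum>c\<in>Basis - {b}. pd b (pd c U) x * pd b u x * pd c u x * \<rho> x))"
      by (intro Bochner_Integration.integrable_add Bochner_Integration.integrable_sum iG iX) auto
    fix x :: 'a
    show "\<kappa> * (\<Sum>b\<in>Basis. (pd b u x)\<^sup>2) * \<rho> x \<le> (\<Sum>b\<in>Basis. ?G b x * (pd b u x)\<^sup>2 * \<rho> x) + (\<Sum>b\<in>Basis. \<Sum>c\<in>Basis - {b}. pd b (pd c U) x * pd b u x * pd c u x * \<rho> x)"
      using mult_right_mono[OF form[of "\<lambda>b. pd b u x" x], of "\<rho> x"]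
      by (simp add: sum_distrib_right distrib_right)
  qed
  also have "\<dots> = (\<Sum>b\<in>Basis. (LBINT x. ?G b x * (pd b u x)\<^sup>2 * \<rho> x)) + (\<Sum>b\<in>Basis. \<Sum>c\<in>Basis - {b}. (LBINT x. pd b (pd c U) x * pd b u x * pd c u x * \<rho> x))"
  proof -
    have iS: "integrable lborel (\<lambda>x. \<Sum>c\<in>Basis - {b}. pd b (pd c U) x * pd b u x * pd c u x * \<rho> x)" if "b \<in> Basis" for b
      using that by (intro Bochner_Integration.integrable_sum iX) auto
    have "(LBINT x. (\<Sum>c\<in>Basis - {b}. pd b (pd c U) x * pd b u x * pd c u x * \<rho> x))
        = (\<Sum>c\<in>Basis - {b}. (LBINT x. pd b (pd c U) x * pd b u x * pd c u x * \<rho> x))" if "b \<in> Basis" for b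
      using that by (intro Bochner_Integration.integral_sum iX) auto
    then show ?thesis
      by (subst Bochner_Integration.integral_add)
         (auto intro!: Bochner_Integration.integrable_sum iG iS simp: Bochner_Integration.integral_sum iG iS)
  qed
  also have "\<dots> \<le> (\<Sum>b\<in>Basis. (LBINT x. gen1 U b u x * gen1 U b u x * \<rho> x)) + (\<Sum>b\<in>Basis. \<Sum>c\<in>Basis - {b}. (LBINT x. gen1 U b u x * gen1 U c u x * \<rho> x))"
    using line_gap_integral(2)[OF int u] by (intro add_mono sum_mono off) (auto simp: power2_eq_square)
  also have "\<dots> = (\<Sum>b\<in>Basis. \<Sum>c\<in>Basis. (LBINT x. gen1 U b u x * gen1 U c u x * \<rho> x))"
    unfolding sum.distrib[symmetric] by (intro sum.cong refl) (simp add: sum.remove)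
  also have "\<dots> = (LBINT x. (\<Sum>b\<in>Basis. \<Sum>c\<in>Basis. gen1 U b u x * gen1 U c u x * \<rho> x))"
    by (simp add: Bochner_Integration.integral_sum iLL)
  also have "\<dots> = (LBINT x. (gen U u x)\<^sup>2 * \<rho> x)"
    unfolding gen_def power2_eq_square sum_product by (simp add: sum_distrib_right)
  finally show ?thesis .
qed

end

section \<open>Square integrable functions\<close>

lemma integrable_product_L2:
  fixes f g :: "'a \<Rightarrow> real"
  assumes [measurable]: "f \<in> borel_measurable M" "g \<in> borel_measurable M"
    and "integrable M (\<lambda>x. (f x)\<^sup>2)" "integrable M (\<lambda>x. (g x)\<^sup>2)"
  shows "integrable M (\<lambda>x. f x * g x)"
proof (rule Bochner_Integration.integrable_bound)
  show "integrable M (\<lambda>x. (f x)\<^sup>2 + (g x)\<^sup>2)" using assms by simp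
  have "\<bar>a * b\<bar> \<le> a\<^sup>2 + b\<^sup>2" for a b :: real
  proof -
    have "0 \<le> (\<bar>a\<bar> - \<bar>b\<bar>)\<^sup>2" by simp
    then have "2 * (\<bar>a\<bar> * \<bar>b\<bar>) \<le> a\<^sup>2 + b\<^sup>2" by (simp add: power2_diff)
    then show ?thesis using abs_ge_zero[of "a * b"] unfolding abs_mult by linarith
  qed
  then show "AE x in M. norm (f x * g x) \<le> norm ((f x)\<^sup>2 + (g x)\<^sup>2)" by simp
qed simp

lemma nonneg_quadratic:
  fixes A X B :: real
  assumes "\<And>t. 0 \<le> t\<^sup>2 * A + 2 * t * X + B" "A \<ge> 0"
  shows "X\<^sup>2 \<le> A * B"
proof (cases "A = 0")
  case True
  have "X = 0"
  proof (rule ccontr)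
    assume "X \<noteq> 0"
    \<comment> \<open>for \<open>A = 0\<close> the hypothesis is affine in \<open>t\<close>, and this \<open>t\<close> makes it equal to \<open>-1\<close>\<close>
    then have "2 * (- (B + 1) / (2 * X)) * X = - (B + 1)" by (simp add: field_simps)
    then show False using assms(1)[of "- (B + 1) / (2 * X)"] True by simp
  qed
  then show ?thesis using True by simp
next
  case False
  have "0 \<le> (- X / A)\<^sup>2 * A + 2 * (- X / A) * X + B" by (rule assms(1))
  also have "\<dots> = B - X\<^sup>2 / A" using False by (simp add: power2_eq_square field_simps)
  finally show ?thesis using False assms(2) by (simp add: field_simps)
qed

lemma Cauchy_Schwarz_integral:
  fixes f g :: "'a \<Rightarrow> real"
  assumes [measurable]: "f \<in> borel_measurable M" "g \<in> borel_measurable M"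
    and f2: "integrable M (\<lambda>x. (f x)\<^sup>2)" and g2: "integrable M (\<lambda>x. (g x)\<^sup>2)"
  shows "(\<integral>x. f x * g x \<partial>M)\<^sup>2 \<le> (\<integral>x. (f x)\<^sup>2 \<partial>M) * (\<integral>x. (g x)\<^sup>2 \<partial>M)"
proof (rule nonneg_quadratic)
  fix t :: real
  have "0 \<le> (\<integral>x. (t * f x + g x)\<^sup>2 \<partial>M)" by simp
  also have "\<dots> = (\<integral>x. t\<^sup>2 * (f x)\<^sup>2 + 2 * t * (f x * g x) + (g x)\<^sup>2 \<partial>M)"
    by (simp add: power2_eq_square algebra_simps)
  also have "\<dots> = t\<^sup>2 * (\<integral>x. (f x)\<^sup>2 \<partial>M) + 2 * t * (\<integral>x. f x * g x \<partial>M) + (\<integral>x. (g x)\<^sup>2 \<partial>M)"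
    using f2 g2 integrable_product_L2[OF assms] by simp
  finally show "0 \<le> t\<^sup>2 * (\<integral>x. (f x)\<^sup>2 \<partial>M) + 2 * t * (\<integral>x. f x * g x \<partial>M) + (\<integral>x. (g x)\<^sup>2 \<partial>M)" .
qed simp

lemma integrable_diff_sq:
  fixes f g :: "'a \<Rightarrow> real"
  assumes [measurable]: "f \<in> borel_measurable M" "g \<in> borel_measurable M"
    and "integrable M (\<lambda>x. (f x)\<^sup>2)" "integrable M (\<lambda>x. (g x)\<^sup>2)"
  shows "integrable M (\<lambda>x. (f x - g x)\<^sup>2)" "integrable M (\<lambda>x. (f x + g x)\<^sup>2)"
proof -
  have "integrable M (\<lambda>x. (f x)\<^sup>2 - 2 * (f x * g x) + (g x)\<^sup>2)" "integrable M (\<lambda>x. (f x)\<^sup>2 + 2 * (f x * g x) + (g x)\<^sup>2)"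
    using integrable_product_L2[OF assms] assms(3,4) by auto
  then show "integrable M (\<lambda>x. (f x - g x)\<^sup>2)" "integrable M (\<lambda>x. (f x + g x)\<^sup>2)"
    by (simp_all add: power2_eq_square algebra_simps)
qed

lemma L2_limit_integral:
  fixes g :: "nat \<Rightarrow> 'a \<Rightarrow> real"
  assumes [measurable]: "h \<in> borel_measurable M" "\<And>k. g k \<in> borel_measurable M" "\<phi> \<in> borel_measurable M"
    and h2: "integrable M (\<lambda>x. (h x)\<^sup>2)" and g2: "\<And>k. integrable M (\<lambda>x. (g k x)\<^sup>2)" and \<phi>2: "integrable M (\<lambda>x. (\<phi> x)\<^sup>2)"
    and lim: "(\<lambda>k. \<integral>x. (h x - g k x)\<^sup>2 \<partial>M) \<longlonglongrightarrow> 0"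
  shows "(\<lambda>k. \<integral>x. g k x * \<phi> x \<partial>M) \<longlonglongrightarrow> (\<integral>x. h x * \<phi> x \<partial>M)"
proof (rule LIM_zero_cancel, rule Lim_null_comparison)
  have d2: "integrable M (\<lambda>x. (h x - g k x)\<^sup>2)" for k by (intro integrable_diff_sq h2 g2) measurable
  show "eventually (\<lambda>k. norm ((\<integral>x. g k x * \<phi> x \<partial>M) - (\<integral>x. h x * \<phi> x \<partial>M)) \<le> sqrt ((\<integral>x. (h x - g k x)\<^sup>2 \<partial>M) * (\<integral>x. (\<phi> x)\<^sup>2 \<partial>M))) sequentially"
  proof (rule always_eventually, rule allI)
    fix k
    have "integrable M (\<lambda>x. g k x * \<phi> x)" "integrable M (\<lambda>x. h x * \<phi> x)"
      by (intro integrable_product_L2 h2 g2 \<phi>2; measurable)+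
    then have "(\<integral>x. (h x - g k x) * \<phi> x \<partial>M) = (\<integral>x. h x * \<phi> x \<partial>M) - (\<integral>x. g k x * \<phi> x \<partial>M)"
      by (simp add: left_diff_distrib)
    moreover have "(\<integral>x. (h x - g k x) * \<phi> x \<partial>M)\<^sup>2 \<le> (\<integral>x. (h x - g k x)\<^sup>2 \<partial>M) * (\<integral>x. (\<phi> x)\<^sup>2 \<partial>M)"
      by (intro Cauchy_Schwarz_integral d2 \<phi>2) measurable
    ultimately show "norm ((\<integral>x. g k x * \<phi> x \<partial>M) - (\<integral>x. h x * \<phi> x \<partial>M)) \<le> sqrt ((\<integral>x. (h x - g k x)\<^sup>2 \<partial>M) * (\<integral>x. (\<phi> x)\<^sup>2 \<partial>M))"
      by (intro real_le_rsqrt) (simp add: power2_commute)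
  qed
  show "(\<lambda>k. sqrt ((\<integral>x. (h x - g k x)\<^sup>2 \<partial>M) * (\<integral>x. (\<phi> x)\<^sup>2 \<partial>M))) \<longlonglongrightarrow> 0"
    using tendsto_real_sqrt[OF tendsto_mult_left_zero[OF lim]] by simp
qed

text \<open>The Riesz-Fischer theorem for sequences with geometric control. The increments are summable in
\<open>L\<^sup>1\<close>, hence pointwise almost everywhere, and Fatou's lemma transfers the bound to the limit.\<close>
lemma (in finite_measure) L2_complete_geometric:
  fixes g :: "nat \<Rightarrow> 'a \<Rightarrow> real"
  assumes [measurable]: "\<And>k. g k \<in> borel_measurable M"
    and g2: "\<And>k. integrable M (\<lambda>x. (g k x)\<^sup>2)"
    and cauchy: "\<And>k l. k \<le> l \<Longrightarrow> (\<integral>x. (g l x - g k x)\<^sup>2 \<partial>M) \<le> C / 4 ^ k"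
  obtains h where "h \<in> borel_measurable M" "integrable M (\<lambda>x. (h x)\<^sup>2)"
    "(\<lambda>k. \<integral>x. (h x - g k x)\<^sup>2 \<partial>M) \<longlonglongrightarrow> 0"
proof -
  have C: "C \<ge> 0"
  proof -
    have "0 \<le> (\<integral>x. (g 0 x - g 0 x)\<^sup>2 \<partial>M)" by simp
    also have "\<dots> \<le> C / 4 ^ 0" by (rule cauchy) simp
    finally show ?thesis by simp
  qed
  have d2: "integrable M (\<lambda>x. (g l x - g k x)\<^sup>2)" for k l by (intro integrable_diff_sq g2) measurable
  define a where "a k x = \<bar>g (Suc k) x - g k x\<bar>" for k x
  have [measurable]: "a k \<in> borel_measurable M" for k unfolding a_def[abs_def] by measurable
  define c where "c = C + measure M (space M)"
  \<comment> \<open>\<open>a \<le> s a\<^sup>2 + 1 / s\<close> with \<open>s = 2 ^ k\<close> balances the bound \<open>C / 4 ^ k\<close> against the total mass\<close>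
  have ac: "(\<integral>\<^sup>+x. ennreal (a k x) \<partial>M) \<le> ennreal (c * (1 / 2) ^ k)" for k
  proof -
    have ai: "integrable M (\<lambda>x. 2 ^ k * (g (Suc k) x - g k x)\<^sup>2 + (1 / 2) ^ k)"
      using d2 by simp
    have "a k x \<le> 2 ^ k * (g (Suc k) x - g k x)\<^sup>2 + (1 / 2) ^ k" for x
    proof -
      define s where "s = (2::real) ^ k"
      have s: "s > 0" "(1 / 2) ^ k = 1 / s" by (auto simp: s_def power_one_over)
      have "0 \<le> (s * a k x - 1)\<^sup>2" by simp
      then have "2 * (s * a k x) \<le> s\<^sup>2 * (a k x)\<^sup>2 + 1" by (simp add: power2_diff power_mult_distrib)
      moreover have "0 \<le> s * a k x" using s by (simp add: a_def)
      ultimately have "s * a k x \<le> s * (s * (a k x)\<^sup>2 + 1 / s)" using s by (simp add: algebra_simps power2_eq_square)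
      then have "a k x \<le> s * (a k x)\<^sup>2 + 1 / s" using s by (simp only: mult_le_cancel_left_pos)
      then show ?thesis by (simp add: a_def s(2)) (simp add: s_def)
    qed
    then have "(\<integral>\<^sup>+x. ennreal (a k x) \<partial>M) \<le> (\<integral>\<^sup>+x. ennreal (2 ^ k * (g (Suc k) x - g k x)\<^sup>2 + (1 / 2) ^ k) \<partial>M)"
      by (intro nn_integral_mono ennreal_leI)
    also have "\<dots> = ennreal (\<integral>x. 2 ^ k * (g (Suc k) x - g k x)\<^sup>2 + (1 / 2) ^ k \<partial>M)"
      using ai by (intro nn_integral_eq_integral) auto
    also have "(\<integral>x. 2 ^ k * (g (Suc k) x - g k x)\<^sup>2 + (1 / 2) ^ k \<partial>M) = 2 ^ k * (\<integral>x. (g (Suc k) x - g k x)\<^sup>2 \<partial>M) + (1 / 2) ^ k * measure M (space M)"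
      using d2 by simp
    also have "ennreal \<dots> \<le> ennreal (c * (1 / 2) ^ k)"
    proof (rule ennreal_leI)
      have "2 ^ k * (\<integral>x. (g (Suc k) x - g k x)\<^sup>2 \<partial>M) \<le> 2 ^ k * (C / 4 ^ k)"
        by (intro mult_left_mono cauchy) auto
      also have "\<dots> = C * (1 / 2) ^ k"
      proof -
        have "(4::real) ^ k = 2 ^ k * 2 ^ k" by (simp flip: power_mult_distrib)
        then show ?thesis by (simp add: power_one_over)
      qed
      finally show "2 ^ k * (\<integral>x. (g (Suc k) x - g k x)\<^sup>2 \<partial>M) + (1 / 2) ^ k * measure M (space M) \<le> c * (1 / 2) ^ k"
        by (simp add: c_def algebra_simps)
    qed
    finally show ?thesis .
  qed
  have c0: "c \<ge> 0" using C by (simp add: c_def)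
  have "(\<integral>\<^sup>+x. (\<Sum>k. ennreal (a k x)) \<partial>M) = (\<Sum>k. \<integral>\<^sup>+x. ennreal (a k x) \<partial>M)"
    by (rule nn_integral_suminf) measurable
  also have "\<dots> \<le> (\<Sum>k. ennreal (c * (1 / 2) ^ k))" by (intro suminf_le ac) auto
  also have "\<dots> = ennreal (\<Sum>k. c * (1 / 2) ^ k)"
    using c0 by (intro suminf_ennreal2) (auto intro!: summable_mult summable_geometric)
  also have "\<dots> < \<infinity>" by simp
  finally have "AE x in M. (\<Sum>k. ennreal (a k x)) \<noteq> \<infinity>"
    by (intro nn_integral_PInf_AE) auto
  then have conv: "AE x in M. convergent (\<lambda>k. g k x)"
  proof (rule AE_mp, intro AE_I2 impI)
    fix x assume "(\<Sum>k. ennreal (a k x)) \<noteq> \<infinity>"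
    then have "summable (\<lambda>k. a k x)" by (intro summable_suminf_not_top) (auto simp: a_def)
    then have "summable (\<lambda>k. norm (g (Suc k) x - g k x))" by (simp add: a_def)
    then have "summable (\<lambda>k. g (Suc k) x - g k x)" by (rule summable_norm_cancel)
    then have "convergent (\<lambda>n. \<Sum>k<n. g (Suc k) x - g k x)" by (simp add: summable_iff_convergent)
    then have "convergent (\<lambda>n. g n x - g 0 x)" unfolding sum_lessThan_telescope[of "\<lambda>k. g k x"] .
    then have "convergent (\<lambda>n. (g n x - g 0 x) + g 0 x)" by (intro convergent_add convergent_const)
    then show "convergent (\<lambda>k. g k x)" by simp
  qed
  define h where "h x = lim (\<lambda>k. g k x)" for x
  have [measurable]: "h \<in> borel_measurable M" unfolding h_def[abs_def] by measurable
  have lim: "AE x in M. (\<lambda>k. g k x) \<longlonglongrightarrow> h x"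
    using conv by (auto simp: h_def convergent_LIMSEQ_iff)
  have bound: "(\<integral>\<^sup>+x. ennreal ((h x - g k x)\<^sup>2) \<partial>M) \<le> ennreal (C / 4 ^ k)" for k
  proof -
    have "(\<integral>\<^sup>+x. ennreal ((h x - g k x)\<^sup>2) \<partial>M) = (\<integral>\<^sup>+x. liminf (\<lambda>l. ennreal ((g l x - g k x)\<^sup>2)) \<partial>M)"
    proof (rule nn_integral_cong_AE, use lim in \<open>eventually_elim\<close>)
      fix x assume "(\<lambda>k. g k x) \<longlonglongrightarrow> h x"
      then have "(\<lambda>l. ennreal ((g l x - g k x)\<^sup>2)) \<longlonglongrightarrow> ennreal ((h x - g k x)\<^sup>2)"
        by (intro tendsto_intros) auto
      then show "ennreal ((h x - g k x)\<^sup>2) = liminf (\<lambda>l. ennreal ((g l x - g k x)\<^sup>2))"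
        by (intro lim_imp_Liminf[symmetric]) auto
    qed
    also have "\<dots> \<le> liminf (\<lambda>l. \<integral>\<^sup>+x. ennreal ((g l x - g k x)\<^sup>2) \<partial>M)"
      by (rule nn_integral_liminf) measurable
    also have "\<dots> \<le> liminf (\<lambda>l. ennreal (C / 4 ^ k))"
    proof (rule Liminf_mono)
      show "eventually (\<lambda>l. (\<integral>\<^sup>+x. ennreal ((g l x - g k x)\<^sup>2) \<partial>M) \<le> ennreal (C / 4 ^ k)) sequentially"
        using d2 cauchy by (intro eventually_sequentiallyI[of k]) (subst nn_integral_eq_integral; auto intro!: ennreal_leI)
    qed
    finally show ?thesis by (simp add: Liminf_const)
  qed
  have hg: "integrable M (\<lambda>x. (h x - g k x)\<^sup>2)" for k
    by (rule integrableI_nonneg) (use le_less_trans[OF bound] in auto)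
  have "integrable M (\<lambda>x. ((h x - g 0 x) + g 0 x)\<^sup>2)"
    by (intro integrable_diff_sq hg g2) measurable
  then have h2: "integrable M (\<lambda>x. (h x)\<^sup>2)" by simp
  have le: "(\<integral>x. (h x - g k x)\<^sup>2 \<partial>M) \<le> C / 4 ^ k" for k
  proof -
    have "ennreal (\<integral>x. (h x - g k x)\<^sup>2 \<partial>M) \<le> ennreal (C / 4 ^ k)"
      using bound[of k] nn_integral_eq_integral[OF hg] by simp
    then show ?thesis using C by (simp add: ennreal_le_iff)
  qed
  have "(\<lambda>k. C * (1 / 4) ^ k) \<longlonglongrightarrow> C * 0" by (intro tendsto_intros LIMSEQ_power_zero) auto
  then have Clim: "(\<lambda>k. C / 4 ^ k) \<longlonglongrightarrow> 0" by (simp add: power_one_over)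
  have "(\<lambda>k. \<integral>x. (h x - g k x)\<^sup>2 \<partial>M) \<longlonglongrightarrow> 0"
    by (rule tendsto_sandwich[OF _ _ tendsto_const Clim]) (auto simp: le)
  then show ?thesis using that h2 \<open>h \<in> _\<close> by blast
qed

context smooth_weight
begin

definition \<mu> :: "'a measure" where "\<mu> = density lborel (\<lambda>x. ennreal (\<rho> x))"

lemma sets_\<mu> [measurable_cong]: "sets \<mu> = sets borel" by (simp add: \<mu>_def)

lemma measurable_\<mu>: "f \<in> borel_measurable \<mu> \<longleftrightarrow> f \<in> borel_measurable borel"
  by (simp add: measurable_cong_sets[OF sets_\<mu> refl])

lemma integral_\<mu>: "f \<in> borel_measurable borel \<Longrightarrow> (\<integral>x. f x \<partial>\<mu>) = (LBINT x. f x * \<rho> x)" for f :: "'a \<Rightarrow> real"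
  unfolding \<mu>_def by (subst integral_density) (auto simp: mult.commute)

lemma integrable_\<mu>: "f \<in> borel_measurable borel \<Longrightarrow> integrable \<mu> f \<longleftrightarrow> integrable lborel (\<lambda>x. f x * \<rho> x)" for f :: "'a \<Rightarrow> real"
  unfolding \<mu>_def by (subst integrable_density) (auto simp: mult.commute)

lemma finite_measure_\<mu>: "finite_measure \<mu>"
proof
  have "emeasure \<mu> (space \<mu>) = (\<integral>\<^sup>+x. ennreal (\<rho> x) \<partial>lborel)"
    unfolding \<mu>_def by (subst emeasure_density) (auto intro!: nn_integral_cong)
  also have "\<dots> = ennreal (LBINT x. \<rho> x)" using intU by (intro nn_integral_eq_integral) auto
  finally show "emeasure \<mu> (space \<mu>) \<noteq> \<infinity>" by simp
qed

lemma Cc_\<mu>: assumes "Cc f" shows "integrable \<mu> f" "f \<in> borel_measurable \<mu>" "integrable \<mu> (\<lambda>x. (f x)\<^sup>2)"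
proof -
  have [measurable]: "f \<in> borel_measurable borel" using assms by (rule Cc_measurable)
  show "integrable \<mu> f" "f \<in> borel_measurable \<mu>" "integrable \<mu> (\<lambda>x. (f x)\<^sup>2)"
    using assms by (auto simp: integrable_\<mu> measurable_\<mu> intro!: integrable_Cc_\<rho> Cc_power2)
qed

text \<open>The residual \<open>h\<close> of the orthogonal projection of \<open>f\<close> to the closure of the range of the generator.
Near-minimisers of the distance form a Cauchy sequence by the parallelogram law, and
first variation shows that the limit is orthogonal to the range.\<close>
lemma generator_residual:
  assumes f: "test_function f"
  obtains h u where "h \<in> borel_measurable borel" "integrable \<mu> (\<lambda>x. (h x)\<^sup>2)"
    "\<And>k::nat. test_function (u k)"
    "(\<lambda>k. \<integral>x. (h x - (f x + gen U (u k) x))\<^sup>2 \<partial>\<mu>) \<longlonglongrightarrow> 0"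
    "\<And>w. test_function w \<Longrightarrow> (\<integral>x. h x * gen U w x \<partial>\<mu>) = 0"
proof -
  interpret \<mu>: finite_measure \<mu> by (rule finite_measure_\<mu>)
  define N where "N u = (\<integral>x. (f x + gen U u x)\<^sup>2 \<partial>\<mu>)" for u
  define d where "d = (INF u\<in>Collect test_function. N u)"
  have N0: "N u \<ge> 0" for u by (simp add: N_def)
  have bdd: "bdd_below (N ` Collect test_function)" by (rule bdd_belowI2[of _ 0]) (rule N0)
  have tz: "test_function (\<lambda>x::'a. 0)" by (intro test_functionI smooth_const Cc_zero)
  have d_le: "d \<le> N u" if "test_function u" for u
    unfolding d_def using that by (intro cINF_lower bdd) auto
  have "\<exists>u. test_function u \<and> N u \<le> d + 1 / 4 ^ k" for k :: nat
  proof -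
    have "d < d + 1 / 4 ^ k" by simp
    then obtain u where "u \<in> Collect test_function" "N u < d + 1 / 4 ^ k"
      using cINF_less_iff[OF _ bdd] tz unfolding d_def by blast
    then show ?thesis by (auto intro: less_imp_le)
  qed
  then obtain u where u: "\<And>k. test_function (u k)" "\<And>k::nat. N (u k) \<le> d + 1 / 4 ^ k" by metis
  define g where "g k x = f x + gen U (u k) x" for k x
  have tg: "test_function (\<lambda>x. f x + gen U v x)" if "test_function v" for v
    using that by (intro test_function_add f test_function_gen smoothU)
  have Cg: "Cc (g k)" for k unfolding g_def[abs_def] by (intro test_function_Cc tg u)
  have [measurable]: "g k \<in> borel_measurable \<mu>" for k by (rule Cc_\<mu>[OF Cg])
  have g2: "integrable \<mu> (\<lambda>x. (g k x)\<^sup>2)" for k by (rule Cc_\<mu>[OF Cg])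
  have gen_lin: "gen U (\<lambda>x. s * v x + t * w x) x = s * gen U v x + t * gen U w x" if "test_function v" "test_function w" for v w s t x
  proof -
    have sv: "smooth v" "smooth w" using that by (auto intro: test_function_smooth)
    have pl: "pd b (\<lambda>x. s * v x + t * w x) = (\<lambda>x. s * pd b v x + t * pd b w x)" if "smooth v" "smooth w" for b v w
      using that by (intro pd_eqI dd_add dd_cmult smooth_dd smooth_differentiable smooth_add smooth_cmult)
    show ?thesis unfolding gen_def gen1_def
      by (simp add: pl sv smooth_pd sum_distrib_left flip: sum.distrib) (simp add: algebra_simps)
  qed
  have cauchy: "(\<integral>x. (g l x - g k x)\<^sup>2 \<partial>\<mu>) \<le> 4 / 4 ^ k" if "k \<le> l" for k l
  proof -
    \<comment> \<open>the midpoint competes in the minimisation, which is the parallelogram argument\<close>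
    define v where "v x = (1 / 2) * u k x + (1 / 2) * u l x" for x
    have tv: "test_function v" unfolding v_def[abs_def] by (intro test_function_add test_function_cmult u)
    have mid: "f x + gen U v x = (g k x + g l x) / 2" for x
      using gen_lin[OF u(1) u(1), of "1/2" k "1/2" l x] by (simp add: v_def[abs_def] g_def field_simps)
    have s2: "integrable \<mu> (\<lambda>x. (g k x + g l x)\<^sup>2)" and d2: "integrable \<mu> (\<lambda>x. (g l x - g k x)\<^sup>2)"
      by (intro integrable_diff_sq g2; measurable)+
    have "(\<integral>x. (g l x - g k x)\<^sup>2 \<partial>\<mu>) + (\<integral>x. (g k x + g l x)\<^sup>2 \<partial>\<mu>) = (\<integral>x. (g l x - g k x)\<^sup>2 + (g k x + g l x)\<^sup>2 \<partial>\<mu>)"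
      using s2 d2 by simp
    also have "\<dots> = (\<integral>x. 2 * (g k x)\<^sup>2 + 2 * (g l x)\<^sup>2 \<partial>\<mu>)"
      by (simp add: power2_eq_square algebra_simps)
    also have "\<dots> = 2 * N (u k) + 2 * N (u l)" using g2 by (simp add: N_def g_def)
    also have "\<dots> \<le> 2 * (d + 1 / 4 ^ k) + 2 * (d + 1 / 4 ^ k)"
    proof -
      have "(1::real) / 4 ^ l \<le> 1 / 4 ^ k" using that by (intro divide_left_mono power_increasing) auto
      moreover have "2 * a + 2 * b \<le> 2 * (d + e) + 2 * (d + e)" if "e' \<le> e" "a \<le> d + e" "b \<le> d + e'" for a b e e' :: real
        using that by (smt (verit))
      ultimately show ?thesis using u(2)[of k] u(2)[of l] by blast
    qed
    finally have "(\<integral>x. (g l x - g k x)\<^sup>2 \<partial>\<mu>) + (\<integral>x. (g k x + g l x)\<^sup>2 \<partial>\<mu>) \<le> 4 * d + 4 / 4 ^ k" by simp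
    moreover have "N v = (\<integral>x. (g k x + g l x)\<^sup>2 \<partial>\<mu>) / 4"
      unfolding N_def mid by (simp add: power_divide)
    moreover have "d \<le> N v" by (rule d_le[OF tv])
    ultimately show ?thesis by linarith
  qed
  obtain h where h: "h \<in> borel_measurable \<mu>" "integrable \<mu> (\<lambda>x. (h x)\<^sup>2)"
    and lim: "(\<lambda>k. \<integral>x. (h x - g k x)\<^sup>2 \<partial>\<mu>) \<longlonglongrightarrow> 0"
    using \<mu>.L2_complete_geometric[of g 4] g2 cauchy by auto
  have "(\<integral>x. h x * gen U w x \<partial>\<mu>) = 0" if w: "test_function w" for w
  proof -
    have CL: "Cc (gen U w)" by (intro test_function_Cc test_function_gen smoothU w)
    define X where "X = (\<integral>x. h x * gen U w x \<partial>\<mu>)"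
    define B where "B = (\<integral>x. (gen U w x)\<^sup>2 \<partial>\<mu>)"
    have limX: "(\<lambda>k. \<integral>x. g k x * gen U w x \<partial>\<mu>) \<longlonglongrightarrow> X"
      unfolding X_def by (rule L2_limit_integral[OF h(1) _ Cc_\<mu>(2)[OF CL] h(2) g2 Cc_\<mu>(3)[OF CL] lim]) measurable
    have "0 \<le> t\<^sup>2 * B + 2 * t * X + 0" for t
    proof -
      have "- (1 / 4 ^ k) \<le> 2 * t * (\<integral>x. g k x * gen U w x \<partial>\<mu>) + t\<^sup>2 * B" for k
      proof -
        define v where "v x = 1 * u k x + t * w x" for x
        have tv: "test_function v" unfolding v_def[abs_def] by (intro test_function_add test_function_cmult u w)
        have eq: "f x + gen U v x = g k x + t * gen U w x" for x
          using gen_lin[OF u(1) w, of 1 k t x] by (simp add: v_def[abs_def] g_def)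
        have "d \<le> N v" by (rule d_le[OF tv])
        also have "N v = (\<integral>x. (g k x)\<^sup>2 + 2 * t * (g k x * gen U w x) + t\<^sup>2 * (gen U w x)\<^sup>2 \<partial>\<mu>)"
          unfolding N_def eq by (simp add: power2_eq_square algebra_simps)
        also have "\<dots> = (\<integral>x. (g k x)\<^sup>2 \<partial>\<mu>) + 2 * t * (\<integral>x. g k x * gen U w x \<partial>\<mu>) + t\<^sup>2 * B"
          unfolding B_def using g2 Cc_\<mu>(3)[OF CL] integrable_product_L2[OF _ Cc_\<mu>(2)[OF CL] g2 Cc_\<mu>(3)[OF CL]] by simp
        also have "(\<integral>x. (g k x)\<^sup>2 \<partial>\<mu>) \<le> d + 1 / 4 ^ k" using u(2)[of k] by (simp add: N_def g_def)
        finally show ?thesis by simp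
      qed
      moreover have "(\<lambda>k. - ((1 / 4) ^ k)) \<longlonglongrightarrow> - (0::real)" by (intro tendsto_intros LIMSEQ_power_zero) auto
      then have "(\<lambda>k. - (1 / 4 ^ k)) \<longlonglongrightarrow> (0::real)" by (simp add: power_one_over)
      moreover have "(\<lambda>k. 2 * t * (\<integral>x. g k x * gen U w x \<partial>\<mu>) + t\<^sup>2 * B) \<longlonglongrightarrow> 2 * t * X + t\<^sup>2 * B"
        by (intro tendsto_intros limX)
      ultimately have "0 \<le> 2 * t * X + t\<^sup>2 * B"
        by (intro LIMSEQ_le[of "\<lambda>k. - (1 / 4 ^ k)"]) auto
      then show ?thesis by simp
    qed
    then have "X\<^sup>2 \<le> B * 0" by (rule nonneg_quadratic) (simp add: B_def)
    then show ?thesis by (simp add: X_def)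
  qed
  then show ?thesis using that[of h u] h lim u(1) by (simp add: g_def measurable_\<mu>)
qed

end

section \<open>Convolution and mollification\<close>

definition cut :: "real \<Rightarrow> 'a::euclidean_space \<Rightarrow> real" where
  "cut R x = max 0 (min 1 (R + 1 - norm x))"

lemma Cc_cut: "Cc (cut R)"
  by (rule CcI[where R="R + 1"]) (auto simp: cut_def[abs_def] intro!: continuous_intros)

lemma cut_bounds: "0 \<le> cut R x" "cut R x \<le> 1" by (auto simp: cut_def)

lemma cut_eq_1: "norm x \<le> R \<Longrightarrow> cut R x = 1" by (simp add: cut_def)

text \<open>Local integrability, tested with cutoffs.\<close>
definition loc_int :: "('a::euclidean_space \<Rightarrow> real) \<Rightarrow> bool" where
  "loc_int g \<longleftrightarrow> g \<in> borel_measurable borel \<and> (\<forall>R. integrable lborel (\<lambda>x. cut R x * g x))"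

lemma loc_int_measurable: "loc_int g \<Longrightarrow> g \<in> borel_measurable borel" by (simp add: loc_int_def)

lemma loc_int_mult_Cc:
  assumes g: "loc_int g" and \<phi>: "Cc \<phi>"
  shows "integrable lborel (\<lambda>x. g x * \<phi> x)"
proof -
  obtain R where R: "\<And>x. norm x > R \<Longrightarrow> \<phi> x = 0" using Cc_supportE[OF \<phi>] by blast
  obtain B where B: "\<And>x. \<bar>\<phi> x\<bar> \<le> B" using Cc_boundE[OF \<phi>] by blast
  have [measurable]: "g \<in> borel_measurable borel" "\<phi> \<in> borel_measurable borel"
    using g \<phi> by (auto intro: loc_int_measurable Cc_measurable)
  show ?thesis
  proof (rule Bochner_Integration.integrable_bound)
    show "integrable lborel (\<lambda>x. B * (cut R x * g x))" using g by (simp add: loc_int_def)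
    show "AE x in lborel. norm (g x * \<phi> x) \<le> norm (B * (cut R x * g x))"
    proof (rule AE_I2)
      fix x :: 'a
      show "norm (g x * \<phi> x) \<le> norm (B * (cut R x * g x))"
      proof (cases "norm x \<le> R")
        case True
        have "\<bar>g x\<bar> * \<bar>\<phi> x\<bar> \<le> \<bar>g x\<bar> * \<bar>B\<bar>" using B[of x] by (intro mult_left_mono) auto
        then show ?thesis by (simp add: cut_eq_1[OF True] abs_mult mult.commute)
      qed (use R in simp)
    qed
  qed simp
qed

lemma loc_int_mult_continuous:
  assumes g: "loc_int g" and s: "continuous_on UNIV s"
  shows "loc_int (\<lambda>x. g x * s x)"
proof -
  have "integrable lborel (\<lambda>x. g x * (s x * cut R x))" for R
    by (intro loc_int_mult_Cc g Cc_mult1[OF s] Cc_cut)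
  then show ?thesis unfolding loc_int_def using loc_int_measurable[OF g] borel_measurable_continuous_onI[OF s]
    by (auto simp: mult_ac)
qed

lemma integrable_imp_loc_int:
  assumes "integrable lborel g" shows "loc_int g"
proof -
  have [measurable]: "g \<in> borel_measurable borel" using assms by auto
  have [measurable]: "cut R \<in> borel_measurable borel" for R by (rule Cc_measurable[OF Cc_cut])
  have "integrable lborel (\<lambda>x. cut R x * g x)" for R
    by (rule Bochner_Integration.integrable_bound[OF assms])
       (auto simp: abs_mult cut_bounds intro!: mult_left_le_one_le)
  then show ?thesis by (simp add: loc_int_def)
qed

definition conv :: "('a::euclidean_space \<Rightarrow> real) \<Rightarrow> ('a \<Rightarrow> real) \<Rightarrow> 'a \<Rightarrow> real" where
  "conv g \<eta> x = (LBINT y. g y * \<eta> (x - y))"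

lemma conv_integrable: "loc_int g \<Longrightarrow> Cc \<eta> \<Longrightarrow> integrable lborel (\<lambda>y. g y * \<eta> (x - y))"
  by (intro loc_int_mult_Cc Cc_reflect)

lemma conv_sequential_limit:
  fixes g :: "'a::euclidean_space \<Rightarrow> real"
  assumes g: "loc_int g" and [measurable]: "\<And>n. q n \<in> borel_measurable borel" "p \<in> borel_measurable borel"
    and lim: "\<And>y. (\<lambda>n. q n y) \<longlonglongrightarrow> p y"
    and B: "\<And>n y. \<bar>q n y\<bar> \<le> B" and R: "\<And>n y. norm y > R \<Longrightarrow> q n y = 0"
  shows "(\<lambda>n. LBINT y. g y * q n y) \<longlonglongrightarrow> (LBINT y. g y * p y)"
proof (rule integral_dominated_convergence[where w="\<lambda>y. \<bar>B * (cut R y * g y)\<bar>"])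
  have [measurable]: "g \<in> borel_measurable borel" using g by (rule loc_int_measurable)
  show "(\<lambda>y. g y * p y) \<in> borel_measurable lborel" "\<And>n. (\<lambda>y. g y * q n y) \<in> borel_measurable lborel" by measurable
  show "integrable lborel (\<lambda>y. \<bar>B * (cut R y * g y)\<bar>)"
    using g by (intro integrable_abs integrable_mult_right) (simp add: loc_int_def)
  show "AE y in lborel. (\<lambda>n. g y * q n y) \<longlonglongrightarrow> g y * p y"
    by (intro AE_I2 tendsto_intros lim)
  show "AE y in lborel. norm (g y * q n y) \<le> \<bar>B * (cut R y * g y)\<bar>" for n
  proof (rule AE_I2)
    fix y :: 'a
    show "norm (g y * q n y) \<le> \<bar>B * (cut R y * g y)\<bar>"
    proof (cases "norm y \<le> R")
      case True
      have "\<bar>g y\<bar> * \<bar>q n y\<bar> \<le> \<bar>g y\<bar> * \<bar>B\<bar>" using B[of n y] by (intro mult_left_mono) auto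
      then show ?thesis by (simp add: cut_eq_1[OF True] abs_mult mult.commute)
    qed (use R in simp)
  qed
qed

lemma conv_continuous:
  fixes g :: "'a::euclidean_space \<Rightarrow> real"
  assumes g: "loc_int g" and \<eta>: "Cc \<eta>"
  shows "continuous_on UNIV (conv g \<eta>)"
proof -
  obtain R where R: "\<And>x. norm x > R \<Longrightarrow> \<eta> x = 0" using Cc_supportE[OF \<eta>] by blast
  obtain B where B: "\<And>x. \<bar>\<eta> x\<bar> \<le> B" using Cc_boundE[OF \<eta>] by blast
  have [measurable]: "\<eta> \<in> borel_measurable borel" using \<eta> by (rule Cc_measurable)
  have "(\<lambda>n. conv g \<eta> (s n)) \<longlonglongrightarrow> conv g \<eta> x" if s: "s \<longlonglongrightarrow> x" for s x
  proof -
    have "bounded (range s)" using s by (intro convergent_imp_bounded) (auto simp: convergent_def)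
    then obtain r where r: "\<And>n. norm (s n) \<le> r" unfolding bounded_iff by auto
    show ?thesis unfolding conv_def
    proof (rule conv_sequential_limit[OF g, where B=B and R="r + R"])
      fix y :: 'a
      show "(\<lambda>n. \<eta> (s n - y)) \<longlonglongrightarrow> \<eta> (x - y)"
        by (rule continuous_on_tendsto_compose[OF Cc_cont[OF \<eta>]]) (auto intro!: tendsto_intros s)
    next
      fix n and y :: 'a assume "r + R < norm y"
      then have "norm (s n - y) > R" using norm_triangle_ineq4[of "s n" "s n - y"] r[of n] by simp
      then show "\<eta> (s n - y) = 0" by (rule R)
    qed (auto simp: B)
  qed
  then show ?thesis unfolding continuous_on_sequentially o_def by blast
qed

text \<open>Differentiation falls on the kernel: the difference quotients of \<open>\<eta>\<close> are bounded by the mean value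
theorem and live in a common ball.\<close>
lemma conv_dd:
  fixes g :: "'a::euclidean_space \<Rightarrow> real"
  assumes g: "loc_int g" and \<eta>: "Cc \<eta>" and d: "dd v \<eta> \<eta>'" and c: "continuous_on UNIV \<eta>'"
  shows "dd v (conv g \<eta>) (conv g \<eta>')"
  unfolding dd_def
proof
  fix x :: 'a
  have \<eta>': "Cc \<eta>'" by (rule dd_Cc_deriv_support[OF d \<eta> c])
  obtain R where R: "\<And>x. norm x > R \<Longrightarrow> \<eta> x = 0" using Cc_supportE[OF \<eta>] by blast
  obtain B where B: "\<And>x. \<bar>\<eta>' x\<bar> \<le> B" using Cc_boundE[OF \<eta>'] by blast
  have [measurable]: "\<eta> \<in> borel_measurable borel" "\<eta>' \<in> borel_measurable borel"
    using \<eta> \<eta>' by (auto intro: Cc_measurable)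
  have "((\<lambda>t. (conv g \<eta> (x + t *\<^sub>R v) - conv g \<eta> x) / t) \<longlongrightarrow> conv g \<eta>' x) (at 0)"
    unfolding tendsto_at_iff_sequentially
  proof (intro allI impI)
    fix s :: "nat \<Rightarrow> real" assume s: "\<forall>i. s i \<in> UNIV - {0}" and lim: "s \<longlonglongrightarrow> 0"
    have s0: "s n \<noteq> 0" for n using s by auto
    have "bounded (range s)" using lim by (intro convergent_imp_bounded) (auto simp: convergent_def)
    then obtain r where r: "\<And>n. \<bar>s n\<bar> \<le> r" unfolding bounded_iff by auto
    have r0: "r \<ge> 0" using r[of 0] by linarith
    define q where "q n y = (\<eta> ((x - y) + s n *\<^sub>R v) - \<eta> (x - y)) / s n" for n y
    have eq: "(conv g \<eta> (x + s n *\<^sub>R v) - conv g \<eta> x) / s n = (LBINT y. g y * q n y)" for n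
    proof -
      have "(LBINT y. g y * q n y) = (LBINT y. (g y * \<eta> ((x + s n *\<^sub>R v) - y) - g y * \<eta> (x - y)) / s n)"
        unfolding q_def by (intro Bochner_Integration.integral_cong) (auto simp: algebra_simps diff_divide_distrib)
      then show ?thesis by (simp add: conv_def Bochner_Integration.integral_diff conv_integrable[OF g \<eta>])
    qed
    have "(\<lambda>n. LBINT y. g y * q n y) \<longlonglongrightarrow> (LBINT y. g y * \<eta>' (x - y))"
    proof (rule conv_sequential_limit[OF g, where B=B and R="norm x + r * norm v + R"])
      fix y :: 'a
      have "((\<lambda>t. (\<eta> ((x - y) + t *\<^sub>R v) - \<eta> (x - y)) / t) \<longlongrightarrow> \<eta>' (x - y)) (at 0)"
        using ddD[OF d, of "x - y"] by (simp add: DERIV_def)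
      then show "(\<lambda>n. q n y) \<longlonglongrightarrow> \<eta>' (x - y)"
        unfolding q_def tendsto_at_iff_sequentially using s lim by (auto simp: o_def)
      fix n
      obtain t where "\<eta> ((x - y) + s n *\<^sub>R v) - \<eta> (x - y) = s n * \<eta>' ((x - y) + t *\<^sub>R v)"
        using dd_MVT[OF d s0[of n], of "x - y"] by metis
      then have "q n y = \<eta>' ((x - y) + t *\<^sub>R v)" using s0[of n] by (simp add: q_def)
      then show "\<bar>q n y\<bar> \<le> B" using B by simp
    next
      fix n and y :: 'a assume y: "norm x + r * norm v + R < norm y"
      have sv: "norm (s n *\<^sub>R v) \<le> r * norm v" using r[of n] by (simp add: mult_right_mono)
      have "norm (x - y) > R + r * norm v" using y norm_triangle_ineq2[of y x] by (simp add: norm_minus_commute)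
      moreover have "r * norm v \<ge> 0" using r0 by simp
      moreover have "norm (x - y) \<le> norm ((x - y) + s n *\<^sub>R v) + norm (s n *\<^sub>R v)"
        using norm_triangle_ineq4[of "(x - y) + s n *\<^sub>R v" "s n *\<^sub>R v"] by simp
      ultimately have "norm (x - y) > R" "norm ((x - y) + s n *\<^sub>R v) > R" using sv by linarith+
      then show "q n y = 0" using R by (simp add: q_def)
    qed (auto simp: q_def)
    then show "((\<lambda>t. (conv g \<eta> (x + t *\<^sub>R v) - conv g \<eta> x) / t) \<circ> s) \<longlonglongrightarrow> conv g \<eta>' x"
      by (simp add: o_def eq conv_def[of g \<eta>'])
  qed
  then show "((\<lambda>t. conv g \<eta> (x + t *\<^sub>R v)) has_real_derivative conv g \<eta>' x) (at 0)"
    by (simp add: DERIV_def)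
qed

lemma lborel_distr_reflect: "distr lborel borel (\<lambda>y. x - y) = (lborel :: 'a::euclidean_space measure)"
  using lborel_affine[of "-1" x] by (simp add: density_1)

lemma lborel_integral_reflect:
  fixes f :: "'a::euclidean_space \<Rightarrow> real"
  assumes [measurable]: "f \<in> borel_measurable borel"
  shows "(LBINT y. f (x - y)) = (LBINT y. f y)"
proof -
  have "(LBINT y. f y) = (\<integral>y. f y \<partial>(distr lborel borel (\<lambda>y. x - y)))"
    by (simp add: lborel_distr_reflect)
  also have "\<dots> = (LBINT y. f (x - y))" by (subst integral_distr) auto
  finally show ?thesis by simp
qed

definition moll :: "nat \<Rightarrow> 'a::euclidean_space \<Rightarrow> real" where
  "moll m x = bump (real (Suc m) *\<^sub>R x) / (\<integral>y. bump (real (Suc m) *\<^sub>R y) \<partial>(lborel :: 'a measure))"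

lemma moll:
  fixes x :: "'a::euclidean_space"
  shows test_function_moll: "test_function (moll m :: 'a \<Rightarrow> real)"
    and moll_nonneg: "moll m x \<ge> 0"
    and integral_moll: "(\<integral>y. moll m y \<partial>(lborel :: 'a measure)) = 1"
    and moll_support: "norm x > real DIM('a) / real (Suc m) \<Longrightarrow> moll m x = 0"
proof -
  define b :: "'a \<Rightarrow> real" where "b x = bump (real (Suc m) *\<^sub>R x)" for x
  have tb: "test_function b" unfolding b_def[abs_def] by (rule test_function_bump) simp
  have Cb: "Cc b" by (rule test_function_Cc[OF tb])
  define I where "I = (LBINT y. b y)"
  have I: "I > 0" unfolding I_def
    by (rule continuous_integral_pos[OF Cc_cont[OF Cb] _ Cc_integrable[OF Cb], of 0])
       (auto simp: b_def bump_nonneg bump_0)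
  have eq: "moll m = (\<lambda>x::'a. (1 / I) * b x)" by (auto simp: moll_def I_def b_def)
  show "test_function (moll m :: 'a \<Rightarrow> real)" unfolding eq by (rule test_function_cmult[OF tb])
  show "moll m x \<ge> 0" unfolding eq using I by (simp add: b_def bump_nonneg)
  show "(\<integral>y. moll m y \<partial>(lborel :: 'a measure)) = 1" unfolding eq using I by (simp add: I_def)
  show "moll m x = 0" if "norm x > real DIM('a) / real (Suc m)"
  proof -
    have "norm (real (Suc m) *\<^sub>R x) = norm x * real (Suc m)" by (simp only: norm_scaleR) simp
    then have "norm (real (Suc m) *\<^sub>R x) > real DIM('a)" using that by (simp add: pos_divide_less_eq mult.commute)
    then show ?thesis unfolding eq b_def by (subst bump_eq_0) auto
  qed
qed

lemma moll_support': "norm (x::'a::euclidean_space) > real DIM('a) \<Longrightarrow> moll m x = 0"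
proof (rule moll_support)
  assume "norm x > real DIM('a)"
  moreover have "real DIM('a) / real (Suc m) \<le> real DIM('a) / 1" by (intro divide_left_mono) auto
  ultimately show "norm x > real DIM('a) / real (Suc m)" by simp
qed

lemma Cc_moll: "Cc (moll m)" by (rule test_function_Cc[OF test_function_moll])

lemma moll_measurable [measurable]: "moll m \<in> borel_measurable borel" by (rule Cc_measurable[OF Cc_moll])

lemma integral_moll_reflect: "(LBINT y. moll m (x - y)) = 1"
  by (subst lborel_integral_reflect) (auto simp: integral_moll)

text \<open>Averaging contracts the \<open>L\<^sup>2\<close> norm: Cauchy-Schwarz against the probability density
\<open>moll m (x - y)\<close>, then Tonelli.\<close>
lemma conv_moll_sq_le:
  fixes g :: "'a::euclidean_space \<Rightarrow> real"
  assumes g: "integrable lborel g" "integrable lborel (\<lambda>x. (g x)\<^sup>2)"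
  shows "integrable lborel (\<lambda>x. (conv g (moll m) x)\<^sup>2)"
    and "(LBINT x. (conv g (moll m) x)\<^sup>2) \<le> (LBINT x. (g x)\<^sup>2)"
proof -
  have [measurable]: "g \<in> borel_measurable borel" using g by auto
  have [measurable]: "conv g (moll m) \<in> borel_measurable borel"
    by (intro borel_measurable_continuous_onI conv_continuous integrable_imp_loc_int g Cc_moll)
  have imr: "integrable lborel (\<lambda>y. moll m (x - y))" for x :: 'a
    by (intro Cc_integrable Cc_reflect Cc_moll)
  have g2m: "integrable lborel (\<lambda>y. (g y)\<^sup>2 * moll m (x - y))" for x
    by (intro conv_integrable integrable_imp_loc_int g Cc_moll)
  have pt: "(conv g (moll m) x)\<^sup>2 \<le> (LBINT y. (g y)\<^sup>2 * moll m (x - y))" for x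
  proof -
    have "(LBINT y. (g y * sqrt (moll m (x - y))) * sqrt (moll m (x - y)))\<^sup>2
      \<le> (LBINT y. (g y * sqrt (moll m (x - y)))\<^sup>2) * (LBINT y. (sqrt (moll m (x - y)))\<^sup>2)"
      using g2m imr by (intro Cauchy_Schwarz_integral) (auto simp: power_mult_distrib moll_nonneg)
    then show ?thesis
      by (simp add: conv_def power_mult_distrib moll_nonneg mult.assoc integral_moll_reflect)
  qed
  have "(\<integral>\<^sup>+x. ennreal ((conv g (moll m) x)\<^sup>2) \<partial>lborel) \<le> (\<integral>\<^sup>+x. (\<integral>\<^sup>+y. ennreal ((g y)\<^sup>2) * ennreal (moll m (x - y)) \<partial>lborel) \<partial>lborel)"
  proof (rule nn_integral_mono)
    fix x :: 'a
    have "ennreal ((conv g (moll m) x)\<^sup>2) \<le> ennreal (LBINT y. (g y)\<^sup>2 * moll m (x - y))"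
      by (rule ennreal_leI[OF pt])
    also have "\<dots> = (\<integral>\<^sup>+y. ennreal ((g y)\<^sup>2 * moll m (x - y)) \<partial>lborel)"
      using g2m by (intro nn_integral_eq_integral[symmetric]) (auto simp: moll_nonneg)
    finally show "ennreal ((conv g (moll m) x)\<^sup>2) \<le> (\<integral>\<^sup>+y. ennreal ((g y)\<^sup>2) * ennreal (moll m (x - y)) \<partial>lborel)"
      by (simp add: ennreal_mult moll_nonneg)
  qed
  also have "\<dots> = (\<integral>\<^sup>+y. (\<integral>\<^sup>+x. ennreal ((g y)\<^sup>2) * ennreal (moll m (x - y)) \<partial>lborel) \<partial>lborel)"
    by (rule lborel_pair.Fubini') measurable
  also have "\<dots> = (\<integral>\<^sup>+y. ennreal ((g y)\<^sup>2) \<partial>lborel)"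
  proof (rule nn_integral_cong)
    fix y :: 'a
    have "(\<integral>\<^sup>+x. ennreal (moll m (x - y)) \<partial>lborel) = (\<integral>\<^sup>+x. ennreal (moll m (x::'a)) \<partial>lborel)"
      using nn_integral_shift[of "\<lambda>x. ennreal (moll m x)" "- y"] by simp
    also have "\<dots> = ennreal (LBINT x. moll m (x::'a))"
      by (intro nn_integral_eq_integral Cc_integrable Cc_moll) (auto simp: moll_nonneg)
    finally have "(\<integral>\<^sup>+x. ennreal (moll m (x - y)) \<partial>lborel) = 1" by (simp add: integral_moll)
    then show "(\<integral>\<^sup>+x. ennreal ((g y)\<^sup>2) * ennreal (moll m (x - y)) \<partial>lborel) = ennreal ((g y)\<^sup>2)"
      by (subst nn_integral_cmult) auto
  qed
  also have "\<dots> = ennreal (LBINT x. (g x)\<^sup>2)" using g by (intro nn_integral_eq_integral) auto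
  finally have le: "(\<integral>\<^sup>+x. ennreal ((conv g (moll m) x)\<^sup>2) \<partial>lborel) \<le> ennreal (LBINT x. (g x)\<^sup>2)" .
  show i: "integrable lborel (\<lambda>x. (conv g (moll m) x)\<^sup>2)"
    by (rule integrableI_nonneg) (use le_less_trans[OF le] in auto)
  have "ennreal (LBINT x. (conv g (moll m) x)\<^sup>2) \<le> ennreal (LBINT x. (g x)\<^sup>2)"
    using le nn_integral_eq_integral[OF i] by simp
  then show "(LBINT x. (conv g (moll m) x)\<^sup>2) \<le> (LBINT x. (g x)\<^sup>2)"
    by (subst (asm) ennreal_le_iff) auto
qed

lemma conv_moll_pointwise:
  fixes \<phi> :: "'a::euclidean_space \<Rightarrow> real"
  assumes \<phi>: "Cc \<phi>"
  shows "(\<lambda>m. conv \<phi> (moll m) x) \<longlonglongrightarrow> \<phi> x"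
proof (rule LIMSEQ_I)
  fix r :: real assume "r > 0"
  have "isCont \<phi> x" using Cc_cont[OF \<phi>] by (simp add: continuous_on_eq_continuous_at)
  then obtain \<delta> where \<delta>: "\<delta> > 0" "\<And>y. dist y x < \<delta> \<Longrightarrow> dist (\<phi> y) (\<phi> x) < r / 2"
    using \<open>r > 0\<close> unfolding continuous_at_eps_delta by (metis half_gt_zero)
  obtain M where M: "real DIM('a) / \<delta> < real M" using reals_Archimedean2 by blast
  show "\<exists>M. \<forall>m\<ge>M. norm (conv \<phi> (moll m) x - \<phi> x) < r"
  proof (intro exI allI impI)
    fix m assume "M \<le> m"
    then have "real DIM('a) / \<delta> < real (Suc m)" using M by linarith
    then have m: "real DIM('a) / real (Suc m) < \<delta>" using \<delta>(1) by (simp add: field_simps)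
    have imr: "integrable lborel (\<lambda>y. moll m (x - y))" by (intro Cc_integrable Cc_reflect Cc_moll)
    have ic: "integrable lborel (\<lambda>y. \<phi> y * moll m (x - y))"
      by (intro conv_integrable integrable_imp_loc_int Cc_integrable \<phi> Cc_moll)
    have "conv \<phi> (moll m) x - \<phi> x = (LBINT y. \<phi> y * moll m (x - y)) - \<phi> x * (LBINT y. moll m (x - y))"
      by (simp add: conv_def integral_moll_reflect)
    also have "\<dots> = (LBINT y. \<phi> y * moll m (x - y) - \<phi> x * moll m (x - y))"
      using imr ic by simp
    finally have eq: "conv \<phi> (moll m) x - \<phi> x = (LBINT y. \<phi> y * moll m (x - y) - \<phi> x * moll m (x - y))" .
    have "norm (conv \<phi> (moll m) x - \<phi> x) \<le> (LBINT y. r / 2 * moll m (x - y))"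
      unfolding eq
    proof (rule Bochner_Integration.integral_norm_bound_integral)
      fix y :: 'a
      show "norm (\<phi> y * moll m (x - y) - \<phi> x * moll m (x - y)) \<le> r / 2 * moll m (x - y)"
      proof (cases "norm (x - y) > real DIM('a) / real (Suc m)")
        case True
        then show ?thesis by (simp add: moll_support)
      next
        case False
        then have "dist y x < \<delta>" using m by (simp add: dist_norm norm_minus_commute)
        then have "\<bar>\<phi> y - \<phi> x\<bar> \<le> r / 2" using \<delta>(2) by (simp add: dist_real_def less_imp_le)
        then have "\<bar>\<phi> y - \<phi> x\<bar> * moll m (x - y) \<le> r / 2 * moll m (x - y)"
          by (intro mult_right_mono) (auto simp: moll_nonneg)
        then show ?thesis by (simp add: abs_mult moll_nonneg flip: left_diff_distrib)
      qed
    qed (use imr ic in auto)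
    also have "\<dots> = r / 2" by (simp add: integral_moll_reflect)
    finally show "norm (conv \<phi> (moll m) x - \<phi> x) < r" using \<open>r > 0\<close> by simp
  qed
qed

lemma conv_moll_Cc_L2:
  fixes \<phi> :: "'a::euclidean_space \<Rightarrow> real"
  assumes \<phi>: "Cc \<phi>"
  shows "(\<lambda>m. LBINT x. (conv \<phi> (moll m) x - \<phi> x)\<^sup>2) \<longlonglongrightarrow> 0"
proof -
  obtain R where R: "R > 0" "\<And>x. norm x > R \<Longrightarrow> \<phi> x = 0" using Cc_supportE[OF \<phi>] by blast
  obtain B where B: "B > 0" "\<And>x. \<bar>\<phi> x\<bar> \<le> B" using Cc_boundE[OF \<phi>] by blast
  have li: "loc_int \<phi>" by (intro integrable_imp_loc_int Cc_integrable \<phi>)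
  have [measurable]: "\<phi> \<in> borel_measurable borel" by (rule Cc_measurable[OF \<phi>])
  have [measurable]: "conv \<phi> (moll m) \<in> borel_measurable borel" for m
    by (intro borel_measurable_continuous_onI conv_continuous li Cc_moll)
  have bound: "\<bar>conv \<phi> (moll m) x\<bar> \<le> B" for m x
  proof -
    have "norm (conv \<phi> (moll m) x) \<le> (LBINT y. B * moll m (x - y))"
      unfolding conv_def
      by (rule Bochner_Integration.integral_norm_bound_integral)
         (auto simp: abs_mult moll_nonneg B mult_right_mono conv_integrable[OF li Cc_moll] intro!: Cc_integrable Cc_reflect Cc_moll)
    then show ?thesis by (simp add: integral_moll_reflect)
  qed
  let ?N = "R + real DIM('a)"
  have supp: "conv \<phi> (moll m) x = 0" if "norm x > ?N" for m x
  proof -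
    have "\<phi> y * moll m (x - y) = 0" for y
    proof (cases "norm y > R")
      case False
      then have "norm (x - y) > real DIM('a)" using that norm_triangle_ineq2[of x y] by linarith
      then show ?thesis by (simp add: moll_support')
    qed (simp add: R)
    then have "(\<lambda>y. \<phi> y * moll m (x - y)) = (\<lambda>y. 0)" by blast
    then show ?thesis by (simp add: conv_def)
  qed
  have "(\<lambda>m. LBINT x. (conv \<phi> (moll m) x - \<phi> x)\<^sup>2) \<longlonglongrightarrow> (\<integral>x. (0::real) \<partial>(lborel :: 'a measure))"
  proof (rule integral_dominated_convergence[where w="\<lambda>x. (2 * B)\<^sup>2 * cut ?N x"])
    show "integrable lborel (\<lambda>x. (2 * B)\<^sup>2 * cut ?N x)" by (intro integrable_mult_right Cc_integrable Cc_cut)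
    show "AE x in lborel. (\<lambda>m. (conv \<phi> (moll m) x - \<phi> x)\<^sup>2) \<longlonglongrightarrow> 0"
    proof (rule AE_I2)
      fix x
      have "(\<lambda>m. (conv \<phi> (moll m) x - \<phi> x)\<^sup>2) \<longlonglongrightarrow> (\<phi> x - \<phi> x)\<^sup>2"
        by (intro tendsto_intros conv_moll_pointwise \<phi>)
      then show "(\<lambda>m. (conv \<phi> (moll m) x - \<phi> x)\<^sup>2) \<longlonglongrightarrow> 0" by simp
    qed
    show "AE x in lborel. norm ((conv \<phi> (moll m) x - \<phi> x)\<^sup>2) \<le> (2 * B)\<^sup>2 * cut ?N x" for m
    proof (rule AE_I2)
      fix x :: 'a
      show "norm ((conv \<phi> (moll m) x - \<phi> x)\<^sup>2) \<le> (2 * B)\<^sup>2 * cut ?N x"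
      proof (cases "norm x \<le> ?N")
        case True
        have "\<bar>conv \<phi> (moll m) x - \<phi> x\<bar> \<le> \<bar>2 * B\<bar>" using bound[of m x] B(2)[of x] B(1) by linarith
        then have "(conv \<phi> (moll m) x - \<phi> x)\<^sup>2 \<le> (2 * B)\<^sup>2" by (simp only: abs_le_square_iff)
        then show ?thesis by (simp add: cut_eq_1[OF True])
      next
        case False
        moreover have "norm x > R" using False by simp
        ultimately show ?thesis using supp[of x m] R(2)[of x] by (simp add: cut_bounds)
      qed
    qed
  qed auto
  then show ?thesis by simp
qed

lemma conv_diff: "loc_int f \<Longrightarrow> loc_int g \<Longrightarrow> Cc \<eta> \<Longrightarrow> conv (\<lambda>x. f x - g x) \<eta> x = conv f \<eta> x - conv g \<eta> x"
  unfolding conv_def left_diff_distrib by (intro Bochner_Integration.integral_diff conv_integrable)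

text \<open>By contraction, convergence passes from an approximating sequence of continuous functions to the
limit. The approximation is a hypothesis, since the functions treated below come with one.\<close>
lemma conv_moll_L2:
  fixes g :: "'a::euclidean_space \<Rightarrow> real" and \<phi> :: "nat \<Rightarrow> 'a \<Rightarrow> real"
  assumes g: "integrable lborel g" "integrable lborel (\<lambda>x. (g x)\<^sup>2)"
    and \<phi>: "\<And>k. Cc (\<phi> k)" and lim: "(\<lambda>k. LBINT x. (g x - \<phi> k x)\<^sup>2) \<longlonglongrightarrow> 0"
  shows "(\<lambda>m. LBINT x. (conv g (moll m) x - g x)\<^sup>2) \<longlonglongrightarrow> 0"
    and "integrable lborel (\<lambda>x. (conv g (moll m) x - g x)\<^sup>2)"
proof -
  have lg: "loc_int g" by (rule integrable_imp_loc_int[OF g(1)])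
  have [measurable]: "g \<in> borel_measurable borel" using g by auto
  have l\<phi>: "loc_int (\<phi> k)" for k by (intro integrable_imp_loc_int Cc_integrable \<phi>)
  have [measurable]: "\<phi> k \<in> borel_measurable borel" for k by (rule Cc_measurable[OF \<phi>])
  have \<phi>2: "integrable lborel (\<lambda>x. (\<phi> k x)\<^sup>2)" for k by (intro Cc_integrable Cc_power2 \<phi>)
  have [measurable]: "conv f (moll m) \<in> borel_measurable borel" if "loc_int f" for f :: "'a \<Rightarrow> real" and m
    by (intro borel_measurable_continuous_onI conv_continuous that Cc_moll)
  note [measurable] = this[OF lg] this[OF l\<phi>]
  show int: "integrable lborel (\<lambda>x. (conv g (moll m) x - g x)\<^sup>2)" for m
    by (intro integrable_diff_sq conv_moll_sq_le g) measurable
  define b where "b k = (LBINT x. (g x - \<phi> k x)\<^sup>2)" for k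
  define e where "e k m = (LBINT x. (conv (\<phi> k) (moll m) x - \<phi> k x)\<^sup>2)" for k m
  have main: "(LBINT x. (conv g (moll m) x - g x)\<^sup>2) \<le> 6 * b k + 3 * e k m" for k m
  proof -
    define d where "d x = g x - \<phi> k x" for x
    have [measurable]: "d \<in> borel_measurable borel" unfolding d_def[abs_def] by measurable
    have d: "integrable lborel d" "integrable lborel (\<lambda>x. (d x)\<^sup>2)"
      unfolding d_def by (intro Bochner_Integration.integrable_diff g Cc_integrable \<phi>) (intro integrable_diff_sq g \<phi>2; measurable)
    have ie: "integrable lborel (\<lambda>x. (conv (\<phi> k) (moll m) x - \<phi> k x)\<^sup>2)"
      by (intro integrable_diff_sq conv_moll_sq_le \<phi>2 Cc_integrable \<phi>) measurable
    have sq: "(a + b + c)\<^sup>2 \<le> 3 * a\<^sup>2 + 3 * b\<^sup>2 + 3 * c\<^sup>2" for a b c :: real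
    proof -
      have "0 \<le> (a - b)\<^sup>2 + (b - c)\<^sup>2 + (a - c)\<^sup>2" by simp
      then show ?thesis by (simp add: power2_eq_square algebra_simps)
    qed
    have "(LBINT x. (conv g (moll m) x - g x)\<^sup>2) \<le> (LBINT x. 3 * (conv d (moll m) x)\<^sup>2 + 3 * (conv (\<phi> k) (moll m) x - \<phi> k x)\<^sup>2 + 3 * (d x)\<^sup>2)"
    proof (rule integral_mono[OF int])
      show "integrable lborel (\<lambda>x. 3 * (conv d (moll m) x)\<^sup>2 + 3 * (conv (\<phi> k) (moll m) x - \<phi> k x)\<^sup>2 + 3 * (d x)\<^sup>2)"
        using conv_moll_sq_le(1)[OF d] ie d by simp
      fix x
      have "conv d (moll m) x = conv g (moll m) x - conv (\<phi> k) (moll m) x"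
        unfolding d_def[abs_def] by (intro conv_diff lg l\<phi> Cc_moll)
      then have "conv g (moll m) x - g x = conv d (moll m) x + (conv (\<phi> k) (moll m) x - \<phi> k x) + (- d x)"
        by (simp add: d_def)
      then show "(conv g (moll m) x - g x)\<^sup>2 \<le> 3 * (conv d (moll m) x)\<^sup>2 + 3 * (conv (\<phi> k) (moll m) x - \<phi> k x)\<^sup>2 + 3 * (d x)\<^sup>2"
        using sq[of "conv d (moll m) x" "conv (\<phi> k) (moll m) x - \<phi> k x" "- d x"] by simp
    qed
    also have "\<dots> = 3 * (LBINT x. (conv d (moll m) x)\<^sup>2) + 3 * e k m + 3 * b k"
      unfolding e_def b_def d_def[symmetric] using conv_moll_sq_le(1)[OF d, of m] ie d by simp
    also have "(LBINT x. (conv d (moll m) x)\<^sup>2) \<le> b k"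
      unfolding b_def d_def[symmetric] by (rule conv_moll_sq_le(2)[OF d])
    finally show ?thesis by simp
  qed
  show "(\<lambda>m. LBINT x. (conv g (moll m) x - g x)\<^sup>2) \<longlonglongrightarrow> 0"
  proof (rule LIMSEQ_I)
    fix r :: real assume "r > 0"
    then have "eventually (\<lambda>k. b k < r / 12) sequentially"
      using lim unfolding b_def by (intro order_tendstoD) auto
    then obtain k where k: "b k < r / 12" by (meson eventually_happens trivial_limit_sequentially)
    have "e k \<longlonglongrightarrow> 0" unfolding e_def by (rule conv_moll_Cc_L2[OF \<phi>])
    then have "eventually (\<lambda>m. e k m < r / 6) sequentially" using \<open>r > 0\<close> by (intro order_tendstoD) auto
    then obtain M where M: "\<And>m. m \<ge> M \<Longrightarrow> e k m < r / 6" unfolding eventually_sequentially by blast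
    show "\<exists>M. \<forall>m\<ge>M. norm ((LBINT x. (conv g (moll m) x - g x)\<^sup>2) - 0) < r"
    proof (intro exI allI impI)
      fix m assume "M \<le> m"
      then have "6 * b k + 3 * e k m < r" using M[of m] k by simp
      then show "norm ((LBINT x. (conv g (moll m) x - g x)\<^sup>2) - 0) < r"
        using main[of m k] by (simp add: le_less_trans)
    qed
  qed
qed

section \<open>Weak solutions: the Caccioppoli estimate\<close>

lemma dd_scale:
  assumes "dd v f f'" shows "dd v (\<lambda>x. f (s *\<^sub>R x)) (\<lambda>x. s * f' (s *\<^sub>R x))"
  unfolding dd_def
proof
  fix x
  have "((\<lambda>t. f (s *\<^sub>R x + t *\<^sub>R v)) has_real_derivative f' (s *\<^sub>R x)) (at (s * 0))"
    using ddD[OF assms, of "s *\<^sub>R x"] by simp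
  moreover have "((\<lambda>t. s * t) has_real_derivative s) (at 0)"
    by (auto intro!: derivative_eq_intros)
  ultimately have "((\<lambda>t. f (s *\<^sub>R x + (s * t) *\<^sub>R v)) has_real_derivative f' (s *\<^sub>R x) * s) (at 0)"
    by (rule DERIV_chain2)
  then show "((\<lambda>t. f (s *\<^sub>R (x + t *\<^sub>R v))) has_real_derivative s * f' (s *\<^sub>R x)) (at 0)"
    by (simp add: algebra_simps)
qed

lemma pd_minus: "smooth f \<Longrightarrow> pd b (\<lambda>x. - f x) = (\<lambda>x. - pd b f x)"
  by (intro pd_eqI dd_minus smooth_dd smooth_differentiable smooth_minus)

text \<open>The difference of the two sides is a sum of three squares. In the application \<open>r\<close> is the weight,
\<open>p\<close> the cutoff and \<open>q\<close> its derivative, \<open>k\<close> the mollified solution and \<open>K\<close> its derivative, and \<open>E\<close>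
the error in the flux.\<close>
lemma caccioppoli_pointwise:
  fixes r p q k K E :: real
  assumes "r > 0"
  shows "1 / 2 * (r * p\<^sup>2 * K\<^sup>2) \<le> (r * K + E) * (2 * p * q * k + p\<^sup>2 * K) + 5 * (r * q\<^sup>2 * k\<^sup>2) + 2 * (p\<^sup>2 * E\<^sup>2 / r)"
proof -
  have "(r * K + E) * (2 * p * q * k + p\<^sup>2 * K) + 5 * (r * q\<^sup>2 * k\<^sup>2) + 2 * (p\<^sup>2 * E\<^sup>2 / r) - 1 / 2 * (r * p\<^sup>2 * K\<^sup>2)
      = r * (1 / 2 * p * K + 2 * q * k)\<^sup>2 + p\<^sup>2 * (1 / 2 * r * K + E)\<^sup>2 / r + (r * q * k + p * E)\<^sup>2 / r"
    using assms by (simp add: field_simps power2_eq_square)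
  also have "\<dots> \<ge> 0" using assms by simp
  finally show ?thesis by simp
qed

text \<open>A square integrable weak solution \<open>h\<close> of \<open>L h = 0\<close>, together with continuous compactly supported
functions \<open>gs k\<close> that converge to it; the latter replace the density theorem for \<open>L\<^sup>2\<close>.\<close>
locale weak_solution = smooth_weight U for U :: "'a::euclidean_space \<Rightarrow> real" +
  fixes h :: "'a \<Rightarrow> real" and gs :: "nat \<Rightarrow> 'a \<Rightarrow> real"
  assumes h_meas [measurable]: "h \<in> borel_measurable borel"
    and h2: "integrable \<mu> (\<lambda>x. (h x)\<^sup>2)"
    and gs: "\<And>k. Cc (gs k)"
    and gs_lim: "(\<lambda>k. \<integral>x. (h x - gs k x)\<^sup>2 \<partial>\<mu>) \<longlonglongrightarrow> 0"
    and weak: "\<And>w. test_function w \<Longrightarrow> (\<integral>x. h x * gen U w x \<partial>\<mu>) = 0"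
begin

lemma gs_meas [measurable]: "gs k \<in> borel_measurable borel" by (rule Cc_measurable[OF gs])

lemma cont_expU: "continuous_on A (\<lambda>x. exp (U x))"
  by (intro continuous_intros continuous_on_subset[OF contU]) auto

lemma h_gs2: "integrable \<mu> (\<lambda>x. (h x - gs k x)\<^sup>2)"
  by (rule integrable_diff_sq[OF _ _ h2 Cc_\<mu>(3)[OF gs]]) (auto simp: measurable_\<mu>)

text \<open>On compact sets \<open>\<rho>\<close> is bounded below, so the weighted norm controls the unweighted one there.\<close>
lemma weighted_square_le:
  assumes [measurable]: "f \<in> borel_measurable borel" and f: "integrable \<mu> (\<lambda>x. (f x)\<^sup>2)"
    and a: "Cc a" and B: "\<And>x. \<bar>a x * exp (U x)\<bar> \<le> B"
  shows "integrable lborel (\<lambda>x. a x * (f x)\<^sup>2)"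
    and "\<bar>LBINT x. a x * (f x)\<^sup>2\<bar> \<le> B * (\<integral>x. (f x)\<^sup>2 \<partial>\<mu>)"
proof -
  have [measurable]: "a \<in> borel_measurable borel" by (rule Cc_measurable[OF a])
  have fi: "integrable lborel (\<lambda>x. B * ((f x)\<^sup>2 * \<rho> x))" using f by (simp add: integrable_\<mu>)
  have le: "norm (a x * (f x)\<^sup>2) \<le> B * ((f x)\<^sup>2 * \<rho> x)" for x
  proof -
    have "exp (U x) * \<rho> x = 1" by (simp add: exp_minus)
    then have "a x * (f x)\<^sup>2 = (a x * exp (U x)) * ((f x)\<^sup>2 * \<rho> x)" by (simp add: algebra_simps)
    then have "norm (a x * (f x)\<^sup>2) = \<bar>a x * exp (U x)\<bar> * ((f x)\<^sup>2 * \<rho> x)" by (simp add: abs_mult)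
    also have "\<dots> \<le> B * ((f x)\<^sup>2 * \<rho> x)" by (intro mult_right_mono B) auto
    finally show ?thesis .
  qed
  show i: "integrable lborel (\<lambda>x. a x * (f x)\<^sup>2)"
    by (rule Bochner_Integration.integrable_bound[OF fi], measurable, rule AE_I2, rule order_trans[OF le]) simp
  have "norm (LBINT x. a x * (f x)\<^sup>2) \<le> (LBINT x. B * ((f x)\<^sup>2 * \<rho> x))"
    by (rule Bochner_Integration.integral_norm_bound_integral[OF i fi le])
  then show "\<bar>LBINT x. a x * (f x)\<^sup>2\<bar> \<le> B * (\<integral>x. (f x)\<^sup>2 \<partial>\<mu>)" by (simp add: integral_\<mu>)
qed

lemma Cc_expU_boundE:
  assumes a: "Cc a" obtains B where "\<And>x. \<bar>a x * exp (U x)\<bar> \<le> B"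
  using Cc_boundE[OF Cc_mult2[OF cont_expU a]] by metis

lemma h2_weight: "Cc a \<Longrightarrow> integrable lborel (\<lambda>x. a x * (h x)\<^sup>2)"
  using weighted_square_le(1)[OF h_meas h2] Cc_expU_boundE by metis

lemma h_gs_weight_lim:
  assumes a: "Cc a" shows "(\<lambda>k. LBINT x. a x * (h x - gs k x)\<^sup>2) \<longlonglongrightarrow> 0"
proof -
  obtain B where B: "\<And>x. \<bar>a x * exp (U x)\<bar> \<le> B" using Cc_expU_boundE[OF a] by blast
  have "\<bar>LBINT x. a x * (h x - gs k x)\<^sup>2\<bar> \<le> B * (\<integral>x. (h x - gs k x)\<^sup>2 \<partial>\<mu>)" for k
    by (rule weighted_square_le(2)[OF _ h_gs2 a B]) measurable
  then show ?thesis
    by (intro Lim_null_comparison[OF _ tendsto_mult_right_zero[OF gs_lim]] always_eventually allI) simp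
qed

lemma loc_int_h: "loc_int h"
  unfolding loc_int_def
proof (intro conjI allI h_meas)
  fix R :: real
  have [measurable]: "(cut R :: 'a \<Rightarrow> real) \<in> borel_measurable borel" by (rule Cc_measurable[OF Cc_cut])
  have "integrable lborel (\<lambda>x::'a. cut R x + cut R x * (h x)\<^sup>2)"
    by (intro Bochner_Integration.integrable_add Cc_integrable Cc_cut h2_weight)
  then show "integrable lborel (\<lambda>x. cut R x * h x)"
  proof (rule Bochner_Integration.integrable_bound)
    show "AE x in lborel. norm (cut R x * h x) \<le> norm (cut R x + cut R x * (h x)\<^sup>2)"
    proof (rule AE_I2)
      fix x
      have "0 \<le> (\<bar>h x\<bar> - 1)\<^sup>2" by simp
      then have "2 * \<bar>h x\<bar> \<le> 1 + (h x)\<^sup>2" by (simp add: power2_diff)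
      then have "\<bar>h x\<bar> \<le> 1 + (h x)\<^sup>2" using abs_ge_zero[of "h x"] by linarith
      then have "cut R x * \<bar>h x\<bar> \<le> cut R x * (1 + (h x)\<^sup>2)" by (intro mult_left_mono cut_bounds)
      then show "norm (cut R x * h x) \<le> norm (cut R x + cut R x * (h x)\<^sup>2)"
        by (simp add: abs_mult cut_bounds algebra_simps)
    qed
  qed measurable
qed

lemma loc_int_hs: "continuous_on UNIV s \<Longrightarrow> loc_int (\<lambda>y. h y * s y)"
  by (intro loc_int_mult_continuous loc_int_h)

lemma conv_hs_integrable:
  assumes s: "continuous_on UNIV s" and a: "Cc a"
  shows "integrable lborel (\<lambda>x. a x * (conv (\<lambda>y. h y * s y) (moll m) x - h x * s x)\<^sup>2)"
proof -
  define c where "c = conv (\<lambda>y. h y * s y) (moll m)"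
  have c: "continuous_on UNIV c" unfolding c_def by (intro conv_continuous loc_int_hs s Cc_moll)
  have "integrable lborel (\<lambda>x. a x * c x * c x)" by (intro Cc_integrable Cc_mult2 c a)
  moreover have "integrable lborel (\<lambda>x. h x * (2 * (a x * c x * s x)))"
    by (intro loc_int_mult_Cc[OF loc_int_h] Cc_cmult Cc_mult2 c s a)
  moreover have "integrable lborel (\<lambda>x. (a x * s x * s x) * (h x)\<^sup>2)"
    by (intro h2_weight Cc_mult2 s a)
  ultimately have "integrable lborel (\<lambda>x. a x * c x * c x - h x * (2 * (a x * c x * s x)) + (a x * s x * s x) * (h x)\<^sup>2)"
    by simp
  then show ?thesis unfolding c_def[symmetric] by (simp add: power2_eq_square algebra_simps)
qed

text \<open>Mollification converges in \<open>L\<^sup>2\<close> on compact sets. Near the support of \<open>a\<close> one may multiply \<open>h\<close> by a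
cutoff \<open>\<theta>\<close> without changing the convolution, and \<open>\<theta> s (gs k)\<close> approximates \<open>\<theta> s h\<close>.\<close>
lemma conv_hs_lim:
  assumes s: "continuous_on UNIV s" and a: "Cc a"
  shows "(\<lambda>m. LBINT x. a x * (conv (\<lambda>y. h y * s y) (moll m) x - h x * s x)\<^sup>2) \<longlonglongrightarrow> 0"
proof -
  obtain R where R: "\<And>x. norm x > R \<Longrightarrow> a x = 0" using Cc_supportE[OF a] by blast
  obtain A where A: "\<And>x. \<bar>a x\<bar> \<le> A" using Cc_boundE[OF a] by blast
  define \<theta> :: "'a \<Rightarrow> real" where "\<theta> = cut (R + real DIM('a))"
  define t where "t x = \<theta> x * s x" for x
  have Ct: "Cc t" unfolding t_def[abs_def] \<theta>_def by (intro Cc_mult2 s Cc_cut)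
  define g where "g x = h x * t x" for x
  have g1: "integrable lborel g" unfolding g_def[abs_def] by (intro loc_int_mult_Cc loc_int_h Ct)
  have g2: "integrable lborel (\<lambda>x. (g x)\<^sup>2)"
    using h2_weight[OF Cc_power2[OF Ct]] by (simp add: g_def power_mult_distrib mult.commute)
  have "(LBINT x. (g x - gs k x * t x)\<^sup>2) = (LBINT x. (t x)\<^sup>2 * (h x - gs k x)\<^sup>2)" for k
    unfolding g_def by (simp add: power2_eq_square algebra_simps)
  then have approx: "(\<lambda>k. LBINT x. (g x - gs k x * t x)\<^sup>2) \<longlonglongrightarrow> 0"
    using h_gs_weight_lim[OF Cc_power2[OF Ct]] by simp
  have Cgt: "Cc (\<lambda>x. gs k x * t x)" for k by (intro Cc_mult2 Cc_cont[OF Ct] gs)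
  note L2 = conv_moll_L2[of g "\<lambda>k x. gs k x * t x", OF g1 g2 Cgt approx]
  have eq: "conv (\<lambda>y. h y * s y) (moll m) x = conv g (moll m) x" "h x * s x = g x" if x: "norm x \<le> R" for x m
  proof -
    have "h y * s y * moll m (x - y) = g y * moll m (x - y)" for y
    proof (cases "norm y \<le> R + real DIM('a)")
      case True
      then show ?thesis by (simp add: g_def t_def \<theta>_def cut_eq_1)
    next
      case False
      then have "norm (x - y) > real DIM('a)" using x norm_triangle_ineq2[of y x] by (simp add: norm_minus_commute)
      then show ?thesis by (simp add: moll_support')
    qed
    then have "(\<lambda>y. h y * s y * moll m (x - y)) = (\<lambda>y. g y * moll m (x - y))" by (rule ext)
    then show "conv (\<lambda>y. h y * s y) (moll m) x = conv g (moll m) x" by (simp add: conv_def)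
    show "h x * s x = g x" using x by (simp add: g_def t_def \<theta>_def cut_eq_1)
  qed
  have "\<bar>LBINT x. a x * (conv (\<lambda>y. h y * s y) (moll m) x - h x * s x)\<^sup>2\<bar> \<le> A * (LBINT x. (conv g (moll m) x - g x)\<^sup>2)" for m
  proof -
    have "norm (LBINT x. a x * (conv (\<lambda>y. h y * s y) (moll m) x - h x * s x)\<^sup>2) \<le> (LBINT x. A * (conv g (moll m) x - g x)\<^sup>2)"
    proof (rule Bochner_Integration.integral_norm_bound_integral[OF conv_hs_integrable[OF s a] integrable_mult_right[OF L2(2)]])
      fix x
      show "norm (a x * (conv (\<lambda>y. h y * s y) (moll m) x - h x * s x)\<^sup>2) \<le> A * (conv g (moll m) x - g x)\<^sup>2"
      proof (cases "norm x \<le> R")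
        case True
        show ?thesis unfolding eq[OF True] using A[of x] by (simp add: abs_mult mult_right_mono)
      next
        case False
        moreover have "A \<ge> 0" using A[of x] by linarith
        ultimately show ?thesis using R[of x] by simp
      qed
    qed
    then show ?thesis by simp
  qed
  then show ?thesis
    by (intro Lim_null_comparison[OF _ tendsto_mult_right_zero[OF L2(1)]] always_eventually allI) simp
qed

lemma conv_hs_weak:
  assumes s: "continuous_on UNIV s" and \<zeta>: "Cc \<zeta>"
  shows "(\<lambda>m. LBINT x. conv (\<lambda>y. h y * s y) (moll m) x * \<zeta> x) \<longlonglongrightarrow> (LBINT x. h x * s x * \<zeta> x)"
proof -
  obtain R where R: "\<And>x. norm x > R \<Longrightarrow> \<zeta> x = 0" using Cc_supportE[OF \<zeta>] by blast
  define \<sigma> :: "'a \<Rightarrow> real" where "\<sigma> = cut R"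
  have C\<sigma>: "Cc \<sigma>" unfolding \<sigma>_def by (rule Cc_cut)
  have [measurable]: "\<sigma> \<in> borel_measurable borel" "\<zeta> \<in> borel_measurable borel" "s \<in> borel_measurable borel"
    using C\<sigma> \<zeta> s by (auto intro: Cc_measurable borel_measurable_continuous_onI)
  define D where "D m x = conv (\<lambda>y. h y * s y) (moll m) x - h x * s x" for m x
  have cc: "continuous_on UNIV (conv (\<lambda>y. h y * s y) (moll m))" for m by (intro conv_continuous loc_int_hs s Cc_moll)
  then have [measurable]: "conv (\<lambda>y. h y * s y) (moll m) \<in> borel_measurable borel" for m
    by (rule borel_measurable_continuous_onI)
  have [measurable]: "D m \<in> borel_measurable borel" for m unfolding D_def[abs_def] by measurable
  define C where "C = (LBINT x. (\<zeta> x)\<^sup>2)"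
  have bound: "eventually (\<lambda>m. norm ((LBINT x. conv (\<lambda>y. h y * s y) (moll m) x * \<zeta> x) - (LBINT x. h x * s x * \<zeta> x))
      \<le> sqrt ((LBINT x. (\<sigma> x)\<^sup>2 * (D m x)\<^sup>2) * C)) sequentially"
  proof (intro always_eventually allI)
    fix m
    have "(LBINT x. conv (\<lambda>y. h y * s y) (moll m) x * \<zeta> x) - (LBINT x. h x * s x * \<zeta> x) = (LBINT x. D m x * \<zeta> x)"
      unfolding D_def left_diff_distrib
      by (intro Bochner_Integration.integral_diff[symmetric] loc_int_mult_Cc loc_int_hs s \<zeta> Cc_integrable Cc_mult1 cc)
    also have "\<dots> = (LBINT x. (\<sigma> x * D m x) * \<zeta> x)"
    proof (rule Bochner_Integration.integral_cong)
      fix x :: 'a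
      show "D m x * \<zeta> x = \<sigma> x * D m x * \<zeta> x"
        using R[of x] by (cases "norm x \<le> R") (auto simp: \<sigma>_def cut_eq_1)
    qed simp
    finally have eq: "(LBINT x. conv (\<lambda>y. h y * s y) (moll m) x * \<zeta> x) - (LBINT x. h x * s x * \<zeta> x) = (LBINT x. (\<sigma> x * D m x) * \<zeta> x)" .
    have "(LBINT x. (\<sigma> x * D m x) * \<zeta> x)\<^sup>2 \<le> (LBINT x. (\<sigma> x * D m x)\<^sup>2) * (LBINT x. (\<zeta> x)\<^sup>2)"
    proof (rule Cauchy_Schwarz_integral)
      show "integrable lborel (\<lambda>x. (\<sigma> x * D m x)\<^sup>2)"
        unfolding power_mult_distrib D_def by (intro conv_hs_integrable s Cc_power2 C\<sigma>)
      show "integrable lborel (\<lambda>x. (\<zeta> x)\<^sup>2)" by (intro Cc_integrable Cc_power2 \<zeta>)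
    qed measurable
    then show "norm ((LBINT x. conv (\<lambda>y. h y * s y) (moll m) x * \<zeta> x) - (LBINT x. h x * s x * \<zeta> x))
      \<le> sqrt ((LBINT x. (\<sigma> x)\<^sup>2 * (D m x)\<^sup>2) * C)"
      unfolding eq C_def by (intro real_le_rsqrt) (simp add: power_mult_distrib)
  qed
  have "(\<lambda>m. LBINT x. (\<sigma> x)\<^sup>2 * (D m x)\<^sup>2) \<longlonglongrightarrow> 0"
    unfolding D_def by (intro conv_hs_lim s Cc_power2 C\<sigma>)
  from tendsto_real_sqrt[OF tendsto_mult_left_zero[OF this, of C]]
  have "(\<lambda>m. sqrt ((LBINT x. (\<sigma> x)\<^sup>2 * (D m x)\<^sup>2) * C)) \<longlonglongrightarrow> 0" by simp
  from Lim_null_comparison[OF bound this] show ?thesis by (rule LIM_zero_cancel)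
qed

abbreviation H where "H \<equiv> \<lambda>y. h y * \<rho> y"
abbreviation Hd where "Hd b \<equiv> \<lambda>y. h y * (\<rho> y * pd b U y)"

lemma loc_int_H: "loc_int H" by (intro loc_int_hs cont\<rho>)
lemma loc_int_Hd: "b \<in> Basis \<Longrightarrow> loc_int (Hd b)" by (intro loc_int_hs continuous_on_mult cont\<rho> contdU)

text \<open>The weak equation tested with the reflected kernel \<open>\<lambda>y. \<eta> (x - y)\<close>.\<close>
lemma flux_divergence:
  assumes \<eta>: "test_function \<eta>"
  shows "(\<Sum>b\<in>Basis. conv H (pd b (pd b \<eta>)) x + conv (Hd b) (pd b \<eta>) x) = 0"
proof -
  define w where "w y = \<eta> (x - y)" for y
  have w: "test_function w" unfolding w_def[abs_def] by (rule test_function_reflect[OF \<eta>])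
  note s\<eta> = test_function_smooth[OF \<eta>]
  have pw: "pd b w = (\<lambda>y. - pd b \<eta> (x - y))" for b
    unfolding w_def[abs_def] by (rule pd_reflect[OF s\<eta>])
  have ppw: "pd b (\<lambda>y. - pd b \<eta> (x - y)) = (\<lambda>y. pd b (pd b \<eta>) (x - y))" if "b \<in> Basis" for b
    using pd_reflect[of "\<lambda>z. - pd b \<eta> z" b x] pd_minus[of "pd b \<eta>" b] smooth_pd[OF s\<eta> that]
    by (simp add: smooth_minus)
  have t: "test_function (pd b \<eta>)" "test_function (pd b (pd b \<eta>))" if "b \<in> Basis" for b
    using that \<eta> by (auto intro: test_function_pd)
  have [measurable]: "gen U w \<in> borel_measurable borel"
    by (intro Cc_measurable test_function_Cc test_function_gen smoothU w)
  have i1: "integrable lborel (\<lambda>y. H y * pd b (pd b \<eta>) (x - y))" if "b \<in> Basis" for b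
    by (intro conv_integrable loc_int_H test_function_Cc t that)
  have i2: "integrable lborel (\<lambda>y. Hd b y * pd b \<eta> (x - y))" if "b \<in> Basis" for b
    by (intro conv_integrable loc_int_Hd test_function_Cc t that)
  have "0 = (\<integral>y. h y * gen U w y \<partial>\<mu>)" using weak[OF w] by simp
  also have "\<dots> = (LBINT y. h y * gen U w y * \<rho> y)" by (rule integral_\<mu>) measurable
  also have "\<dots> = (LBINT y. (\<Sum>b\<in>Basis. H y * pd b (pd b \<eta>) (x - y) + Hd b y * pd b \<eta> (x - y)))"
    by (intro Bochner_Integration.integral_cong refl)
       (simp add: gen_def gen1_def ppw pw sum_distrib_left sum_distrib_right algebra_simps)
  also have "\<dots> = (\<Sum>b\<in>Basis. conv H (pd b (pd b \<eta>)) x + conv (Hd b) (pd b \<eta>) x)"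
    by (simp add: conv_def Bochner_Integration.integral_sum i1 i2)
  finally show ?thesis by simp
qed

text \<open>The mollified solution is the mollification of \<open>h \<rho>\<close> divided by \<open>\<rho>\<close>, not the mollification of
\<open>h\<close>: this is the function whose weighted gradient is close to the divergence free flux.\<close>
definition mh :: "nat \<Rightarrow> 'a \<Rightarrow> real" where "mh m x = conv H (moll m) x * exp (U x)"
definition mh_pd :: "nat \<Rightarrow> 'a \<Rightarrow> 'a \<Rightarrow> real" where
  "mh_pd m b x = conv H (pd b (moll m)) x * exp (U x) + conv H (moll m) x * (exp (U x) * pd b U x)"
text \<open>The commutator of mollification with multiplication by \<open>\<partial>\<^sub>b U\<close>. It involves no derivative of \<open>h\<close>.\<close>
definition flux_err :: "nat \<Rightarrow> 'a \<Rightarrow> 'a \<Rightarrow> real" where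
  "flux_err m b x = conv (Hd b) (moll m) x - pd b U x * conv H (moll m) x"

lemma test_pd_moll: "b \<in> Basis \<Longrightarrow> test_function (pd b (moll m))"
  by (intro test_function_pd test_function_moll)

lemma dd_conv_moll:
  assumes "loc_int G" "b \<in> Basis"
  shows "dd b (conv G (moll m)) (conv G (pd b (moll m)))" "dd b (conv G (pd b (moll m))) (conv G (pd b (pd b (moll m))))"
  using assms by (auto intro!: conv_dd Cc_moll smooth_dd test_function_Cc test_pd_moll smooth_continuous test_function_smooth test_function_moll test_function_pd)

lemma cont_conv_moll: "loc_int G \<Longrightarrow> continuous_on UNIV (conv G (moll m))"
  by (intro conv_continuous Cc_moll)

lemma cont_conv:
  assumes "loc_int G" "b \<in> Basis"
  shows "continuous_on UNIV (conv G (pd b (moll m)))" "continuous_on UNIV (conv G (pd b (pd b (moll m))))"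
  using assms by (auto intro!: conv_continuous Cc_moll test_function_Cc test_pd_moll test_function_pd)

lemma cont_mh: "continuous_on UNIV (mh m)"
  unfolding mh_def[abs_def] by (intro continuous_on_mult conv_continuous loc_int_H Cc_moll cont_expU)

lemma cont_mh_pd: "b \<in> Basis \<Longrightarrow> continuous_on UNIV (mh_pd m b)"
  unfolding mh_pd_def[abs_def] by (intro continuous_intros cont_conv[OF loc_int_H] cont_conv_moll[OF loc_int_H] cont_expU contdU)

lemma cont_flux_err: "b \<in> Basis \<Longrightarrow> continuous_on UNIV (flux_err m b)"
  unfolding flux_err_def[abs_def] by (intro continuous_intros cont_conv_moll[OF loc_int_H] cont_conv_moll[OF loc_int_Hd] contdU)

lemma dd_mh: "b \<in> Basis \<Longrightarrow> dd b (mh m) (mh_pd m b)"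
  unfolding mh_def[abs_def] mh_pd_def[abs_def] by (intro dd_mult dd_conv_moll loc_int_H dd_exp smooth_dd smoothU)

lemma flux_eq: "conv H (pd b (moll m)) x + conv (Hd b) (moll m) x = \<rho> x * mh_pd m b x + flux_err m b x"
proof -
  have re: "\<rho> x * exp (U x) = 1" by (simp add: exp_minus)
  have "\<rho> x * mh_pd m b x = (\<rho> x * exp (U x)) * (conv H (pd b (moll m)) x + conv H (moll m) x * pd b U x)"
    unfolding mh_pd_def by (simp only: algebra_simps)
  then have "\<rho> x * mh_pd m b x = conv H (pd b (moll m)) x + conv H (moll m) x * pd b U x"
    unfolding re by (simp only: mult_1_left)
  then show ?thesis by (simp add: flux_err_def)
qed

text \<open>The divergence free flux integrates to zero against the gradient of \<open>\<phi>\<^sup>2\<close> times the mollified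
solution.\<close>
lemma flux_tested:
  assumes \<phi>: "test_function \<phi>"
  shows "(\<Sum>b\<in>Basis. LBINT x. (\<rho> x * mh_pd m b x + flux_err m b x) * (2 * \<phi> x * pd b \<phi> x * mh m x + (\<phi> x)\<^sup>2 * mh_pd m b x)) = 0"
proof -
  define F where "F b x = conv H (pd b (moll m)) x + conv (Hd b) (moll m) x" for b x
  define F' where "F' b x = conv H (pd b (pd b (moll m))) x + conv (Hd b) (pd b (moll m)) x" for b x
  note s\<phi> = test_function_smooth[OF \<phi>]
  note C\<phi> = test_function_Cc[OF \<phi>]
  define \<psi> where "\<psi> x = \<phi> x * \<phi> x * mh m x" for x
  define \<psi>' where "\<psi>' b x = (pd b \<phi> x * \<phi> x + \<phi> x * pd b \<phi> x) * mh m x + \<phi> x * \<phi> x * mh_pd m b x" for b x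
  have C\<psi>: "Cc \<psi>" unfolding \<psi>_def[abs_def] by (intro Cc_mult2 cont_mh Cc_cont C\<phi>)
  have d\<psi>: "dd b \<psi> (\<psi>' b)" if "b \<in> Basis" for b
    unfolding \<psi>_def[abs_def] \<psi>'_def[abs_def] by (intro dd_mult smooth_dd s\<phi> dd_mh that)
  have c\<psi>': "continuous_on UNIV (\<psi>' b)" if "b \<in> Basis" for b
    unfolding \<psi>'_def[abs_def]
    by (intro continuous_on_mult continuous_on_add smooth_continuous smooth_pd s\<phi> cont_mh cont_mh_pd that)
  have C\<psi>': "Cc (\<psi>' b)" if "b \<in> Basis" for b by (rule dd_Cc_deriv_support[OF d\<psi>[OF that] C\<psi> c\<psi>'[OF that]])
  have dF: "dd b (F b) (F' b)" if "b \<in> Basis" for b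
    unfolding F_def[abs_def] F'_def[abs_def] by (intro dd_add dd_conv_moll loc_int_H loc_int_Hd that)
  have cF: "continuous_on UNIV (F b)" "continuous_on UNIV (F' b)" if "b \<in> Basis" for b
    unfolding F_def[abs_def] F'_def[abs_def] by (intro continuous_on_add cont_conv_moll cont_conv loc_int_H loc_int_Hd that)+
  have "(LBINT x. F' b x * \<psi> x) + (LBINT x. F b x * \<psi>' b x) = 0" if b: "b \<in> Basis" for b
  proof -
    have "(LBINT x. F' b x * \<psi> x + F b x * \<psi>' b x) = 0"
      by (rule integral_dd_eq_0[OF dd_mult[OF dF[OF b] d\<psi>[OF b]]])
         (intro Cc_mult1 cF b C\<psi> continuous_on_add continuous_on_mult c\<psi>' Cc_cont)+
    moreover have "integrable lborel (\<lambda>x. F' b x * \<psi> x)" "integrable lborel (\<lambda>x. F b x * \<psi>' b x)"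
      by (intro Cc_integrable Cc_mult1 cF C\<psi> C\<psi>' b)+
    ultimately show ?thesis by simp
  qed
  then have "0 = (\<Sum>b\<in>Basis. (LBINT x. F' b x * \<psi> x) + (LBINT x. F b x * \<psi>' b x))" by simp
  also have "\<dots> = (\<Sum>b\<in>Basis. (LBINT x. F' b x * \<psi> x)) + (\<Sum>b\<in>Basis. LBINT x. F b x * \<psi>' b x)"
    by (rule sum.distrib)
  also have "(\<Sum>b\<in>Basis. (LBINT x. F' b x * \<psi> x)) = (LBINT x. (\<Sum>b\<in>Basis. F' b x) * \<psi> x)"
    unfolding sum_distrib_right
    by (intro Bochner_Integration.integral_sum[symmetric] Cc_integrable Cc_mult1 cF C\<psi>)
  also have "\<dots> = 0" using flux_divergence[OF test_function_moll] by (simp add: F'_def)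
  finally have "(\<Sum>b\<in>Basis. LBINT x. F b x * \<psi>' b x) = 0" by simp
  moreover have "F b x * \<psi>' b x = (\<rho> x * mh_pd m b x + flux_err m b x) * (2 * \<phi> x * pd b \<phi> x * mh m x + (\<phi> x)\<^sup>2 * mh_pd m b x)" for b x
    unfolding F_def flux_eq \<psi>'_def by (simp add: power2_eq_square algebra_simps)
  ultimately show ?thesis by simp
qed

text \<open>The pointwise inequality, integrated; the term with the full flux drops out by \<open>flux_tested\<close>.\<close>
lemma caccioppoli:
  assumes \<phi>: "test_function \<phi>"
  shows "1 / 2 * (\<Sum>b\<in>Basis. LBINT x. \<rho> x * (\<phi> x)\<^sup>2 * (mh_pd m b x)\<^sup>2)
    \<le> (\<Sum>b\<in>Basis. 5 * (LBINT x. \<rho> x * (pd b \<phi> x)\<^sup>2 * (mh m x)\<^sup>2) + 2 * (LBINT x. (\<phi> x)\<^sup>2 * (flux_err m b x)\<^sup>2 * exp (U x)))"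
proof -
  note C\<phi> = test_function_Cc[OF \<phi>]
  have Cd: "Cc (pd b \<phi>)" if "b \<in> Basis" for b using that \<phi> by (intro test_function_Cc test_function_pd)
  have sq: "continuous_on UNIV f \<Longrightarrow> continuous_on UNIV (\<lambda>x. (f x)\<^sup>2)" for f :: "'a \<Rightarrow> real" by (intro continuous_intros)
  have C1: "Cc (\<lambda>x. \<rho> x * (\<phi> x)\<^sup>2 * (mh_pd m b x)\<^sup>2)" if "b \<in> Basis" for b
    by (intro Cc_mult2 Cc_mult1 sq cont_mh_pd that cont\<rho> Cc_power2 C\<phi>)
  have C2: "Cc (\<lambda>x. \<rho> x * (pd b \<phi> x)\<^sup>2 * (mh m x)\<^sup>2)" if "b \<in> Basis" for b
    by (intro Cc_mult2[OF sq[OF cont_mh]] Cc_mult1[OF cont\<rho>] Cc_power2 Cd that)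
  have C3: "Cc (\<lambda>x. (\<phi> x)\<^sup>2 * (flux_err m b x)\<^sup>2 * exp (U x))" if "b \<in> Basis" for b
    by (rule Cc_mult2[OF cont_expU], rule Cc_mult2[OF sq[OF cont_flux_err[OF that]]], rule Cc_power2[OF C\<phi>])
  have C4: "Cc (\<lambda>x. (\<rho> x * mh_pd m b x + flux_err m b x) * (2 * \<phi> x * pd b \<phi> x * mh m x + (\<phi> x)\<^sup>2 * mh_pd m b x))" if "b \<in> Basis" for b
  proof (rule Cc_mult1)
    show "continuous_on UNIV (\<lambda>x. \<rho> x * mh_pd m b x + flux_err m b x)"
      by (intro continuous_on_add continuous_on_mult cont\<rho> cont_mh_pd cont_flux_err that)
    have "Cc (\<lambda>x. 2 * \<phi> x * pd b \<phi> x * mh m x)"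
      by (rule Cc_mult2[OF cont_mh], rule Cc_mult2[OF Cc_cont[OF Cd[OF that]]], rule Cc_cmult[OF C\<phi>])
    moreover have "Cc (\<lambda>x. (\<phi> x)\<^sup>2 * mh_pd m b x)" by (rule Cc_mult2[OF cont_mh_pd[OF that]], rule Cc_power2[OF C\<phi>])
    ultimately show "Cc (\<lambda>x. 2 * \<phi> x * pd b \<phi> x * mh m x + (\<phi> x)\<^sup>2 * mh_pd m b x)" by (rule Cc_add)
  qed
  note I = Cc_integrable[OF C1] Cc_integrable[OF C2] Cc_integrable[OF C3] Cc_integrable[OF C4]
  have "1 / 2 * (LBINT x. \<rho> x * (\<phi> x)\<^sup>2 * (mh_pd m b x)\<^sup>2) \<le>
      (LBINT x. (\<rho> x * mh_pd m b x + flux_err m b x) * (2 * \<phi> x * pd b \<phi> x * mh m x + (\<phi> x)\<^sup>2 * mh_pd m b x))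
      + (5 * (LBINT x. \<rho> x * (pd b \<phi> x)\<^sup>2 * (mh m x)\<^sup>2) + 2 * (LBINT x. (\<phi> x)\<^sup>2 * (flux_err m b x)\<^sup>2 * exp (U x)))" if b: "b \<in> Basis" for b
  proof -
    have "(LBINT x. 1 / 2 * (\<rho> x * (\<phi> x)\<^sup>2 * (mh_pd m b x)\<^sup>2)) \<le>
      (LBINT x. (\<rho> x * mh_pd m b x + flux_err m b x) * (2 * \<phi> x * pd b \<phi> x * mh m x + (\<phi> x)\<^sup>2 * mh_pd m b x)
        + (5 * (\<rho> x * (pd b \<phi> x)\<^sup>2 * (mh m x)\<^sup>2) + 2 * ((\<phi> x)\<^sup>2 * (flux_err m b x)\<^sup>2 * exp (U x))))"
    proof (rule integral_mono)
      fix x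
      show "1 / 2 * (\<rho> x * (\<phi> x)\<^sup>2 * (mh_pd m b x)\<^sup>2) \<le> (\<rho> x * mh_pd m b x + flux_err m b x) * (2 * \<phi> x * pd b \<phi> x * mh m x + (\<phi> x)\<^sup>2 * mh_pd m b x)
        + (5 * (\<rho> x * (pd b \<phi> x)\<^sup>2 * (mh m x)\<^sup>2) + 2 * ((\<phi> x)\<^sup>2 * (flux_err m b x)\<^sup>2 * exp (U x)))"
      proof -
        have "(\<phi> x)\<^sup>2 * (flux_err m b x)\<^sup>2 / \<rho> x = (\<phi> x)\<^sup>2 * (flux_err m b x)\<^sup>2 * exp (U x)"
          by (simp add: exp_minus divide_inverse)
        with caccioppoli_pointwise[of "\<rho> x" "\<phi> x" "mh_pd m b x" "flux_err m b x" "pd b \<phi> x" "mh m x"]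
        show ?thesis by (simp only: add.assoc exp_gt_zero)
      qed
    qed (use I b in auto)
    then show ?thesis using I b by simp
  qed
  then have "(\<Sum>b\<in>Basis. 1 / 2 * (LBINT x. \<rho> x * (\<phi> x)\<^sup>2 * (mh_pd m b x)\<^sup>2)) \<le> (\<Sum>b\<in>Basis.
      (LBINT x. (\<rho> x * mh_pd m b x + flux_err m b x) * (2 * \<phi> x * pd b \<phi> x * mh m x + (\<phi> x)\<^sup>2 * mh_pd m b x))
      + (5 * (LBINT x. \<rho> x * (pd b \<phi> x)\<^sup>2 * (mh m x)\<^sup>2) + 2 * (LBINT x. (\<phi> x)\<^sup>2 * (flux_err m b x)\<^sup>2 * exp (U x))))"
    by (intro sum_mono)
  then show ?thesis
    unfolding sum.distrib sum_distrib_left[symmetric] flux_tested[OF \<phi>] by (simp only: add_0_left)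
qed

text \<open>In the limit of the mollification the flux error disappears, and what remains on the right involves
the solution itself, not its gradient. The bound \<open>(a + b)\<^sup>2 \<le> 2 a\<^sup>2 + 2 b\<^sup>2\<close> turns
the convergence in \<open>L\<^sup>2\<close> into a one-sided estimate, whose factor is \<open>20\<close> instead of \<open>10\<close>.\<close>
lemma caccioppoli_lim:
  assumes \<phi>: "test_function \<phi>"
  obtains e where "e \<longlonglongrightarrow> 0" 
    "\<And>m. (\<Sum>b\<in>Basis. LBINT x. \<rho> x * (\<phi> x)\<^sup>2 * (mh_pd m b x)\<^sup>2) \<le> 20 * (\<Sum>b\<in>Basis. \<integral>x. (pd b \<phi> x)\<^sup>2 * (h x)\<^sup>2 \<partial>\<mu>) + e m"
proof -
  note C\<phi> = test_function_Cc[OF \<phi>]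
  have Cd: "Cc (pd b \<phi>)" if "b \<in> Basis" for b using that \<phi> by (intro test_function_Cc test_function_pd)
  have [measurable]: "pd b \<phi> \<in> borel_measurable borel" if "b \<in> Basis" for b by (rule Cc_measurable[OF Cd[OF that]])
  define a1 where "a1 b x = (pd b \<phi> x)\<^sup>2 * exp (U x)" for b x
  define a2 where "a2 x = (\<phi> x)\<^sup>2 * exp (U x)" for x
  define a3 where "a3 b x = a2 x * (pd b U x * pd b U x)" for b x
  have Ca1: "Cc (a1 b)" if "b \<in> Basis" for b unfolding a1_def[abs_def] by (rule Cc_mult2[OF cont_expU Cc_power2[OF Cd[OF that]]])
  have Ca2: "Cc a2" unfolding a2_def[abs_def] by (rule Cc_mult2[OF cont_expU Cc_power2[OF C\<phi>]])
  have Ca3: "Cc (a3 b)" if "b \<in> Basis" for b unfolding a3_def[abs_def]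
    by (rule Cc_mult2[OF _ Ca2]) (intro continuous_on_mult contdU that)
  define DH where "DH m x = conv H (moll m) x - H x" for m x
  define DD where "DD m b x = conv (Hd b) (moll m) x - Hd b x" for m b x
  define e1 where "e1 m b = (LBINT x. a1 b x * (DH m x)\<^sup>2)" for m b
  define e2 where "e2 m b = (LBINT x. a2 x * (DD m b x)\<^sup>2)" for m b
  define e3 where "e3 m b = (LBINT x. a3 b x * (DH m x)\<^sup>2)" for m b
  have cHd: "continuous_on UNIV (\<lambda>y. \<rho> y * pd b U y)" if "b \<in> Basis" for b by (intro continuous_on_mult cont\<rho> contdU that)
  have i1: "integrable lborel (\<lambda>x. a1 b x * (DH m x)\<^sup>2)" if "b \<in> Basis" for b m
    unfolding DH_def by (rule conv_hs_integrable[OF cont\<rho> Ca1[OF that]])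
  have i2: "integrable lborel (\<lambda>x. a2 x * (DD m b x)\<^sup>2)" if "b \<in> Basis" for b m
    unfolding DD_def by (rule conv_hs_integrable[OF cHd[OF that] Ca2])
  have i3: "integrable lborel (\<lambda>x. a3 b x * (DH m x)\<^sup>2)" if "b \<in> Basis" for b m
    unfolding DH_def by (rule conv_hs_integrable[OF cont\<rho> Ca3[OF that]])
  have l1: "(\<lambda>m. e1 m b) \<longlonglongrightarrow> 0" if "b \<in> Basis" for b
    unfolding e1_def DH_def by (rule conv_hs_lim[OF cont\<rho> Ca1[OF that]])
  have l2: "(\<lambda>m. e2 m b) \<longlonglongrightarrow> 0" if "b \<in> Basis" for b
    unfolding e2_def DD_def by (rule conv_hs_lim[OF cHd[OF that] Ca2])
  have l3: "(\<lambda>m. e3 m b) \<longlonglongrightarrow> 0" if "b \<in> Basis" for b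
    unfolding e3_def DH_def by (rule conv_hs_lim[OF cont\<rho> Ca3[OF that]])
  have sq2: "(a + b)\<^sup>2 \<le> 2 * a\<^sup>2 + 2 * b\<^sup>2" "(a - b)\<^sup>2 \<le> 2 * a\<^sup>2 + 2 * b\<^sup>2" for a b :: real
    using sum_squares_bound[of a b] sum_squares_bound[of a "- b"] by (auto simp: power2_sum power2_diff)
  have re: "\<rho> x * exp (U x) = 1" for x by (simp add: exp_minus)
  have b1: "(LBINT x. \<rho> x * (pd b \<phi> x)\<^sup>2 * (mh m x)\<^sup>2) \<le> 2 * (\<integral>x. (pd b \<phi> x)\<^sup>2 * (h x)\<^sup>2 \<partial>\<mu>) + 2 * e1 m b" if b: "b \<in> Basis" for m b
  proof -
    have [measurable]: "pd b \<phi> \<in> borel_measurable borel" by (rule Cc_measurable[OF Cd[OF b]])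
    have ih: "integrable lborel (\<lambda>x. (pd b \<phi> x)\<^sup>2 * (h x)\<^sup>2 * \<rho> x)"
      using h2_weight[OF Cc_mult2[OF cont\<rho> Cc_power2[OF Cd[OF b]]]] by (simp add: mult_ac)
    have "(LBINT x. \<rho> x * (pd b \<phi> x)\<^sup>2 * (mh m x)\<^sup>2) \<le> (LBINT x. 2 * ((pd b \<phi> x)\<^sup>2 * (h x)\<^sup>2 * \<rho> x) + 2 * (a1 b x * (DH m x)\<^sup>2))"
    proof (rule integral_mono)
      show "integrable lborel (\<lambda>x. \<rho> x * (pd b \<phi> x)\<^sup>2 * (mh m x)\<^sup>2)"
        by (rule Cc_integrable, rule Cc_mult2) (intro continuous_intros cont_mh, intro Cc_mult1[OF cont\<rho>] Cc_power2 Cd b)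
      show "integrable lborel (\<lambda>x. 2 * ((pd b \<phi> x)\<^sup>2 * (h x)\<^sup>2 * \<rho> x) + 2 * (a1 b x * (DH m x)\<^sup>2))"
        using ih i1[OF b] by simp
      fix x
      have "\<rho> x * (pd b \<phi> x)\<^sup>2 * (mh m x)\<^sup>2 = (\<rho> x * exp (U x)) * (a1 b x * (conv H (moll m) x)\<^sup>2)"
        by (simp add: mh_def a1_def power2_eq_square algebra_simps)
      also have "\<dots> = a1 b x * (H x + DH m x)\<^sup>2" by (simp add: re DH_def)
      also have "\<dots> \<le> a1 b x * (2 * (H x)\<^sup>2 + 2 * (DH m x)\<^sup>2)" by (intro mult_left_mono sq2) (simp add: a1_def)
      also have "a1 b x * (H x)\<^sup>2 = (\<rho> x * exp (U x)) * ((pd b \<phi> x)\<^sup>2 * (h x)\<^sup>2 * \<rho> x)"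
        by (simp add: a1_def power2_eq_square algebra_simps)
      then have "a1 b x * (2 * (H x)\<^sup>2 + 2 * (DH m x)\<^sup>2) = 2 * ((pd b \<phi> x)\<^sup>2 * (h x)\<^sup>2 * \<rho> x) + 2 * (a1 b x * (DH m x)\<^sup>2)"
        by (simp only: re distrib_left mult.left_commute[of "a1 b x" 2] mult_1_left)
      finally show "\<rho> x * (pd b \<phi> x)\<^sup>2 * (mh m x)\<^sup>2 \<le> 2 * ((pd b \<phi> x)\<^sup>2 * (h x)\<^sup>2 * \<rho> x) + 2 * (a1 b x * (DH m x)\<^sup>2)" .
    qed
    also have "\<dots> = 2 * (LBINT x. (pd b \<phi> x)\<^sup>2 * (h x)\<^sup>2 * \<rho> x) + 2 * e1 m b"
      using ih i1[OF b] by (simp add: e1_def)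
    also have "(LBINT x. (pd b \<phi> x)\<^sup>2 * (h x)\<^sup>2 * \<rho> x) = (\<integral>x. (pd b \<phi> x)\<^sup>2 * (h x)\<^sup>2 \<partial>\<mu>)"
      by (rule integral_\<mu>[symmetric]) measurable
    finally show ?thesis .
  qed
  have b2: "(LBINT x. (\<phi> x)\<^sup>2 * (flux_err m b x)\<^sup>2 * exp (U x)) \<le> 2 * e2 m b + 2 * e3 m b" if b: "b \<in> Basis" for m b
  proof -
    have "(LBINT x. (\<phi> x)\<^sup>2 * (flux_err m b x)\<^sup>2 * exp (U x)) \<le> (LBINT x. 2 * (a2 x * (DD m b x)\<^sup>2) + 2 * (a3 b x * (DH m x)\<^sup>2))"
    proof (rule integral_mono)
      have "Cc (\<lambda>x. a2 x * (flux_err m b x)\<^sup>2)" by (rule Cc_mult2[OF _ Ca2]) (intro continuous_intros cont_flux_err b)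
      then show "integrable lborel (\<lambda>x. (\<phi> x)\<^sup>2 * (flux_err m b x)\<^sup>2 * exp (U x))"
        using Cc_integrable by (simp add: a2_def mult_ac)
      show "integrable lborel (\<lambda>x. 2 * (a2 x * (DD m b x)\<^sup>2) + 2 * (a3 b x * (DH m x)\<^sup>2))"
        using i2[OF b] i3[OF b] by simp
      fix x
      have "flux_err m b x = DD m b x - pd b U x * DH m x" by (simp add: flux_err_def DD_def DH_def algebra_simps)
      then have "(\<phi> x)\<^sup>2 * (flux_err m b x)\<^sup>2 * exp (U x) = a2 x * (DD m b x - pd b U x * DH m x)\<^sup>2"
        by (simp add: a2_def mult_ac)
      also have "\<dots> \<le> a2 x * (2 * (DD m b x)\<^sup>2 + 2 * (pd b U x * DH m x)\<^sup>2)"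
        by (intro mult_left_mono sq2) (simp add: a2_def)
      also have "\<dots> = 2 * (a2 x * (DD m b x)\<^sup>2) + 2 * (a3 b x * (DH m x)\<^sup>2)"
        by (simp add: a3_def power2_eq_square algebra_simps)
      finally show "(\<phi> x)\<^sup>2 * (flux_err m b x)\<^sup>2 * exp (U x) \<le> 2 * (a2 x * (DD m b x)\<^sup>2) + 2 * (a3 b x * (DH m x)\<^sup>2)" .
    qed
    also have "\<dots> = 2 * e2 m b + 2 * e3 m b" using i2[OF b] i3[OF b] by (simp add: e2_def e3_def)
    finally show ?thesis .
  qed
  define e where "e m = 2 * (\<Sum>b\<in>Basis. 10 * e1 m b + 4 * e2 m b + 4 * e3 m b)" for m
  show ?thesis
  proof (rule that)
    have "e \<longlonglongrightarrow> 2 * (\<Sum>b\<in>(Basis::'a set). 10 * 0 + 4 * 0 + 4 * 0)"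
      unfolding e_def by (intro tendsto_intros l1 l2 l3)
    then show "e \<longlonglongrightarrow> 0" by simp
    fix m
    have "(\<Sum>b\<in>Basis. LBINT x. \<rho> x * (\<phi> x)\<^sup>2 * (mh_pd m b x)\<^sup>2)
      \<le> 2 * (\<Sum>b\<in>Basis. 5 * (LBINT x. \<rho> x * (pd b \<phi> x)\<^sup>2 * (mh m x)\<^sup>2) + 2 * (LBINT x. (\<phi> x)\<^sup>2 * (flux_err m b x)\<^sup>2 * exp (U x)))"
      using caccioppoli[OF \<phi>, of m] by simp
    also have "\<dots> \<le> 2 * (\<Sum>b\<in>Basis. 10 * (\<integral>x. (pd b \<phi> x)\<^sup>2 * (h x)\<^sup>2 \<partial>\<mu>) + (10 * e1 m b + 4 * e2 m b + 4 * e3 m b))"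
    proof (intro mult_left_mono sum_mono)
      fix b :: 'a assume b: "b \<in> Basis"
      show "5 * (LBINT x. \<rho> x * (pd b \<phi> x)\<^sup>2 * (mh m x)\<^sup>2) + 2 * (LBINT x. (\<phi> x)\<^sup>2 * (flux_err m b x)\<^sup>2 * exp (U x))
        \<le> 10 * (\<integral>x. (pd b \<phi> x)\<^sup>2 * (h x)\<^sup>2 \<partial>\<mu>) + (10 * e1 m b + 4 * e2 m b + 4 * e3 m b)"
        using b1[OF b, of m] b2[OF b, of m] by linarith
    qed simp
    also have "\<dots> = 20 * (\<Sum>b\<in>Basis. \<integral>x. (pd b \<phi> x)\<^sup>2 * (h x)\<^sup>2 \<partial>\<mu>) + e m"
      unfolding e_def sum.distrib by (simp add: sum_distrib_left)
    finally show "(\<Sum>b\<in>Basis. LBINT x. \<rho> x * (\<phi> x)\<^sup>2 * (mh_pd m b x)\<^sup>2) \<le> 20 * (\<Sum>b\<in>Basis. \<integral>x. (pd b \<phi> x)\<^sup>2 * (h x)\<^sup>2 \<partial>\<mu>) + e m" .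
  qed
qed

end

section \<open>Weak solutions are constant\<close>

lemma test_function_bump1: "test_function (bump :: 'a::euclidean_space \<Rightarrow> real)"
  using test_function_bump[of 1, where 'a='a] by simp

text \<open>Cutoffs whose gradients tend to zero uniformly while the functions approach \<open>1\<close> locally.\<close>
definition spread_bump :: "nat \<Rightarrow> 'a::euclidean_space \<Rightarrow> real" where
  "spread_bump n x = (1 / bump (0::'a)) * bump ((1 / real (Suc n)) *\<^sub>R x)"

lemma test_function_spread_bump: "test_function (spread_bump n)"
  unfolding spread_bump_def[abs_def] by (intro test_function_cmult test_function_bump) simp

lemma spread_bump_pd_bound:
  obtains C where "C \<ge> 0" "\<And>n b x. b \<in> Basis \<Longrightarrow> \<bar>pd b (spread_bump n) (x::'a::euclidean_space)\<bar> \<le> C / real (Suc n)"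
proof -
  define I where "I = 1 / bump (0::'a)"
  have I: "I > 0" unfolding I_def using bump_0 by simp
  have "\<exists>B. \<forall>x. \<bar>pd b bump x\<bar> \<le> B" if "b \<in> Basis" for b :: 'a
    using Cc_boundE[OF test_function_Cc[OF test_function_pd[OF test_function_bump1 that]]] by metis
  then obtain B where B: "\<And>b x. b \<in> Basis \<Longrightarrow> \<bar>pd b bump (x::'a)\<bar> \<le> B b" by metis
  define M where "M = (\<Sum>b\<in>(Basis::'a set). \<bar>B b\<bar>)"
  have BM: "B b \<le> M" if "b \<in> Basis" for b
    using member_le_sum[OF that, of "\<lambda>b. \<bar>B b\<bar>"] by (simp add: M_def)
  have "\<bar>pd b (spread_bump n) x\<bar> \<le> (I * M) / real (Suc n)" if b: "b \<in> Basis" for n b and x :: 'a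
  proof -
    define s where "s = 1 / real (Suc n)"
    have "pd b (spread_bump n) = (\<lambda>x::'a. I * (s * pd b bump (s *\<^sub>R x)))"
    proof (rule pd_eqI)
      show "(spread_bump n :: 'a \<Rightarrow> real) differentiable_on UNIV"
        by (intro smooth_differentiable test_function_smooth test_function_spread_bump)
      show "dd b (spread_bump n) (\<lambda>x::'a. I * (s * pd b bump (s *\<^sub>R x)))"
        unfolding spread_bump_def[abs_def] I_def s_def
        by (intro dd_cmult dd_scale smooth_dd test_function_smooth test_function_bump1)
    qed
    then have "\<bar>pd b (spread_bump n) x\<bar> = I * s * \<bar>pd b bump (s *\<^sub>R x)\<bar>"
      using I by (simp add: s_def abs_mult)
    also have "\<dots> \<le> I * s * M"
      using B[OF b, of "s *\<^sub>R x"] BM[OF b] I by (intro mult_left_mono) (auto simp: s_def)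
    finally show ?thesis by (simp add: s_def)
  qed
  moreover have "I * M \<ge> 0" using I by (simp add: M_def sum_nonneg)
  ultimately show ?thesis using that by blast
qed

lemma spread_bump_lower_bound:
  "eventually (\<lambda>n. \<forall>x::'a::euclidean_space. norm x \<le> R \<longrightarrow> spread_bump n x \<ge> 1 / 2) sequentially"
proof -
  have "continuous_on UNIV (bump :: 'a \<Rightarrow> real)" by (intro Cc_cont test_function_Cc test_function_bump1)
  then have "isCont (bump :: 'a \<Rightarrow> real) 0" by (simp add: continuous_on_eq_continuous_at)
  then have cd: "\<forall>e>0. \<exists>d>0. \<forall>y::'a. dist y 0 < d \<longrightarrow> dist (bump y) (bump (0::'a)) < e"
    unfolding continuous_at_eps_delta .
  have b0: "bump (0::'a) > 0" by (rule bump_0)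
  have "bump (0::'a) / 2 > 0" using b0 by simp
  then have "\<exists>d>0. \<forall>y::'a. dist y 0 < d \<longrightarrow> dist (bump y) (bump (0::'a)) < bump (0::'a) / 2" by (rule cd[rule_format])
  then obtain \<delta> where \<delta>': "\<delta> > 0 \<and> (\<forall>y::'a. dist y 0 < \<delta> \<longrightarrow> dist (bump y) (bump (0::'a)) < bump (0::'a) / 2)"
    by (rule exE)
  then have \<delta>: "\<delta> > 0" "\<And>y::'a. dist y 0 < \<delta> \<Longrightarrow> dist (bump y) (bump (0::'a)) < bump (0::'a) / 2"
    by auto
  obtain N where N: "R / \<delta> < real N" using reals_Archimedean2 by blast
  show ?thesis
  proof (rule eventually_sequentiallyI[of N], intro allI impI)
    fix n and x :: 'a assume n: "N \<le> n" and x: "norm x \<le> R"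
    have "R / \<delta> < real (Suc n)" using N n by linarith
    then have "norm x < real (Suc n) * \<delta>" using x \<delta>(1) by (simp add: pos_divide_less_eq)
    then have "norm x / real (Suc n) < \<delta>" by (simp add: pos_divide_less_eq mult.commute)
    then have "dist ((1 / real (Suc n)) *\<^sub>R x) 0 < \<delta>" by simp
    then have "dist (bump ((1 / real (Suc n)) *\<^sub>R x)) (bump (0::'a)) < bump (0::'a) / 2" by (rule \<delta>(2))
    then have "bump ((1 / real (Suc n)) *\<^sub>R x) \<ge> bump (0::'a) / 2" unfolding dist_real_def by linarith
    then show "1 / 2 \<le> spread_bump n x" unfolding spread_bump_def using b0 by (simp add: field_simps)
  qed
qed

context weak_solution
begin

text \<open>The weak derivative of \<open>h\<close> against \<open>\<psi>\<close> is the limit of \<open>- \<integral> \<partial>\<^sub>b (mh m) \<psi>\<close>, which Cauchy-Schwarz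
and the Caccioppoli estimate control wherever the cutoff \<open>\<phi>\<close> is bounded below.\<close>
lemma weak_gradient_bound:
  assumes \<psi>: "test_function \<psi>" and b: "b \<in> Basis" and \<phi>: "test_function \<phi>"
    and low: "\<And>x. \<psi> x \<noteq> 0 \<Longrightarrow> \<phi> x \<ge> 1 / 2"
  shows "(LBINT x. h x * pd b \<psi> x)\<^sup>2
    \<le> 80 * (LBINT x. (\<psi> x)\<^sup>2 * exp (U x)) * (\<Sum>b\<in>Basis. \<integral>x. (pd b \<phi> x)\<^sup>2 * (h x)\<^sup>2 \<partial>\<mu>)"
proof -
  define S where "S = (\<Sum>b\<in>Basis. \<integral>x. (pd b \<phi> x)\<^sup>2 * (h x)\<^sup>2 \<partial>\<mu>)"
  define C where "C = (LBINT x. (\<psi> x)\<^sup>2 * exp (U x))"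
  obtain e where e: "e \<longlonglongrightarrow> 0"
    "\<And>m. (\<Sum>b\<in>Basis. LBINT x. \<rho> x * (\<phi> x)\<^sup>2 * (mh_pd m b x)\<^sup>2) \<le> 20 * S + e m"
    using caccioppoli_lim[OF \<phi>] unfolding S_def by blast
  note C\<psi> = test_function_Cc[OF \<psi>] and C\<phi> = test_function_Cc[OF \<phi>]
  have Cp: "Cc (pd b \<psi>)" by (intro test_function_Cc test_function_pd \<psi> b)
  have [measurable]: "\<psi> \<in> borel_measurable borel" "\<phi> \<in> borel_measurable borel"
    using C\<psi> C\<phi> by (auto intro: Cc_measurable)
  have [measurable]: "mh_pd m b \<in> borel_measurable borel" for m
    by (intro borel_measurable_continuous_onI cont_mh_pd b)
  have [measurable]: "U \<in> borel_measurable borel" by (intro borel_measurable_continuous_onI contU)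
  have iC: "integrable lborel (\<lambda>x. (\<psi> x)\<^sup>2 * exp (U x))"
    by (intro Cc_integrable Cc_mult2[OF cont_expU] Cc_power2 C\<psi>)
  have bound: "(LBINT x. mh m x * pd b \<psi> x)\<^sup>2 \<le> (20 * S + e m) * (4 * C)" for m
  proof -
    have "(LBINT x. mh_pd m b x * \<psi> x + mh m x * pd b \<psi> x) = 0"
      by (rule integral_dd_eq_0[OF dd_mult[OF dd_mh[OF b] smooth_dd[OF test_function_smooth[OF \<psi>]]]])
         (intro Cc_mult1 cont_mh C\<psi> continuous_on_add continuous_on_mult cont_mh_pd b Cc_cont Cp)+
    moreover have "integrable lborel (\<lambda>x. mh_pd m b x * \<psi> x)" "integrable lborel (\<lambda>x. mh m x * pd b \<psi> x)"
      by (intro Cc_integrable Cc_mult1 cont_mh cont_mh_pd C\<psi> Cp b)+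
    ultimately have "(LBINT x. mh m x * pd b \<psi> x)\<^sup>2 = (LBINT x. mh_pd m b x * \<psi> x)\<^sup>2"
      by (simp add: add_eq_0_iff)
    \<comment> \<open>the weights are split so that the square of \<open>f\<close> is the integrand of the Caccioppoli estimate; dividing by \<open>\<phi>\<close> is harmless as it is at least \<open>1/2\<close> where \<open>\<psi>\<close> does not vanish\<close>
    define f where "f x = \<phi> x * exp (- U x / 2) * mh_pd m b x" for x
    define g where "g x = \<psi> x * exp (U x / 2) / \<phi> x" for x
    have [measurable]: "f \<in> borel_measurable borel" "g \<in> borel_measurable borel"
      unfolding f_def[abs_def] g_def[abs_def] by measurable
    have fg: "f x * g x = mh_pd m b x * \<psi> x" for x
    proof (cases "\<psi> x = 0")
      case False
      then have "\<phi> x \<noteq> 0" using low[of x] by auto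
      moreover have "exp (- U x / 2) * exp (U x / 2) = 1" by (simp flip: exp_add)
      ultimately show ?thesis unfolding f_def g_def by (simp add: field_simps exp_minus)
    qed (simp add: f_def g_def)
    have f2: "(f x)\<^sup>2 = \<rho> x * (\<phi> x)\<^sup>2 * (mh_pd m b x)\<^sup>2" for x
      unfolding f_def power_mult_distrib by (simp add: power2_eq_square flip: exp_add)
    have sq: "continuous_on UNIV f \<Longrightarrow> continuous_on UNIV (\<lambda>x. (f x)\<^sup>2)" for f :: "'a \<Rightarrow> real" by (intro continuous_intros)
    have if2: "integrable lborel (\<lambda>x. \<rho> x * (\<phi> x)\<^sup>2 * (mh_pd m b x)\<^sup>2)" if "b \<in> Basis" for b
      by (intro Cc_integrable Cc_mult2[OF sq[OF cont_mh_pd[OF that]]] Cc_mult1[OF cont\<rho>] Cc_power2 C\<phi>)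
    have g2: "(g x)\<^sup>2 \<le> 4 * ((\<psi> x)\<^sup>2 * exp (U x))" for x
    proof (cases "\<psi> x = 0")
      case False
      then have p: "\<phi> x \<ge> 1 / 2" using low[of x] by auto
      then have "(1 / 2)\<^sup>2 \<le> (\<phi> x)\<^sup>2" by (intro power_mono) auto
      then have "1 \<le> 4 * (\<phi> x)\<^sup>2" by (simp add: power2_eq_square)
      then have "(\<psi> x)\<^sup>2 * exp (U x) * 1 \<le> (\<psi> x)\<^sup>2 * exp (U x) * (4 * (\<phi> x)\<^sup>2)" by (intro mult_left_mono) auto
      moreover have "(g x)\<^sup>2 = (\<psi> x)\<^sup>2 * exp (U x) / (\<phi> x)\<^sup>2"
        unfolding g_def power_mult_distrib power_divide by (simp add: power2_eq_square flip: exp_add)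
      moreover have "(\<phi> x)\<^sup>2 > 0" using p by simp
      ultimately show ?thesis by (simp add: pos_divide_le_eq mult_ac)
    qed (simp add: g_def)
    have ig2: "integrable lborel (\<lambda>x. (g x)\<^sup>2)"
      by (rule Bochner_Integration.integrable_bound[OF integrable_mult_right[OF iC, of 4]])
         (auto intro!: AE_I2 order_trans[OF g2])
    have "(LBINT x. f x * g x)\<^sup>2 \<le> (LBINT x. (f x)\<^sup>2) * (LBINT x. (g x)\<^sup>2)"
      by (rule Cauchy_Schwarz_integral) (use ig2 if2[OF b] in \<open>auto simp: f2\<close>)
    also have "\<dots> \<le> (20 * S + e m) * (4 * C)"
    proof (rule mult_mono)
      have "(LBINT x. (f x)\<^sup>2) \<le> (\<Sum>b\<in>Basis. LBINT x. \<rho> x * (\<phi> x)\<^sup>2 * (mh_pd m b x)\<^sup>2)"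
        unfolding f2 by (rule member_le_sum[OF b]) (auto intro!: Bochner_Integration.integral_nonneg)
      then show "(LBINT x. (f x)\<^sup>2) \<le> 20 * S + e m" using e(2)[of m] by linarith
      then show "0 \<le> 20 * S + e m" by (rule order_trans[rotated]) simp
      have "(LBINT x. (g x)\<^sup>2) \<le> (LBINT x. 4 * ((\<psi> x)\<^sup>2 * exp (U x)))"
        by (rule integral_mono[OF ig2 integrable_mult_right[OF iC] g2])
      then show "(LBINT x. (g x)\<^sup>2) \<le> 4 * C" by (simp add: C_def)
    qed simp
    finally show ?thesis unfolding fg using \<open>_ = (LBINT x. mh_pd m b x * \<psi> x)\<^sup>2\<close> by simp
  qed
  have "(\<lambda>m. LBINT x. conv H (moll m) x * (exp (U x) * pd b \<psi> x)) \<longlonglongrightarrow> (LBINT x. h x * \<rho> x * (exp (U x) * pd b \<psi> x))"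
    by (intro conv_hs_weak cont\<rho> Cc_mult1 cont_expU Cp)
  moreover have "(\<lambda>x. h x * \<rho> x * (exp (U x) * pd b \<psi> x)) = (\<lambda>x. h x * pd b \<psi> x)"
    by (simp add: exp_minus fun_eq_iff)
  ultimately have "(\<lambda>m. LBINT x. mh m x * pd b \<psi> x) \<longlonglongrightarrow> (LBINT x. h x * pd b \<psi> x)"
    by (simp add: mh_def mult.assoc)
  then have "(\<lambda>m. (LBINT x. mh m x * pd b \<psi> x)\<^sup>2) \<longlonglongrightarrow> (LBINT x. h x * pd b \<psi> x)\<^sup>2"
    by (intro tendsto_intros)
  moreover have "(\<lambda>m. (20 * S + e m) * (4 * C)) \<longlonglongrightarrow> (20 * S + 0) * (4 * C)"
    by (intro tendsto_intros e)
  ultimately have "(LBINT x. h x * pd b \<psi> x)\<^sup>2 \<le> (20 * S + 0) * (4 * C)"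
    using bound by (intro LIMSEQ_le[of "\<lambda>m. (LBINT x. mh m x * pd b \<psi> x)\<^sup>2"]) auto
  then show ?thesis by (simp add: S_def C_def mult_ac)
qed

lemma weak_gradient_zero:
  assumes \<psi>: "test_function \<psi>" and b: "b \<in> Basis"
  shows "(LBINT x. h x * pd b \<psi> x) = 0"
proof -
  obtain R where R: "\<And>x. norm x > R \<Longrightarrow> \<psi> x = 0" using Cc_supportE[OF test_function_Cc[OF \<psi>]] by blast
  obtain C where C: "C \<ge> 0" "\<And>n b x. b \<in> Basis \<Longrightarrow> \<bar>pd b (spread_bump n) (x::'a)\<bar> \<le> C / real (Suc n)"
    using spread_bump_pd_bound[where 'a='a] by blast
  define N where "N = (\<integral>x. (h x)\<^sup>2 \<partial>\<mu>)"
  define P where "P = (LBINT x. (\<psi> x)\<^sup>2 * exp (U x))"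
  have P: "P \<ge> 0" unfolding P_def by (intro Bochner_Integration.integral_nonneg) simp
  have S: "(\<Sum>b\<in>Basis. \<integral>x. (pd b (spread_bump n) x)\<^sup>2 * (h x)\<^sup>2 \<partial>\<mu>) \<le> real DIM('a) * ((C / real (Suc n))\<^sup>2 * N)" for n
  proof (rule order_trans[OF sum_bounded_above[where K="(C / real (Suc n))\<^sup>2 * N"]])
    fix c :: 'a assume c: "c \<in> Basis"
    have [measurable]: "pd c (spread_bump n) \<in> borel_measurable borel"
      by (intro Cc_measurable test_function_Cc test_function_pd test_function_spread_bump c)
    have le: "(pd c (spread_bump n) x)\<^sup>2 * (h x)\<^sup>2 \<le> (C / real (Suc n))\<^sup>2 * (h x)\<^sup>2" for x
    proof (rule mult_right_mono)
      show "(pd c (spread_bump n) x)\<^sup>2 \<le> (C / real (Suc n))\<^sup>2"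
        unfolding abs_le_square_iff[symmetric] using C(2)[OF c, of n x] C(1) by (simp del: of_nat_Suc)
    qed simp
    have i: "integrable \<mu> (\<lambda>x. (C / real (Suc n))\<^sup>2 * (h x)\<^sup>2)" using h2 by simp
    have "integrable \<mu> (\<lambda>x. (pd c (spread_bump n) x)\<^sup>2 * (h x)\<^sup>2)"
      by (rule Bochner_Integration.integrable_bound[OF i]) (measurable, rule AE_I2, use le in \<open>simp del: of_nat_Suc\<close>)
    from integral_mono[OF this i le]
    show "(\<integral>x. (pd c (spread_bump n) x)\<^sup>2 * (h x)\<^sup>2 \<partial>\<mu>) \<le> (C / real (Suc n))\<^sup>2 * N" by (simp add: N_def)
  qed simp
  define T where "T = (LBINT x. h x * pd b \<psi> x)\<^sup>2"
  have "eventually (\<lambda>n. T \<le> 80 * P * (real DIM('a) * ((C / real (Suc n))\<^sup>2 * N))) sequentially"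
    using spread_bump_lower_bound[of R, where 'a='a]
  proof eventually_elim
    case (elim n)
    have "T \<le> 80 * P * (\<Sum>b\<in>Basis. \<integral>x. (pd b (spread_bump n) x)\<^sup>2 * (h x)\<^sup>2 \<partial>\<mu>)"
      unfolding T_def P_def
    proof (rule weak_gradient_bound[OF \<psi> b test_function_spread_bump])
      fix x assume "\<psi> x \<noteq> 0"
      then show "1 / 2 \<le> spread_bump n x" using R[of x] elim by force
    qed
    also have "\<dots> \<le> 80 * P * (real DIM('a) * ((C / real (Suc n))\<^sup>2 * N))"
      using P by (intro mult_left_mono S) auto
    finally show ?case .
  qed
  moreover have "(\<lambda>n. C / real (Suc n)) \<longlonglongrightarrow> 0"
    using tendsto_mult_right_zero[OF LIMSEQ_inverse_real_of_nat, of C] by (simp add: divide_inverse)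
  then have "(\<lambda>n. 80 * P * (real DIM('a) * ((C / real (Suc n))\<^sup>2 * N))) \<longlonglongrightarrow> 80 * P * (real DIM('a) * (0\<^sup>2 * N))"
    by (intro tendsto_intros)
  ultimately have "T \<le> 80 * P * (real DIM('a) * (0\<^sup>2 * N))"
    by (intro tendsto_lowerbound) auto
  then show ?thesis by (simp add: T_def)
qed

text \<open>All directional derivatives of the convolution vanish, because they are weak derivatives of \<open>h\<close>
tested with reflected kernels.\<close>
lemma conv_h_constant:
  assumes \<eta>: "test_function \<eta>" shows "conv h \<eta> x = conv h \<eta> 0"
proof -
  note s\<eta> = test_function_smooth[OF \<eta>]
  have lin: "pd x f = (\<lambda>y. \<Sum>b\<in>Basis. (x \<bullet> b) * pd b f y)" if "smooth f" for f :: "'a \<Rightarrow> real"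
    using pd_linear_combination[OF smooth_differentiable[OF that]] by (intro ext)
  have c: "continuous_on UNIV (pd x \<eta>)"
    unfolding lin[OF s\<eta>] by (intro continuous_intros smooth_pd_continuous s\<eta>)
  have d: "dd x (conv h \<eta>) (conv h (pd x \<eta>))"
    by (rule conv_dd[OF loc_int_h test_function_Cc[OF \<eta>] smooth_dd[OF s\<eta>] c])
  have zero: "conv h (pd x \<eta>) z = 0" for z
  proof -
    define w where "w y = \<eta> (z - y)" for y
    have w: "test_function w" unfolding w_def[abs_def] by (rule test_function_reflect[OF \<eta>])
    have pw: "pd x w = (\<lambda>y. - pd x \<eta> (z - y))" unfolding w_def[abs_def] by (rule pd_reflect[OF s\<eta>])
    have "conv h (pd x \<eta>) z = (LBINT y. - (h y * pd x w y))" by (simp add: conv_def pw)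
    also have "\<dots> = - (LBINT y. (\<Sum>b\<in>Basis. (x \<bullet> b) * (h y * pd b w y)))"
      by (simp add: lin[OF test_function_smooth[OF w]] sum_distrib_left mult_ac)
    also have "(LBINT y. (\<Sum>b\<in>Basis. (x \<bullet> b) * (h y * pd b w y))) = (\<Sum>b\<in>Basis. (x \<bullet> b) * (LBINT y. h y * pd b w y))"
      by (subst Bochner_Integration.integral_sum)
         (auto intro!: integrable_mult_right loc_int_mult_Cc loc_int_h test_function_Cc test_function_pd w)
    also have "\<dots> = 0" by (simp add: weak_gradient_zero[OF w])
    finally show ?thesis by simp
  qed
  obtain s where "conv h \<eta> (0 + 1 *\<^sub>R x) - conv h \<eta> 0 = 1 * conv h (pd x \<eta>) (0 + s *\<^sub>R x)"
    using dd_MVT[OF d, of 1 0] by (metis one_neq_zero)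
  then show ?thesis by (simp add: zero)
qed

text \<open>The mollifications of \<open>h\<close> are constants \<open>c m\<close> and converge weakly to \<open>h\<close>, so the constants
converge too.\<close>
lemma weakly_constant:
  obtains c where "\<And>\<psi>. Cc \<psi> \<Longrightarrow> (LBINT x. h x * \<psi> x) = c * (LBINT x. \<psi> x)"
proof -
  define c where "c m = conv h (moll m) 0" for m
  have lim: "(\<lambda>m. c m * (LBINT x. \<psi> x)) \<longlonglongrightarrow> (LBINT x. h x * \<psi> x)" if "Cc \<psi>" for \<psi>
  proof -
    have "(\<lambda>m. LBINT x. conv (\<lambda>y. h y * 1) (moll m) x * \<psi> x) \<longlonglongrightarrow> (LBINT x. h x * 1 * \<psi> x)"
      by (rule conv_hs_weak[OF _ that]) simp
    moreover have "conv h (moll m) x = c m" for m x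
      unfolding c_def by (rule conv_h_constant[OF test_function_moll])
    ultimately show ?thesis by simp
  qed
  define c0 where "c0 = (LBINT x. h x * moll 0 x)"
  have "c \<longlonglongrightarrow> c0" using lim[OF Cc_moll[of 0]] by (simp add: integral_moll c0_def)
  then have "(LBINT x. h x * \<psi> x) = c0 * (LBINT x. \<psi> x)" if "Cc \<psi>" for \<psi>
    using LIMSEQ_unique[OF lim[OF that]] by (intro LIMSEQ_unique[OF lim[OF that]] tendsto_intros)
  then show ?thesis using that by blast
qed

text \<open>Here \<open>h\<close> equals the constant \<open>A / Z\<close>. Testing with \<open>gs k\<close> gives the norm, and testing with
cutoffs tending to \<open>1\<close> identifies the constant.\<close>
lemma L2_norm_weak_solution:
  assumes mean: "\<And>k. (\<integral>x. gs k x \<partial>\<mu>) = A"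
  shows "(\<integral>x. (h x)\<^sup>2 \<partial>\<mu>) = A\<^sup>2 / Z"
proof -
  interpret \<mu>: finite_measure \<mu> by (rule finite_measure_\<mu>)
  obtain c where c: "\<And>\<psi>. Cc \<psi> \<Longrightarrow> (LBINT x. h x * \<psi> x) = c * (LBINT x. \<psi> x)"
    using weakly_constant by blast
  have c\<mu>: "(\<integral>x. h x * \<psi> x \<partial>\<mu>) = c * (\<integral>x. \<psi> x \<partial>\<mu>)" if \<psi>: "Cc \<psi>" for \<psi>
  proof -
    have [measurable]: "\<psi> \<in> borel_measurable borel" by (rule Cc_measurable[OF \<psi>])
    show ?thesis using c[OF Cc_mult2[OF cont\<rho> \<psi>]] by (simp add: integral_\<mu> mult.assoc)
  qed
  have meas: "h \<in> borel_measurable \<mu>" "gs k \<in> borel_measurable \<mu>" "(\<lambda>x. 1) \<in> borel_measurable \<mu>" for k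
    by (auto simp: measurable_\<mu>)
  have one: "integrable \<mu> (\<lambda>x. (1::real)\<^sup>2)" by simp
  have gs2: "integrable \<mu> (\<lambda>x. (gs k x)\<^sup>2)" for k by (rule Cc_\<mu>[OF gs])
  have ih: "integrable \<mu> h" using integrable_product_L2[OF meas(1) meas(3) h2 one] by simp
  have "(\<lambda>k. \<integral>x. gs k x * h x \<partial>\<mu>) \<longlonglongrightarrow> (\<integral>x. h x * h x \<partial>\<mu>)"
    by (rule L2_limit_integral[OF meas(1) meas(2) meas(1) h2 gs2 h2 gs_lim])
  moreover have "(\<integral>x. gs k x * h x \<partial>\<mu>) = c * A" for k
    using c\<mu>[OF gs, of k] mean[of k] by (simp add: mult.commute)
  ultimately have 1: "(\<integral>x. h x * h x \<partial>\<mu>) = c * A" by (simp add: LIMSEQ_const_iff)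
  have "(\<lambda>k. \<integral>x. gs k x * 1 \<partial>\<mu>) \<longlonglongrightarrow> (\<integral>x. h x * 1 \<partial>\<mu>)"
    by (rule L2_limit_integral[OF meas(1) meas(2) meas(3) h2 gs2 one gs_lim])
  then have 2: "(\<integral>x. h x \<partial>\<mu>) = A" by (simp add: mean LIMSEQ_const_iff)
  have cutlim: "(\<lambda>n. cut (real n) x) \<longlonglongrightarrow> 1" for x :: 'a
  proof (rule tendsto_eventually)
    obtain N where "norm x \<le> real N" using real_arch_simple by blast
    then show "eventually (\<lambda>n. cut (real n) x = 1) sequentially"
      by (intro eventually_sequentiallyI[of N] cut_eq_1) linarith
  qed
  have [measurable]: "(cut R :: 'a \<Rightarrow> real) \<in> borel_measurable borel" for R by (rule Cc_measurable[OF Cc_cut])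
  have L: "(\<lambda>n. \<integral>x. f x * cut (real n) x \<partial>\<mu>) \<longlonglongrightarrow> (\<integral>x. f x \<partial>\<mu>)" if f: "integrable \<mu> f" for f :: "'a \<Rightarrow> real"
  proof (rule integral_dominated_convergence[where w="\<lambda>x. \<bar>f x\<bar>"])
    have [measurable]: "f \<in> borel_measurable borel" using f by (auto simp: measurable_\<mu>)
    show "f \<in> borel_measurable \<mu>" "\<And>n. (\<lambda>x. f x * cut (real n) x) \<in> borel_measurable \<mu>" by (auto simp: measurable_\<mu>)
    show "AE x in \<mu>. (\<lambda>n. f x * cut (real n) x) \<longlonglongrightarrow> f x"
    proof (rule AE_I2)
      fix x
      have "(\<lambda>n. f x * cut (real n) x) \<longlonglongrightarrow> f x * 1" by (intro tendsto_intros cutlim)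
      then show "(\<lambda>n. f x * cut (real n) x) \<longlonglongrightarrow> f x" by simp
    qed
    show "AE x in \<mu>. norm (f x * cut (real n) x) \<le> \<bar>f x\<bar>" for n
      by (intro AE_I2) (auto simp: abs_mult cut_bounds intro!: mult_right_le_one_le)
  qed (use f in auto)
  have "(\<lambda>n. c * (\<integral>x. 1 * cut (real n) x \<partial>\<mu>)) \<longlonglongrightarrow> c * (\<integral>x. 1 \<partial>\<mu>)" by (intro tendsto_intros L) simp
  moreover have "(\<lambda>n. c * (\<integral>x. 1 * cut (real n) x \<partial>\<mu>)) \<longlonglongrightarrow> (\<integral>x. h x \<partial>\<mu>)"
    using L[OF ih] c\<mu>[OF Cc_cut] by simp
  ultimately have "(\<integral>x. h x \<partial>\<mu>) = c * (\<integral>x. 1 \<partial>\<mu>)" using LIMSEQ_unique by blast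
  moreover have "(\<integral>x. 1 \<partial>\<mu>) = Z" by (subst integral_\<mu>) (auto simp: partition_const_def)
  ultimately have "A = c * Z" using 2 by simp
  then show ?thesis using 1 Z_pos by (simp add: power2_eq_square)
qed

end

context smooth_weight
begin

text \<open>The duality argument. The squared norm of \<open>f + L u\<close> is at least \<open>\<integral> f\<^sup>2 \<rho> - energy f / \<kappa>\<close> for every \<open>u\<close>, while
along the minimising sequence it tends to the squared norm of the projection of \<open>f\<close> to the
constants.\<close>
theorem poincare_from_generator_bound:
  assumes \<kappa>: "\<kappa> > 0" and B: "\<And>u. test_function u \<Longrightarrow> \<kappa> * energy u \<le> (LBINT x. (gen U u x)\<^sup>2 * \<rho> x)"
  shows "poincare \<kappa>"
  unfolding poincare_def
proof (intro allI impI)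
  fix f :: "'a \<Rightarrow> real" assume f: "test_function f"
  note Cf = test_function_Cc[OF f]
  have [measurable]: "f \<in> borel_measurable borel" by (rule Cc_measurable[OF Cf])
  obtain h u where h: "h \<in> borel_measurable borel" "integrable \<mu> (\<lambda>x. (h x)\<^sup>2)"
    and u: "\<And>k::nat. test_function (u k)"
    and lim: "(\<lambda>k. \<integral>x. (h x - (f x + gen U (u k) x))\<^sup>2 \<partial>\<mu>) \<longlonglongrightarrow> 0"
    and weak: "\<And>w. test_function w \<Longrightarrow> (\<integral>x. h x * gen U w x \<partial>\<mu>) = 0"
    using generator_residual[OF f] by blast
  define g where "g k x = f x + gen U (u k) x" for k x
  have Cg: "Cc (g k)" for k unfolding g_def[abs_def]
    by (intro Cc_add Cf test_function_Cc test_function_gen smoothU u)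
  interpret weak_solution U h g
    using h lim weak Cg by unfold_locales (auto simp: g_def)
  have CL: "Cc (gen U (u k))" for k by (intro test_function_Cc test_function_gen smoothU u)
  have [measurable]: "gen U (u k) \<in> borel_measurable borel" for k by (rule Cc_measurable[OF CL])
  have mean: "(\<integral>x. g k x \<partial>\<mu>) = (LBINT x. f x * \<rho> x)" for k
    unfolding g_def using Cc_\<mu>(1)[OF Cf] Cc_\<mu>(1)[OF CL]
    by (simp add: integral_\<mu> integral_gen_eq_0[OF u])
  have hn: "(\<integral>x. (h x)\<^sup>2 \<partial>\<mu>) = (LBINT x. f x * \<rho> x)\<^sup>2 / Z"
    by (rule L2_norm_weak_solution[OF mean])
  have lower: "(LBINT x. (f x)\<^sup>2 * \<rho> x) - energy f / \<kappa> \<le> (\<integral>x. (g k x)\<^sup>2 \<partial>\<mu>)" for k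
  proof -
    have i: "integrable lborel (\<lambda>x. (f x)\<^sup>2 * \<rho> x)" "integrable lborel (\<lambda>x. f x * gen U (u k) x * \<rho> x)"
      "integrable lborel (\<lambda>x. (gen U (u k) x)\<^sup>2 * \<rho> x)"
      by (intro integrable_Cc_\<rho> Cc_power2 Cf CL Cc_mult1 Cc_cont[OF Cf])+
    have Cpf: "Cc (pd b f)" "Cc (pd b (u k))" if "b \<in> Basis" for b
      using that f u by (auto intro!: test_function_Cc test_function_pd)
    have ie: "integrable lborel (\<lambda>x. (\<Sum>b\<in>Basis. (pd b f x)\<^sup>2) * \<rho> x)" "integrable lborel (\<lambda>x. (\<Sum>b\<in>Basis. (pd b (u k) x)\<^sup>2) * \<rho> x)"
      "integrable lborel (\<lambda>x. (\<Sum>b\<in>Basis. pd b f x * pd b (u k) x) * \<rho> x)"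
      by (intro integrable_Cc_\<rho> Cc_sum Cc_power2 Cc_mult1 Cpf Cc_cont; assumption)+
    have "(LBINT x. 2 * ((\<Sum>b\<in>Basis. pd b f x * pd b (u k) x) * \<rho> x))
      \<le> (LBINT x. (1 / \<kappa>) * ((\<Sum>b\<in>Basis. (pd b f x)\<^sup>2) * \<rho> x) + \<kappa> * ((\<Sum>b\<in>Basis. (pd b (u k) x)\<^sup>2) * \<rho> x))"
    proof (rule integral_mono)
      fix x
      \<comment> \<open>the parameter \<open>\<kappa>\<close> makes the energy of \<open>u k\<close> cancel against the bound on the generator\<close>
      have ab: "2 * (a * b) \<le> (1 / \<kappa>) * a\<^sup>2 + \<kappa> * b\<^sup>2" for a b :: real
      proof -
        have "0 \<le> (a - \<kappa> * b)\<^sup>2 / \<kappa>" using \<kappa> by simp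
        also have "\<dots> = (1 / \<kappa>) * a\<^sup>2 + \<kappa> * b\<^sup>2 - 2 * (a * b)" using \<kappa> by (simp add: field_simps power2_eq_square)
        finally show ?thesis by simp
      qed
      have "2 * (\<Sum>b\<in>Basis. pd b f x * pd b (u k) x) \<le> (1 / \<kappa>) * (\<Sum>b\<in>Basis. (pd b f x)\<^sup>2) + \<kappa> * (\<Sum>b\<in>Basis. (pd b (u k) x)\<^sup>2)"
        unfolding sum_distrib_left sum.distrib[symmetric] by (intro sum_mono ab)
      then have "2 * (\<Sum>b\<in>Basis. pd b f x * pd b (u k) x) * \<rho> x \<le> ((1 / \<kappa>) * (\<Sum>b\<in>Basis. (pd b f x)\<^sup>2) + \<kappa> * (\<Sum>b\<in>Basis. (pd b (u k) x)\<^sup>2)) * \<rho> x"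
        by (rule mult_right_mono) simp
      then show "2 * ((\<Sum>b\<in>Basis. pd b f x * pd b (u k) x) * \<rho> x) \<le> (1 / \<kappa>) * ((\<Sum>b\<in>Basis. (pd b f x)\<^sup>2) * \<rho> x) + \<kappa> * ((\<Sum>b\<in>Basis. (pd b (u k) x)\<^sup>2) * \<rho> x)"
        by (simp add: algebra_simps)
    qed (use ie in auto)
    then have cross: "2 * (LBINT x. (\<Sum>b\<in>Basis. pd b f x * pd b (u k) x) * \<rho> x) \<le> energy f / \<kappa> + \<kappa> * energy (u k)"
      using ie by (simp add: energy_def)
    have "(\<integral>x. (g k x)\<^sup>2 \<partial>\<mu>) = (LBINT x. (f x)\<^sup>2 * \<rho> x + 2 * (f x * gen U (u k) x * \<rho> x) + (gen U (u k) x)\<^sup>2 * \<rho> x)"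
      unfolding g_def by (subst integral_\<mu>) (auto simp: power2_eq_square algebra_simps)
    also have "\<dots> = (LBINT x. (f x)\<^sup>2 * \<rho> x) + 2 * (LBINT x. f x * gen U (u k) x * \<rho> x) + (LBINT x. (gen U (u k) x)\<^sup>2 * \<rho> x)"
      using i by simp
    finally show ?thesis using cross B[OF u, of k] integral_mult_gen[OF f u, of k] by simp
  qed
  have h_meas\<mu>: "h \<in> borel_measurable \<mu>" "g k \<in> borel_measurable \<mu>" for k by (auto simp: measurable_\<mu>)
  have g2: "integrable \<mu> (\<lambda>x. (g k x)\<^sup>2)" for k by (rule Cc_\<mu>[OF Cg])
  have "(\<lambda>k. 2 * (\<integral>x. g k x * h x \<partial>\<mu>) - (\<integral>x. (h x)\<^sup>2 \<partial>\<mu>) + (\<integral>x. (h x - g k x)\<^sup>2 \<partial>\<mu>)) \<longlonglongrightarrow> 2 * (\<integral>x. h x * h x \<partial>\<mu>) - (\<integral>x. (h x)\<^sup>2 \<partial>\<mu>) + 0"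
    by (intro tendsto_intros gs_lim L2_limit_integral[OF h_meas\<mu>(1) h_meas\<mu>(2) h_meas\<mu>(1) h2 g2 h2 gs_lim])
  moreover have "(\<integral>x. (g k x)\<^sup>2 \<partial>\<mu>) = 2 * (\<integral>x. g k x * h x \<partial>\<mu>) - (\<integral>x. (h x)\<^sup>2 \<partial>\<mu>) + (\<integral>x. (h x - g k x)\<^sup>2 \<partial>\<mu>)" for k
  proof -
    have "(\<integral>x. (g k x)\<^sup>2 \<partial>\<mu>) = (\<integral>x. 2 * (g k x * h x) - (h x)\<^sup>2 + (h x - g k x)\<^sup>2 \<partial>\<mu>)"
      by (simp add: power2_eq_square algebra_simps)
    also have "\<dots> = 2 * (\<integral>x. g k x * h x \<partial>\<mu>) - (\<integral>x. (h x)\<^sup>2 \<partial>\<mu>) + (\<integral>x. (h x - g k x)\<^sup>2 \<partial>\<mu>)"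
      using h2 h_gs2 integrable_product_L2[OF h_meas\<mu>(2) h_meas\<mu>(1) g2 h2] by simp
    finally show ?thesis .
  qed
  ultimately have "(\<lambda>k. \<integral>x. (g k x)\<^sup>2 \<partial>\<mu>) \<longlonglongrightarrow> (\<integral>x. (h x)\<^sup>2 \<partial>\<mu>)"
    by (simp add: power2_eq_square)
  then have "(LBINT x. (f x)\<^sup>2 * \<rho> x) - energy f / \<kappa> \<le> (\<integral>x. (h x)\<^sup>2 \<partial>\<mu>)"
    using lower by (intro LIMSEQ_le_const) auto
  then have "wvar f \<le> energy f / \<kappa>" unfolding hn wvar_def by simp
  then show "\<kappa> * wvar f \<le> energy f" using \<kappa> by (simp add: field_simps)
qed

end

section \<open>The modified Hessian\<close>

lemma cond_potential_eq_line: "cond_potential U x i = line U (axis i 1) x"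
proof -
  have "(\<chi> j. if j = i then t else x $ j) = x - (x \<bullet> axis i 1) *\<^sub>R axis i 1 + t *\<^sub>R axis i 1" for t
  proof -
    have "x \<bullet> axis i 1 = x $ i" by (simp add: inner_axis)
    then show ?thesis by (simp add: vec_eq_iff axis_def)
  qed
  then show ?thesis by (auto simp: cond_potential_def line_def fun_eq_iff)
qed

lemma sum_Basis_vec: "(\<Sum>b\<in>(Basis :: (real ^ 'n) set). f b) = (\<Sum>i\<in>UNIV. f (axis i 1))"
proof -
  have "(Basis :: (real ^ 'n) set) = range (\<lambda>i. axis i 1)" by (auto simp: Basis_vec_def)
  moreover have "inj (\<lambda>i. axis i (1::real) :: real ^ 'n)" by (auto simp: inj_on_def axis_eq_axis)
  ultimately show ?thesis by (subst \<open>Basis = _\<close>, subst sum.reindex) auto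
qed

text \<open>Symmetry is what makes the real eigenvalues of the matrix exist and control its form.\<close>
lemma Hess_tilde_symmetric:
  assumes "smooth U" shows "transpose (Hess_tilde U x) = Hess_tilde U x"
proof -
  have "partial2 i j U = partial2 j i U" for i j
    unfolding partial2_def by (intro smooth_pd_commute assms axis_in_Basis_iff[THEN iffD2]) auto
  then show ?thesis by (simp add: transpose_def Hess_tilde_def vec_eq_iff)
qed

lemma Hess_tilde_form:
  "v \<bullet> (Hess_tilde U x *v v) = (\<Sum>i\<in>UNIV. cond_gap U x i * (v $ i)\<^sup>2) + (\<Sum>i\<in>UNIV. \<Sum>j\<in>UNIV - {i}. partial2 i j U x * v $ i * v $ j)"
proof -
  have "v \<bullet> (Hess_tilde U x *v v) = (\<Sum>i\<in>UNIV. v $ i * (\<Sum>j\<in>UNIV. Hess_tilde U x $ i $ j * v $ j))"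
    by (simp add: inner_vec_def matrix_vector_mult_def)
  also have "\<dots> = (\<Sum>i\<in>UNIV. cond_gap U x i * (v $ i)\<^sup>2 + (\<Sum>j\<in>UNIV - {i}. partial2 i j U x * v $ i * v $ j))"
  proof (rule sum.cong[OF refl])
    fix i
    have "(\<Sum>j\<in>UNIV. Hess_tilde U x $ i $ j * v $ j) = cond_gap U x i * v $ i + (\<Sum>j\<in>UNIV - {i}. Hess_tilde U x $ i $ j * v $ j)"
      by (subst sum.remove[of UNIV i]) (auto simp: Hess_tilde_def)
    also have "(\<Sum>j\<in>UNIV - {i}. Hess_tilde U x $ i $ j * v $ j) = (\<Sum>j\<in>UNIV - {i}. partial2 i j U x * v $ j)"
      by (intro sum.cong) (auto simp: Hess_tilde_def)
    finally show "v $ i * (\<Sum>j\<in>UNIV. Hess_tilde U x $ i $ j * v $ j) = cond_gap U x i * (v $ i)\<^sup>2 + (\<Sum>j\<in>UNIV - {i}. partial2 i j U x * v $ i * v $ j)"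
      by (simp add: distrib_left sum_distrib_left power2_eq_square mult_ac)
  qed
  finally show ?thesis by (simp add: sum.distrib)
qed

lemma spectral_gap_ge_lambda_min:
  fixes U :: "real ^ 'n \<Rightarrow> real"
  assumes U: "smooth U" "integrable lborel (\<lambda>x. exp (- U x))"
    and cond: "\<And>x i. integrable lborel (\<lambda>t. exp (- cond_potential U x i t))"
    and \<kappa>: "\<kappa> > 0" "\<And>x. \<kappa> \<le> lambda_min (Hess_tilde U x)"
  shows "\<kappa> \<le> spectral_gap U"
proof -
  interpret smooth_weight U using U by unfold_locales
  have "poincare \<kappa>"
  proof (rule poincare_from_generator_bound[OF \<kappa>(1)], rule energy_le_integral_gen_sq)
    fix x b :: "real ^ 'n" assume "b \<in> Basis"
    then obtain i where "b = axis i 1" by (auto simp: Basis_vec_def)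
    then show "integrable lborel (\<lambda>t. exp (- line U b x t))"
      using cond[of x i] by (simp add: cond_potential_eq_line)
  next
    fix x :: "real ^ 'n" and v :: "real ^ 'n \<Rightarrow> real"
    define w where "w = (\<chi> i. v (axis i 1))"
    have off: "(\<Sum>c\<in>Basis - {axis i 1}. g c) = (\<Sum>j\<in>UNIV - {i}. g (axis j 1))" for i and g :: "real ^ 'n \<Rightarrow> real"
      by (simp add: sum_diff1 sum_Basis_vec axis_in_Basis_iff)
    have "\<kappa> * (w \<bullet> w) \<le> lambda_min (Hess_tilde U x) * (w \<bullet> w)" by (intro mult_right_mono \<kappa>) simp
    also have "\<dots> \<le> w \<bullet> (Hess_tilde U x *v w)" by (intro lambda_min_rayleigh Hess_tilde_symmetric U)
    finally have "\<kappa> * (w \<bullet> w) \<le> w \<bullet> (Hess_tilde U x *v w)" .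
    then show "\<kappa> * (\<Sum>b\<in>Basis. (v b)\<^sup>2) \<le> (\<Sum>b\<in>Basis. spectral_gap (line U b x) * (v b)\<^sup>2) + (\<Sum>b\<in>Basis. \<Sum>c\<in>Basis - {b}. pd b (pd c U) x * v b * v c)"
      unfolding Hess_tilde_form
      by (simp add: sum_Basis_vec off w_def inner_vec_def power2_eq_square cond_gap_def cond_potential_eq_line partial2_def)
  qed
  then show ?thesis by (rule le_spectral_gap)
qed

theorem theorem1p1:
  fixes U :: "real ^ 'n \<Rightarrow> real"
  assumes "smooth U"
    and "integrable lborel (\<lambda>x. exp (- U x))"
    and "\<And>x i. integrable lborel (\<lambda>t. exp (- cond_potential U x i t))"
  shows "ereal (spectral_gap U) \<ge> (INF x. ereal (lambda_min (Hess_tilde U x))) \<and>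
    (INF x. ereal (lambda_min (Hess_tilde U x))) \<ge>
      (INF x. SUP w\<in>{w :: 'n \<Rightarrow> real. \<forall>i. 0 < w i}.
        ereal (MIN i. cond_gap U x i - (\<Sum>j\<in>UNIV - {i}. \<bar>partial2 i j U x\<bar> * (w j / w i))))"
proof
  interpret smooth_weight U using assms(1,2) by unfold_locales
  \<comment> \<open>a nonpositive infimum is covered by nonnegativity of the gap, a positive one is a real number\<close>
  let ?I = "INF x. ereal (lambda_min (Hess_tilde U x))"
  show "?I \<le> ereal (spectral_gap U)"
  proof (cases "?I \<le> 0")
    case True
    then show ?thesis using spectral_gap_nonneg by (meson ereal_less_eq(5) order_trans)
  next
    case False
    have le: "?I \<le> ereal (lambda_min (Hess_tilde U x))" for x by (rule INF_lower) simp
    obtain \<kappa> where \<kappa>: "?I = ereal \<kappa>"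
      using False le[of 0] by (cases ?I) auto
    then have "\<kappa> \<le> spectral_gap U"
      using False le by (intro spectral_gap_ge_lambda_min assms) auto
    then show ?thesis by (simp add: \<kappa>)
  qed
  show "(INF x. SUP w\<in>{w :: 'n \<Rightarrow> real. \<forall>i. 0 < w i}.
        ereal (MIN i. cond_gap U x i - (\<Sum>j\<in>UNIV - {i}. \<bar>partial2 i j U x\<bar> * (w j / w i)))) \<le> ?I"
  proof (rule INF_mono')
    fix x
    show "(SUP w\<in>{w :: 'n \<Rightarrow> real. \<forall>i. 0 < w i}.
        ereal (MIN i. cond_gap U x i - (\<Sum>j\<in>UNIV - {i}. \<bar>partial2 i j U x\<bar> * (w j / w i)))) \<le> ereal (lambda_min (Hess_tilde U x))"
    proof (rule SUP_least)
      fix w :: "'n \<Rightarrow> real" assume "w \<in> {w. \<forall>i. 0 < w i}"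
      then have w: "\<And>i. 0 < w i" by simp
      have eq: "Hess_tilde U x $ i $ i - (\<Sum>j\<in>UNIV - {i}. \<bar>Hess_tilde U x $ i $ j\<bar> * (w j / w i))
          = cond_gap U x i - (\<Sum>j\<in>UNIV - {i}. \<bar>partial2 i j U x\<bar> * (w j / w i))" for i
        by (auto simp: Hess_tilde_def intro!: sum.cong)
      show "ereal (MIN i. cond_gap U x i - (\<Sum>j\<in>UNIV - {i}. \<bar>partial2 i j U x\<bar> * (w j / w i))) \<le> ereal (lambda_min (Hess_tilde U x))"
        using weighted_gershgorin[where w=w, OF lambda_min_eigenvalue[OF Hess_tilde_symmetric[OF assms(1), of x]]] w
        unfolding eq by (simp only: ereal_less_eq)
    qed
  qed
qed

end
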